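(* Let $K$ be an arbitrary field and let $C=\prod_{j=1}^s f_{1,j}+\prod_{j=1}^s f_{2,j}$ be a $\Sigma\Pi\Sigma\Pi_\delta(2,s,n)$ circuit over $K$, i.e. each $f_{i,j}\in K[x_1,\dots,x_n]$ is a polynomial (given as a sum of monomials) of degree at most $\delta$. There is a deterministic blackbox test that decides whether $C$ computes the zero polynomial in time $\mathrm{poly}(\delta s n)^{\delta^2}$.
   Context: A $\Sigma\Pi\Sigma\Pi_\delta(k,s,n)$ circuit is an expression $\sum_{i=1}^k\prod_{j=1}^s f_{i,j}$ where the $f_{i,j}$ are sparse $n$-variate polynomials of degree at most $\delta$. A blackbox test may only evaluate the circuit at points (with coordinates in the algebraic closure of $K$ or a sufficiently large extension) and must decide whether it computes the zero polynomial. *)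

theory Defs
  imports
    "HOL-Library.Poly_Mapping"
    "HOL-Computational_Algebra.Polynomial"
    "HOL-Algebra.Algebraic_Closure_Type"
begin

section \<open>Multivariate polynomials and depth-4 circuits\<close>

text \<open>
  A monomial is a finitely supported exponent vector and a polynomial a finitely supported
  coefficient function on monomials.  The variables \<open>x\<^sub>1, \<dots>, x\<^sub>n\<close> are numbered \<open>0, \<dots>, n - 1\<close>.
\<close>

type_synonym 'k mvpoly = "(nat \<Rightarrow>\<^sub>0 nat) \<Rightarrow>\<^sub>0 'k"

definition mvars :: "'k::zero mvpoly \<Rightarrow> nat set" where
  "mvars q = (\<Union>m\<in>Poly_Mapping.keys q. Poly_Mapping.keys m)"

definition monomial_degree :: "(nat \<Rightarrow>\<^sub>0 nat) \<Rightarrow> nat" where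
  "monomial_degree m = (\<Sum>i\<in>Poly_Mapping.keys m. Poly_Mapping.lookup m i)"

text \<open>The zero polynomial is given degree \<open>0\<close>.\<close>

definition total_degree :: "'k::zero mvpoly \<Rightarrow> nat" where
  "total_degree q = Max (insert 0 (monomial_degree ` Poly_Mapping.keys q))"

definition eval_ac :: "'k::field mvpoly \<Rightarrow> (nat \<Rightarrow> 'k alg_closure) \<Rightarrow> 'k alg_closure" where
  "eval_ac q x = (\<Sum>m\<in>Poly_Mapping.keys q. to_ac (Poly_Mapping.lookup q m) * (\<Prod>i\<in>Poly_Mapping.keys m. x i ^ Poly_Mapping.lookup m i))"

text \<open>A circuit with top fan-in \<open>k\<close> is given by its family \<open>f i j\<close>, \<open>1 \<le> i \<le> k\<close>, \<open>1 \<le> j \<le> s\<close>.\<close>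

definition is_SPSP_circuit ::
    "nat \<Rightarrow> nat \<Rightarrow> nat \<Rightarrow> nat \<Rightarrow> (nat \<Rightarrow> nat \<Rightarrow> 'k::field mvpoly) \<Rightarrow> bool" where
  "is_SPSP_circuit \<delta> k s n f \<longleftrightarrow>
     (\<forall>i\<in>{1..k}. \<forall>j\<in>{1..s}. mvars (f i j) \<subseteq> {..<n} \<and> total_degree (f i j) \<le> \<delta>)"

definition SPSP_poly :: "nat \<Rightarrow> nat \<Rightarrow> (nat \<Rightarrow> nat \<Rightarrow> 'k::field mvpoly) \<Rightarrow> 'k mvpoly" where
  "SPSP_poly k s f = (\<Sum>i=1..k. \<Prod>j=1..s. f i j)"


section \<open>Deterministic blackbox algorithms over a field\<close>

text \<open>
  Programs of an algebraic random access machine with two infinite memories, one holding natural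
  numbers and one holding field elements.  Field cells are always addressed indirectly, through
  the content of a number cell.  Numbers can only be changed by one per step, so that (up to
  program constants and inputs) no number exceeds the running time and unit cost is not an
  idealisation for them; field operations are counted at unit cost.  Programs contain no
  constants of the field.

  Two instructions depend on the environment.  \<open>Query i j\<close> evaluates the blackbox at the point
  whose coordinates are stored consecutively from field cell number \<open>N j\<close> on; it is the only
  access to the circuit.  \<open>Supply i j\<close> yields member number \<open>N j\<close> of a given sequence of field
  elements.  Over a finite field the constants \<open>0\<close> and \<open>1\<close> generate only the prime field, so a
  supply of distinct points from an extension has to be provided.
\<close>

datatype prog =
    Skip
  | NConst nat nat
  | NSucc nat
  | NPred nat
  | NCopy nat nat
  | NLoad nat nat
  | NStore nat nat
  | FZero nat
  | FOne nat
  | FCopy nat nat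
  | FAdd nat nat nat
  | FSub nat nat nat
  | FMul nat nat nat
  | FDiv nat nat nat
  | Supply nat nat
  | Query nat nat
  | Seq prog prog
  | IfN nat prog prog
  | IfF nat prog prog
  | WhileN nat prog

type_synonym 'l mem = "(nat \<Rightarrow> nat) \<times> (nat \<Rightarrow> 'l)"

fun atomic_step ::
    "(nat \<Rightarrow> 'l::field) \<Rightarrow> ((nat \<Rightarrow> 'l) \<Rightarrow> 'l) \<Rightarrow> prog \<Rightarrow> 'l mem \<Rightarrow> 'l mem option" where
  "atomic_step e B Skip (N, F) = Some (N, F)"
| "atomic_step e B (NConst i c) (N, F) = Some (N(i := c), F)"
| "atomic_step e B (NSucc i) (N, F) = Some (N(i := N i + 1), F)"
| "atomic_step e B (NPred i) (N, F) = Some (N(i := N i - 1), F)"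
| "atomic_step e B (NCopy i j) (N, F) = Some (N(i := N j), F)"
| "atomic_step e B (NLoad i j) (N, F) = Some (N(i := N (N j)), F)"
| "atomic_step e B (NStore i j) (N, F) = Some (N(N i := N j), F)"
| "atomic_step e B (FZero i) (N, F) = Some (N, F(N i := 0))"
| "atomic_step e B (FOne i) (N, F) = Some (N, F(N i := 1))"
| "atomic_step e B (FCopy i j) (N, F) = Some (N, F(N i := F (N j)))"
| "atomic_step e B (FAdd i j k) (N, F) = Some (N, F(N i := F (N j) + F (N k)))"
| "atomic_step e B (FSub i j k) (N, F) = Some (N, F(N i := F (N j) - F (N k)))"
| "atomic_step e B (FMul i j k) (N, F) = Some (N, F(N i := F (N j) * F (N k)))"
| "atomic_step e B (FDiv i j k) (N, F) = Some (N, F(N i := F (N j) / F (N k)))"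
| "atomic_step e B (Supply i j) (N, F) = Some (N, F(N i := e (N j)))"
| "atomic_step e B (Query i j) (N, F) = Some (N, F(N i := B (\<lambda>k. F (N j + k))))"
| "atomic_step e B _ _ = None"

text \<open>\<open>exec e B P \<sigma> t \<sigma>'\<close>: started in \<open>\<sigma>\<close>, program \<open>P\<close> halts in \<open>\<sigma>'\<close> after exactly \<open>t\<close> steps.\<close>

inductive exec ::
    "(nat \<Rightarrow> 'l::field) \<Rightarrow> ((nat \<Rightarrow> 'l) \<Rightarrow> 'l) \<Rightarrow> prog \<Rightarrow> 'l mem \<Rightarrow> nat \<Rightarrow> 'l mem \<Rightarrow> bool"
  for e B where
  Atomic: "atomic_step e B c \<sigma> = Some \<sigma>' \<Longrightarrow> exec e B c \<sigma> 1 \<sigma>'"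
| Seq: "exec e B P \<sigma> t \<sigma>' \<Longrightarrow> exec e B Q \<sigma>' u \<sigma>'' \<Longrightarrow> exec e B (Seq P Q) \<sigma> (t + u) \<sigma>''"
| IfN_zero: "N i = 0 \<Longrightarrow> exec e B P (N, F) t \<sigma>' \<Longrightarrow> exec e B (IfN i P Q) (N, F) (t + 1) \<sigma>'"
| IfN_nonzero: "N i \<noteq> 0 \<Longrightarrow> exec e B Q (N, F) t \<sigma>' \<Longrightarrow> exec e B (IfN i P Q) (N, F) (t + 1) \<sigma>'"
| IfF_zero: "F (N i) = 0 \<Longrightarrow> exec e B P (N, F) t \<sigma>' \<Longrightarrow> exec e B (IfF i P Q) (N, F) (t + 1) \<sigma>'"
| IfF_nonzero: "F (N i) \<noteq> 0 \<Longrightarrow> exec e B Q (N, F) t \<sigma>' \<Longrightarrow> exec e B (IfF i P Q) (N, F) (t + 1) \<sigma>'"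
| WhileN_stop: "N i = 0 \<Longrightarrow> exec e B (WhileN i P) (N, F) 1 (N, F)"
| WhileN_loop: "N i \<noteq> 0 \<Longrightarrow> exec e B P (N, F) t \<sigma>' \<Longrightarrow> exec e B (WhileN i P) \<sigma>' u \<sigma>''
    \<Longrightarrow> exec e B (WhileN i P) (N, F) (t + u + 1) \<sigma>''"

inductive_cases exec_SeqE: "exec e B (Seq P Q) \<sigma> t \<sigma>'"
inductive_cases exec_IfNE: "exec e B (IfN i P Q) \<sigma> t \<sigma>'"
inductive_cases exec_IfFE: "exec e B (IfF i P Q) \<sigma> t \<sigma>'"
inductive_cases exec_WhileNE: "exec e B (WhileN i P) \<sigma> t \<sigma>'"

lemma exec_atomic:
  assumes "exec e B c \<sigma> t \<tau>" "atomic_step e B c \<sigma> = Some \<sigma>'"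
  shows "t = 1 \<and> \<tau> = \<sigma>'"
  using assms by cases auto

lemma exec_deterministic:
  "exec e B P \<sigma> t \<sigma>' \<Longrightarrow> exec e B P \<sigma> u \<tau> \<Longrightarrow> u = t \<and> \<tau> = \<sigma>'"
proof (induction arbitrary: u \<tau> rule: exec.induct)
  case (Atomic c \<sigma> \<sigma>')
  then show ?case using exec_atomic by blast
next
  case (Seq P \<sigma> t \<sigma>' Q u' \<sigma>'')
  from Seq.prems show ?case
  proof (rule exec_SeqE)
    fix t1 \<rho> t2
    assume a: "u = t1 + t2" "exec e B P \<sigma> t1 \<rho>" "exec e B Q \<rho> t2 \<tau>"
    from a have "t1 = t" "\<rho> = \<sigma>'" using Seq.IH(1)[of t1 \<rho>] by auto
    then show ?thesis using a Seq.IH(2)[of t2 \<tau>] by simp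
  qed (cases \<sigma>, simp)
next
  case (IfN_zero N i P F t \<sigma>' Q)
  from IfN_zero.prems show ?case
    by (rule exec_IfNE) (use IfN_zero.hyps(1) in \<open>auto dest: IfN_zero.IH\<close>)
next
  case (IfN_nonzero N i Q F t \<sigma>' P)
  from IfN_nonzero.prems show ?case
    by (rule exec_IfNE) (use IfN_nonzero.hyps(1) in \<open>auto dest: IfN_nonzero.IH\<close>)
next
  case (IfF_zero F N i P t \<sigma>' Q)
  from IfF_zero.prems show ?case
    by (rule exec_IfFE) (use IfF_zero.hyps(1) in \<open>auto dest: IfF_zero.IH\<close>)
next
  case (IfF_nonzero F N i Q t \<sigma>' P)
  from IfF_nonzero.prems show ?case
    by (rule exec_IfFE) (use IfF_nonzero.hyps(1) in \<open>auto dest: IfF_nonzero.IH\<close>)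
next
  case (WhileN_stop N i P F)
  from WhileN_stop.prems show ?case by (rule exec_WhileNE) (use WhileN_stop in auto)
next
  case (WhileN_loop N i P F t \<sigma>' u' \<sigma>'')
  from WhileN_loop.prems show ?case
  proof (rule exec_WhileNE)
    fix N' F' t1 \<rho> t2
    assume a: "(N, F) = (N', F')" "u = Suc (t1 + t2)"
      "exec e B P (N', F') t1 \<rho>" "exec e B (WhileN i P) \<rho> t2 \<tau>"
    from a have "t1 = t" "\<rho> = \<sigma>'" using WhileN_loop.IH(1)[of t1 \<rho>] by auto
    then show ?thesis using a WhileN_loop.IH(2)[of t2 \<tau>] by simp
  qed (use WhileN_loop.hyps(1) in auto)
qed

definition initial_mem :: "nat \<Rightarrow> nat \<Rightarrow> nat \<Rightarrow> 'l::zero mem" where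
  "initial_mem \<delta> s n = ((\<lambda>_. 0)(0 := \<delta>, 1 := s, 2 := n), (\<lambda>_. 0))"

text \<open>
  The program knows the parameters \<open>\<delta>\<close>, \<open>s\<close>, \<open>n\<close>, sees the polynomial \<open>C\<close> only through its values
  on points over the algebraic closure, and answers in number cell \<open>0\<close>.
\<close>

definition decides_zero_within ::
    "(nat \<Rightarrow> 'k::field alg_closure) \<Rightarrow> prog \<Rightarrow> nat \<Rightarrow> nat \<Rightarrow> nat \<Rightarrow> 'k mvpoly \<Rightarrow> nat \<Rightarrow> bool" where
  "decides_zero_within e P \<delta> s n C T \<longleftrightarrow>
     (\<exists>t N F. exec e (eval_ac C) P (initial_mem \<delta> s n) t (N, F) \<and> t \<le> T \<and>
        N 0 = (if C = 0 then 1 else 0))"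

end

theory Submission
  imports Defs "Jordan_Normal_Form.Determinant"
begin

text \<open>
  Let \<open>L\<close> be the algebraic closure and \<open>W\<^sub>D\<close> the set of points \<open>(\<Sum>k<D. z\<^sub>k * y\<^sub>k ^ i)\<^sub>i\<close> of \<open>L\<^sup>n\<close>.
  A nonzero polynomial of degree at most \<open>D\<close> does not vanish on \<open>W\<^sub>D\<close>.
  If \<open>C = A + B\<close> is nonzero and \<open>A\<close>, \<open>B\<close> are not proportional, unique factorisation gives a prime \<open>g\<close>
  occurring with different multiplicities in \<open>A\<close> and \<open>B\<close>, say \<open>C = g ^ i * (A' + g ^ j * B')\<close> with
  \<open>j > 0\<close> and \<open>A'\<close> a product of polynomials \<open>h\<close> of degree at most \<open>\<delta>\<close> not divisible by \<open>g\<close>.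
  Choose \<open>v \<in> W\<^sub>\<delta>\<close> where the top form of \<open>g\<close> does not vanish.  The resultants of \<open>g (u + t v)\<close> and
  \<open>h (u + t v)\<close> with respect to \<open>t\<close> are nonzero polynomials in \<open>u\<close> of degree at most \<open>2 \<delta>\<^sup>2\<close>, so
  some \<open>u\<close> in \<open>W\<^sub>D\<close>, \<open>D = 2 \<delta>\<^sup>2\<close>, is a zero of none of them.  At a root \<open>t\<close> of \<open>g (u + t v)\<close> the second factor of \<open>C\<close>
  does not vanish, hence \<open>C\<close> does not vanish on the line \<open>u + t v\<close>, which lies in \<open>W\<^sub>D\<close> for \<open>D = 3 \<delta>\<^sup>2\<close>.
  A Kronecker substitution replaces the \<open>6 \<delta>\<^sup>2\<close> parameters \<open>y\<^sub>k\<close>, \<open>z\<^sub>k\<close> by powers of a single one.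
\<close>


subsection \<open>Gauss' lemma for subrings of an integral domain\<close>

text \<open>The obstacle is that the number \<open>s\<close> of factors must stay out of the
  exponent of the running time. Genericity is therefore demanded of one factor at a time, where the
  degrees depend on \<open>\<delta>\<close> only; meeting all demands at once costs nothing, because
  polynomial functions over an infinite field form an integral domain. The parameter
  \<open>s\<close> is felt only through the degree \<open>s * \<delta>\<close> of the circuit, i.e.
  in the base \<open>\<delta> * s * n + 1\<close> of the Kronecker substitution, whereas the number
  of parameters becomes its exponent. The bound \<open>2 * \<delta>\<^sup>2\<close> is the size
  \<open>2 * \<delta>\<close> of a Sylvester matrix times the degree \<open>\<delta>\<close> of its
  entries; the direction \<open>v\<close> costs another
  \<open>\<delta> \<le> \<delta>\<^sup>2\<close> summands. If \<open>A\<close> and \<open>B\<close>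
  are proportional or one of them is 0, then \<open>C\<close> is a multiple of a single product and
  \<open>W\<^sub>\<delta>\<close> already suffices. Unique factorisation is developed for subsets of
  one type, so that a variable can be adjoined without changing the type.\<close>

definition subring_of :: "'a::comm_ring_1 set \<Rightarrow> bool" where
  "subring_of R \<longleftrightarrow> 1 \<in> R \<and> (\<forall>a\<in>R. \<forall>b\<in>R. a - b \<in> R \<and> a * b \<in> R)"

lemma subring_ofD:
  assumes "subring_of R"
  shows "0 \<in> R" "1 \<in> R" "a \<in> R \<Longrightarrow> - a \<in> R"
    "a \<in> R \<Longrightarrow> b \<in> R \<Longrightarrow> a + b \<in> R" "a \<in> R \<Longrightarrow> b \<in> R \<Longrightarrow> a - b \<in> R"
    "a \<in> R \<Longrightarrow> b \<in> R \<Longrightarrow> a * b \<in> R" "a \<in> R \<Longrightarrow> a ^ k \<in> R"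
proof -
  have R: "1 \<in> R" "\<And>a b. a \<in> R \<Longrightarrow> b \<in> R \<Longrightarrow> a - b \<in> R" "\<And>a b. a \<in> R \<Longrightarrow> b \<in> R \<Longrightarrow> a * b \<in> R"
    using assms by (auto simp: subring_of_def)
  from R(2)[OF R(1) R(1)] show 0: "0 \<in> R" by simp
  show "1 \<in> R" by fact
  show neg: "a \<in> R \<Longrightarrow> - a \<in> R" for a using R(2)[OF 0, of a] by simp
  show "a \<in> R \<Longrightarrow> b \<in> R \<Longrightarrow> a - b \<in> R" "a \<in> R \<Longrightarrow> b \<in> R \<Longrightarrow> a * b \<in> R" by (fact R)+
  show "a \<in> R \<Longrightarrow> b \<in> R \<Longrightarrow> a + b \<in> R" using R(2)[OF _ neg, of a b] by simp
  show "a \<in> R \<Longrightarrow> a ^ k \<in> R" by (induction k) (auto simp: R)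
qed

lemma subring_of_sum:
  "subring_of R \<Longrightarrow> (\<And>i. i \<in> I \<Longrightarrow> f i \<in> R) \<Longrightarrow> sum f I \<in> R"
  by (induction I rule: infinite_finite_induct) (auto simp: subring_ofD)

lemma subring_of_prod_list:
  "subring_of R \<Longrightarrow> set xs \<subseteq> R \<Longrightarrow> prod_list xs \<in> R"
  by (induction xs) (auto simp: subring_ofD)

definition dvd_in :: "'a::comm_ring_1 set \<Rightarrow> 'a \<Rightarrow> 'a \<Rightarrow> bool" where
  "dvd_in R a b \<longleftrightarrow> (\<exists>c\<in>R. b = a * c)"

definition prime_in :: "'a::comm_ring_1 set \<Rightarrow> 'a \<Rightarrow> bool" where
  "prime_in R p \<longleftrightarrow> p \<in> R \<and> p \<noteq> 0 \<and> \<not> dvd_in R p 1 \<and>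
     (\<forall>a\<in>R. \<forall>b\<in>R. dvd_in R p (a * b) \<longrightarrow> dvd_in R p a \<or> dvd_in R p b)"

text \<open>Asking for factors that are prime, not merely irreducible, makes uniqueness automatic;
  hence only existence is demanded.\<close>

definition ufd_on :: "'a::comm_ring_1 set \<Rightarrow> bool" where
  "ufd_on R \<longleftrightarrow> subring_of R \<and>
     (\<forall>a\<in>R. a \<noteq> 0 \<longrightarrow> (\<exists>u ps. u \<in> R \<and> dvd_in R u 1 \<and> (\<forall>p\<in>set ps. prime_in R p) \<and> a = u * prod_list ps))"

definition polys_over :: "'a::comm_ring_1 set \<Rightarrow> 'a poly set" where
  "polys_over R = {P. \<forall>i. coeff P i \<in> R}"

lemma dvd_in_mult_left:
  "subring_of R \<Longrightarrow> dvd_in R p a \<Longrightarrow> b \<in> R \<Longrightarrow> dvd_in R p (b * a)"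
  unfolding dvd_in_def by (metis mult.left_commute subring_ofD(6))

lemma dvd_in_trans:
  "subring_of R \<Longrightarrow> dvd_in R a b \<Longrightarrow> dvd_in R b c \<Longrightarrow> dvd_in R a c"
  unfolding dvd_in_def by (metis mult.assoc subring_ofD(6))

lemma dvd_in_diff:
  "subring_of R \<Longrightarrow> dvd_in R p a \<Longrightarrow> dvd_in R p b \<Longrightarrow> dvd_in R p (a - b)"
  unfolding dvd_in_def by (metis right_diff_distrib subring_ofD(5))

lemma dvd_in_zero: "subring_of R \<Longrightarrow> dvd_in R p 0"
  unfolding dvd_in_def using subring_ofD(1) by force

lemma prime_in_dvd_prod_list:
  assumes R: "subring_of R" and p: "prime_in R p" and "dvd_in R p (prod_list xs)" "set xs \<subseteq> R"
  shows "\<exists>x\<in>set xs. dvd_in R p x"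
  using assms(3,4)
proof (induction xs)
  case (Cons x xs)
  then have "x \<in> R" "prod_list xs \<in> R" by (auto simp: R subring_of_prod_list)
  with Cons.prems p have "dvd_in R p x \<or> dvd_in R p (prod_list xs)" unfolding prime_in_def by auto
  with Cons show ?case by auto
qed (use p in \<open>auto simp: prime_in_def\<close>)

lemma subring_of_polys_over:
  assumes "subring_of R"
  shows "subring_of (polys_over R)"
proof -
  note R = subring_ofD[OF assms]
  have "P * Q \<in> polys_over R" if "P \<in> polys_over R" "Q \<in> polys_over R" for P Q
    using that R by (auto simp: polys_over_def coeff_mult intro!: subring_of_sum[OF assms])
  then show ?thesis
    unfolding subring_of_def[of "polys_over R"] using R by (auto simp: polys_over_def)
qed

lemma smult_in_polys_over: "subring_of R \<Longrightarrow> a \<in> R \<Longrightarrow> P \<in> polys_over R \<Longrightarrow> smult a P \<in> polys_over R"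
  by (auto simp: polys_over_def subring_ofD)

lemma const_in_polys_over: "subring_of R \<Longrightarrow> a \<in> R \<Longrightarrow> [:a:] \<in> polys_over R"
  by (auto simp: polys_over_def subring_ofD coeff_pCons split: nat.splits)

lemma monom_in_polys_over: "subring_of R \<Longrightarrow> a \<in> R \<Longrightarrow> monom a k \<in> polys_over R"
  by (auto simp: polys_over_def subring_ofD)

lemma pCons_in_polys_over:
  "pCons a P \<in> polys_over R \<longleftrightarrow> a \<in> R \<and> P \<in> polys_over R"
  by (auto simp: polys_over_def coeff_pCons split: nat.splits)

lemma dvd_in_const_iff:
  assumes "subring_of R"
  shows "dvd_in (polys_over R) [:p:] F \<longleftrightarrow> (\<forall>i. dvd_in R p (coeff F i))" (is "_ \<longleftrightarrow> ?r")
proof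
  assume ?r
  then obtain c where c: "\<And>i. c i \<in> R" "\<And>i. coeff F i = p * c i" unfolding dvd_in_def by metis
  \<comment> \<open>A quotient of the coefficient 0 need not be 0, so the quotients are cut off
    beyond the degree to obtain a polynomial.\<close>
  define c' where "c' i = (if i \<le> degree F then c i else 0)" for i
  have cc: "coeff (Poly (map c' [0..<Suc (degree F)])) i = c' i" for i
    unfolding coeff_Poly_eq by (cases "i < Suc (degree F)") (auto simp: nth_default_def c'_def simp del: upt_Suc)
  have "F = [:p:] * Poly (map c' [0..<Suc (degree F)])"
  proof (rule poly_eqI)
    fix i
    have "coeff (smult p (Poly (map c' [0..<Suc (degree F)]))) i = p * c' i" by (simp only: coeff_smult cc)
    then show "coeff F i = coeff ([:p:] * Poly (map c' [0..<Suc (degree F)])) i"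
      by (simp add: c'_def c(2)[symmetric] coeff_eq_0 del: upt_Suc)
  qed
  moreover have "Poly (map c' [0..<Suc (degree F)]) \<in> polys_over R"
    unfolding polys_over_def mem_Collect_eq cc using c(1) subring_ofD(1)[OF assms] by (auto simp: c'_def)
  ultimately show "dvd_in (polys_over R) [:p:] F" unfolding dvd_in_def by blast
qed (auto simp: dvd_in_def polys_over_def)

text \<open>Gauss' lemma by stripping constant coefficients: \<open>p\<close> divides the product of
  the two constant terms, hence one of them, say \<open>a\<close>; subtracting \<open>a * G\<close>
  and dividing by the variable leaves the smaller product \<open>F' * G\<close>.\<close>

lemma dvd_in_const_mult:
  fixes F G :: "'a::idom poly"
  assumes R: "subring_of R" and p: "prime_in R p"
    and "F \<in> polys_over R" "G \<in> polys_over R" "dvd_in (polys_over R) [:p:] (F * G)"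
  shows "dvd_in (polys_over R) [:p:] F \<or> dvd_in (polys_over R) [:p:] G"
  using assms(3-5)
\<comment> \<open>The extra 1 for a nonzero polynomial makes the measure drop when a nonzero
  constant is reduced to 0, as both have degree 0.\<close>
proof (induction "degree F + degree G + (if F = 0 then 0 else 1) + (if G = 0 then 0 else 1)" arbitrary: F G rule: less_induct)
  case less
  let ?S = "polys_over R"
  have S: "subring_of ?S" by (rule subring_of_polys_over[OF R])
  obtain a F' where F: "F = pCons a F'" by (cases F)
  obtain b G' where G: "G = pCons b G'" by (cases G)
  show ?case
  proof (cases "F = 0 \<or> G = 0")
    case True
    then show ?thesis using dvd_in_zero[OF S] by auto
  next
    case False
    have ab: "a \<in> R" "F' \<in> ?S" "b \<in> R" "G' \<in> ?S" using less.prems F G by (auto simp: pCons_in_polys_over)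
    have "dvd_in R p (coeff (F * G) 0)" using less.prems(3) dvd_in_const_iff[OF R] by blast
    then have "dvd_in R p (a * b)" by (simp add: F G coeff_mult mult.commute)
    then consider "dvd_in R p a" | "dvd_in R p b" using p ab unfolding prime_in_def by blast
    then show ?thesis
    proof cases
      case 1
      have "F * G = smult a G + pCons 0 (F' * G)" by (simp add: F)
      moreover have "dvd_in ?S [:p:] (smult a G)"
        unfolding dvd_in_const_iff[OF R]
      proof
        fix i
        have "coeff G i \<in> R" using less.prems(2) by (simp add: polys_over_def)
        then show "dvd_in R p (coeff (smult a G) i)"
          using dvd_in_mult_left[OF R 1, of "coeff G i"] by (simp add: mult.commute)
      qed
      ultimately have "dvd_in ?S [:p:] (pCons 0 (F' * G))"
        using dvd_in_diff[OF S less.prems(3), of "smult a G"] by simp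
      then have "dvd_in ?S [:p:] (F' * G)"
        unfolding dvd_in_const_iff[OF R] by (metis coeff_pCons_Suc)
      moreover have "degree F' + degree G + (if F' = 0 then 0 else 1) + (if G = 0 then 0 else 1) <
          degree F + degree G + (if F = 0 then 0 else 1) + (if G = 0 then 0 else 1)"
        using False by (cases "F' = 0") (auto simp: F)
      ultimately have IH: "dvd_in ?S [:p:] F' \<or> dvd_in ?S [:p:] G"
        using less.hyps ab less.prems(2) by blast
      have "dvd_in ?S [:p:] F" if "dvd_in ?S [:p:] F'"
        unfolding dvd_in_const_iff[OF R] F
      proof
        fix i show "dvd_in R p (coeff (pCons a F') i)"
          using that 1 unfolding dvd_in_const_iff[OF R] by (cases i) auto
      qed
      then show ?thesis using IH by blast
    next
      case 2
      have "F * G = smult b F + pCons 0 (F * G')" by (simp add: G)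
      moreover have "dvd_in ?S [:p:] (smult b F)"
        unfolding dvd_in_const_iff[OF R]
      proof
        fix i
        have "coeff F i \<in> R" using less.prems(1) by (simp add: polys_over_def)
        then show "dvd_in R p (coeff (smult b F) i)"
          using dvd_in_mult_left[OF R 2, of "coeff F i"] by (simp add: mult.commute)
      qed
      ultimately have "dvd_in ?S [:p:] (pCons 0 (F * G'))"
        using dvd_in_diff[OF S less.prems(3), of "smult b F"] by simp
      then have "dvd_in ?S [:p:] (F * G')"
        unfolding dvd_in_const_iff[OF R] by (metis coeff_pCons_Suc)
      moreover have "degree F + degree G' + (if F = 0 then 0 else 1) + (if G' = 0 then 0 else 1) <
          degree F + degree G + (if F = 0 then 0 else 1) + (if G = 0 then 0 else 1)"
        using False by (cases "G' = 0") (auto simp: G)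
      ultimately have IH: "dvd_in ?S [:p:] F \<or> dvd_in ?S [:p:] G'"
        using less.hyps ab less.prems(1) by blast
      have "dvd_in ?S [:p:] G" if "dvd_in ?S [:p:] G'"
        unfolding dvd_in_const_iff[OF R] G
      proof
        fix i show "dvd_in R p (coeff (pCons b G') i)"
          using that 2 unfolding dvd_in_const_iff[OF R] by (cases i) auto
      qed
      then show ?thesis using IH by blast
    qed
  qed
qed

lemma prime_in_const:
  fixes p :: "'a::idom"
  assumes R: "subring_of R" and p: "prime_in R p"
  shows "prime_in (polys_over R) [:p:]"
proof -
  have "\<not> dvd_in (polys_over R) [:p:] 1"
    using p unfolding dvd_in_const_iff[OF R] prime_in_def by (auto intro!: exI[of _ 0])
  then show ?thesis
    using dvd_in_const_mult[OF R p] p const_in_polys_over[OF R] unfolding prime_in_def by auto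
qed

text \<open>Content 1 is expressed by primes, so that no gcd of the coefficients has to be
  constructed.\<close>

definition primitive_on :: "'a::comm_ring_1 set \<Rightarrow> 'a poly \<Rightarrow> bool" where
  "primitive_on R F \<longleftrightarrow> F \<in> polys_over R \<and> (\<forall>p. prime_in R p \<longrightarrow> \<not> dvd_in (polys_over R) [:p:] F)"

text \<open>The primes of \<open>l\<close> can be cancelled one by one: a prime \<open>p\<close>
  that divides \<open>F * Q\<close> does not divide the primitive \<open>F\<close>, so it divides
  \<open>Q\<close>.\<close>

lemma primitive_dvd_in_smult:
  fixes F W :: "'a::idom poly"
  assumes R: "ufd_on R" and F: "primitive_on R F" and W: "W \<in> polys_over R"
    and l: "l \<in> R" "l \<noteq> 0" and dvd: "dvd_in (polys_over R) F (smult l W)"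
  shows "dvd_in (polys_over R) F W"
proof -
  let ?S = "polys_over R"
  have sR: "subring_of R" using R by (simp add: ufd_on_def)
  have S: "subring_of ?S" by (rule subring_of_polys_over[OF sR])
  from R l obtain u ps where u: "u \<in> R" "dvd_in R u 1" "\<forall>p\<in>set ps. prime_in R p" "l = u * prod_list ps"
    unfolding ufd_on_def by blast
  from u(2) obtain u' where u': "u' \<in> R" "1 = u * u'" by (auto simp: dvd_in_def)
  have "dvd_in ?S F (smult u' (smult l W))"
    using dvd_in_mult_left[OF S dvd, of "[:u':]"] const_in_polys_over[OF sR u'(1)] by (simp add: mult.commute)
  then have "dvd_in ?S F (smult (prod_list ps) W)" by (simp add: u(4) mult.assoc[symmetric] mult.commute[of u'] u'(2)[symmetric])
  then show ?thesis using u(3)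
  proof (induction ps)
    case (Cons p ps)
    then have p: "prime_in R p" by simp
    from Cons.prems obtain Q where Q: "Q \<in> ?S" "smult p (smult (prod_list ps) W) = F * Q"
      by (auto simp: dvd_in_def)
    have "prod_list ps \<in> R" using Cons.prems by (intro subring_of_prod_list[OF sR]) (auto simp: prime_in_def)
    then have "dvd_in ?S [:p:] (F * Q)"
      unfolding dvd_in_def Q(2)[symmetric] by (intro bexI[of _ "smult (prod_list ps) W"])
        (auto simp: mult.commute intro!: smult_in_polys_over sR W)
    with dvd_in_const_mult[OF sR p _ Q(1), of F] F p have "dvd_in ?S [:p:] Q"
      unfolding primitive_on_def by blast
    then obtain Q' where Q': "Q' \<in> ?S" "Q = smult p Q'" by (auto simp: dvd_in_def)
    have "smult p (smult (prod_list ps) W - F * Q') = 0"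
      unfolding smult_diff_right using Q(2) Q'(2) by simp
    then have "smult (prod_list ps) W = F * Q'"
      using p by (simp add: prime_in_def del: smult_smult)
    then have "dvd_in ?S F (smult (prod_list ps) W)" using Q' by (auto simp: dvd_in_def)
    then show ?case using Cons by simp
  qed simp
qed

lemma prime_in_factor_unit:
  fixes p :: "'a::idom"
  assumes R: "subring_of R" and p: "prime_in R p" and "p = a * b" "a \<in> R" "b \<in> R" "\<not> dvd_in R a 1"
  shows "dvd_in R b 1"
proof -
  have "dvd_in R p (a * b)" using assms(3) subring_ofD(2)[OF R] by (force simp: dvd_in_def)
  then have "dvd_in R p a \<or> dvd_in R p b" using p assms(4,5) by (auto simp: prime_in_def)
  then show ?thesis
  proof
    assume "dvd_in R p a"
    then obtain c where c: "c \<in> R" "a = a * b * c" using assms(3) by (auto simp: dvd_in_def)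
    moreover have "a \<noteq> 0" using p assms(3) by (auto simp: prime_in_def)
    ultimately have "1 = b * c" by (simp add: mult.assoc)
    then show ?thesis using c by (auto simp: dvd_in_def)
  next
    assume "dvd_in R p b"
    then obtain c where c: "c \<in> R" "b = a * b * c" using assms(3) by (auto simp: dvd_in_def)
    moreover have "b \<noteq> 0" using p assms(3) by (auto simp: prime_in_def)
    ultimately have "1 = a * c" by (simp add: mult.assoc mult.left_commute[of a])
    then show ?thesis using c assms(6) by (auto simp: dvd_in_def)
  qed
qed

lemma dvd_in_one_mult:
  "subring_of R \<Longrightarrow> dvd_in R u 1 \<Longrightarrow> dvd_in R w 1 \<Longrightarrow> dvd_in R (u * w) 1"
  unfolding dvd_in_def by (metis (no_types, lifting) mult.assoc mult.commute mult.right_neutral subring_ofD(6))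

text \<open>Pulling primes out of the coefficients terminates because each time the leading
  coefficient loses, up to a unit, one of its prime factors.\<close>

lemma primitive_part_exists:
  fixes F :: "'a::idom poly"
  assumes R: "ufd_on R" and "F \<in> polys_over R" "F \<noteq> 0"
  shows "\<exists>qs G. (\<forall>q\<in>set qs. prime_in R q) \<and> primitive_on R G \<and> F = smult (prod_list qs) G"
proof -
  let ?S = "polys_over R"
  have sR: "subring_of R" using R by (simp add: ufd_on_def)
  have S: "subring_of ?S" by (rule subring_of_polys_over[OF sR])
  have *: "\<exists>qs G. (\<forall>q\<in>set qs. prime_in R q) \<and> primitive_on R G \<and> F = smult (prod_list qs) G"
    if "F \<in> ?S" "F \<noteq> 0" "u \<in> R" "dvd_in R u 1" "\<forall>p\<in>set ps. prime_in R p" "lead_coeff F = u * prod_list ps" for F u ps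
    using that
  proof (induction "length ps" arbitrary: F u ps rule: less_induct)
    case less
    show ?case
    proof (cases "primitive_on R F")
      case True
      then show ?thesis by (intro exI[of _ "[]"] exI[of _ F]) auto
    next
      case False
      then obtain p where p: "prime_in R p" "dvd_in ?S [:p:] F" using less.prems(1) by (auto simp: primitive_on_def)
      then obtain F' where F': "F' \<in> ?S" "F = smult p F'" by (auto simp: dvd_in_def)
      have p0: "p \<noteq> 0" "p \<in> R" "\<not> dvd_in R p 1" using p by (auto simp: prime_in_def)
      have psR: "set ps \<subseteq> R" using less.prems(5) by (auto simp: prime_in_def)
      have lc: "lead_coeff F = p * lead_coeff F'" by (simp add: F')
      have "lead_coeff F' \<in> R" using F' by (auto simp: polys_over_def)
      then have "dvd_in R p (u * prod_list ps)" using lc less.prems(6) by (auto simp: dvd_in_def)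
      moreover have "\<not> dvd_in R p u" using dvd_in_trans[OF sR _ less.prems(4)] p0 by blast
      ultimately have "dvd_in R p (prod_list ps)"
        using p(1) less.prems(3) subring_of_prod_list[OF sR psR] by (auto simp: prime_in_def)
      then obtain q where q: "q \<in> set ps" "dvd_in R p q"
        using prime_in_dvd_prod_list[OF sR p(1) _ psR] by blast
      then obtain w where w: "w \<in> R" "q = p * w" by (auto simp: dvd_in_def)
      have w1: "dvd_in R w 1"
        using prime_in_factor_unit[OF sR _ w(2) p0(2) w(1) p0(3)] q less.prems(5) by blast
      obtain xs ys where ps: "ps = xs @ q # ys" using q(1) by (meson split_list)
      have "p * lead_coeff F' = p * (u * w * prod_list (xs @ ys))"
        unfolding lc[symmetric] less.prems(6) by (simp add: ps w(2) mult_ac)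
      then have lc': "lead_coeff F' = (u * w) * prod_list (xs @ ys)" using p0(1) mult_left_cancel by blast
      have "\<exists>qs G. (\<forall>q\<in>set qs. prime_in R q) \<and> primitive_on R G \<and> F' = smult (prod_list qs) G"
        by (rule less.hyps[OF _ F'(1) _ _ _ _ lc'])
          (use less.prems F'(2) in \<open>auto simp: ps dvd_in_one_mult sR w w1 subring_ofD\<close>)
      then obtain qs G where "\<forall>q\<in>set qs. prime_in R q" "primitive_on R G" "F' = smult (prod_list qs) G" by blast
      then show ?thesis using p(1) F'(2) by (intro exI[of _ "p # qs"] exI[of _ G]) auto
    qed
  qed
  have "lead_coeff F \<in> R" "lead_coeff F \<noteq> 0" using assms by (auto simp: polys_over_def)
  then obtain u ps where "u \<in> R" "dvd_in R u 1" "\<forall>p\<in>set ps. prime_in R p" "lead_coeff F = u * prod_list ps"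
    using R unfolding ufd_on_def by blast
  then show ?thesis using * assms by blast
qed

text \<open>Powers of the leading coefficient take the place of fractions, so that the computation
  stays over \<open>R\<close>.\<close>

lemma pseudo_division:
  fixes W h :: "'a::idom poly"
  assumes R: "subring_of R" and h: "h \<in> polys_over R" "h \<noteq> 0" and "W \<in> polys_over R"
  shows "\<exists>k. \<exists>q\<in>polys_over R. \<exists>r\<in>polys_over R.
    smult (lead_coeff h ^ k) W = q * h + r \<and> (r = 0 \<or> degree r < degree h)"
  using assms(4)
proof (induction "degree W + (if W = 0 then 0 else 1)" arbitrary: W rule: less_induct)
  case less
  let ?S = "polys_over R"
  have S: "subring_of ?S" by (rule subring_of_polys_over[OF R])
  show ?case
  proof (cases "W = 0 \<or> degree W < degree h")
    case True
    then show ?thesis using less.prems subring_ofD(1)[OF S] by (intro exI[of _ 0] bexI[of _ 0] bexI[of _ W]) auto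
  next
    case False
    define l where "l = lead_coeff h"
    define m where "m = monom (lead_coeff W) (degree W - degree h)"
    have m: "m \<in> ?S" using less.prems unfolding m_def
      by (intro monom_in_polys_over[OF R]) (auto simp: polys_over_def)
    have l: "l \<in> R" "l \<noteq> 0" using h by (auto simp: l_def polys_over_def)
    define W' where "W' = smult l W - m * h"
    have W': "W' \<in> ?S" unfolding W'_def
      using l m h less.prems by (auto intro!: subring_ofD[OF S] smult_in_polys_over[OF R])
    have dm: "degree (m * h) = degree W" 
      using False h(2) unfolding m_def by (subst degree_mult_eq) (auto simp: degree_monom_eq)
    have lm: "coeff (m * h) (degree W) = lead_coeff W * l"
    proof -
      have "lead_coeff (m * h) = lead_coeff W * l" using False unfolding lead_coeff_mult by (simp add: m_def l_def degree_monom_eq)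
      then show ?thesis using dm by simp
    qed
    have "W' = 0 \<or> degree W' < degree W"
    proof -
      have "degree W' \<le> degree W" unfolding W'_def using dm l by (intro degree_diff_le) auto
      moreover have "coeff W' (degree W) = 0" unfolding W'_def using lm by (simp add: mult.commute)
      ultimately show ?thesis by (metis leading_coeff_0_iff nat_less_le)
    qed
    then have "degree W' + (if W' = 0 then 0 else 1) < degree W + (if W = 0 then 0 else 1)" using False by auto
    from less.hyps[OF this W'] obtain k q r where
      qr: "q \<in> ?S" "r \<in> ?S" "smult (l ^ k) W' = q * h + r" "r = 0 \<or> degree r < degree h" unfolding l_def by blast
    have "smult (l ^ k) W' = smult (l ^ Suc k) W - smult (l ^ k) m * h"
      unfolding W'_def by (simp add: smult_diff_right mult.commute)
    then have "smult (l ^ Suc k) W = (q + smult (l ^ k) m) * h + r"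
      using qr(3) by (simp add: algebra_simps)
    moreover have "q + smult (l ^ k) m \<in> ?S"
      using qr m l by (auto intro!: subring_ofD[OF S] smult_in_polys_over[OF R] subring_ofD[OF R])
    ultimately show ?thesis using qr unfolding l_def by blast
  qed
qed

text \<open>An irreducible primitive \<open>F\<close> with \<open>F\<close> not dividing \<open>A\<close> generates, together with \<open>A\<close>, an ideal
  containing a nonzero constant \<open>c\<close>; if \<open>F\<close> divides \<open>A * B\<close> it then divides \<open>c * B\<close>, hence \<open>B\<close>.\<close>

lemma primitive_irreducible_prime_in:
  fixes F :: "'a::idom poly"
  assumes R: "ufd_on R" and F: "primitive_on R F" and deg: "degree F > 0"
    and irr: "\<And>G H. G \<in> polys_over R \<Longrightarrow> H \<in> polys_over R \<Longrightarrow> F = G * H \<Longrightarrow> degree G = 0 \<or> degree H = 0"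
  shows "prime_in (polys_over R) F"
proof -
  let ?S = "polys_over R"
  have sR: "subring_of R" using R by (simp add: ufd_on_def)
  have S: "subring_of ?S" by (rule subring_of_polys_over[OF sR])
  have FS: "F \<in> ?S" "F \<noteq> 0" using F deg by (auto simp: primitive_on_def)
  have unit: "\<not> dvd_in ?S F 1"
  proof
    assume "dvd_in ?S F 1"
    then obtain c where "1 = F * c" by (auto simp: dvd_in_def)
    then have "degree F + degree c = 0" by (metis FS(2) degree_1 degree_mult_eq mult_zero_right one_neq_zero)
    then show False using deg by simp
  qed
  have "dvd_in ?S F B" if AB: "A \<in> ?S" "B \<in> ?S" "dvd_in ?S F (A * B)" "\<not> dvd_in ?S F A" for A B
  proof -
    define I where "I = {r * F + s * A |r s. r \<in> ?S \<and> s \<in> ?S}"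
    have I_S: "I \<subseteq> ?S" unfolding I_def using FS AB by (auto intro!: subring_ofD[OF S])
    have FI: "F \<in> I" unfolding I_def using subring_ofD(1,2)[OF S] by (intro CollectI exI[of _ 1] exI[of _ 0]) auto
    have AI: "A \<in> I" unfolding I_def using subring_ofD(1,2)[OF S] by (intro CollectI exI[of _ 0] exI[of _ 1]) auto
    have I_comb: "smult a x - q * y \<in> I" if xy: "x \<in> I" "y \<in> I" "a \<in> R" "q \<in> ?S" for x y a q
    proof -
      obtain r s r' s' where rs: "r \<in> ?S" "s \<in> ?S" "r' \<in> ?S" "s' \<in> ?S" "x = r * F + s * A" "y = r' * F + s' * A"
        using xy unfolding I_def by blast
      have "smult a x - q * y = (smult a r - q * r') * F + (smult a s - q * s') * A"
        unfolding rs by (simp add: algebra_simps smult_add_right)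
      moreover have "smult a r - q * r' \<in> ?S" "smult a s - q * s' \<in> ?S"
        using rs xy by (auto intro!: subring_ofD[OF S] smult_in_polys_over[OF sR])
      ultimately show ?thesis unfolding I_def by blast
    qed
    \<comment> \<open>A nonzero element of least degree plays the role of the generator that the
      ideal would have over the quotient field.\<close>
    define h where "h = arg_min degree (\<lambda>x. x \<in> I \<and> x \<noteq> 0)"
    have h: "h \<in> I" "h \<noteq> 0" "\<And>x. x \<in> I \<Longrightarrow> x \<noteq> 0 \<Longrightarrow> degree h \<le> degree x"
      using arg_min_nat_lemma[of "\<lambda>x. x \<in> I \<and> x \<noteq> 0" F degree] FI FS(2) unfolding h_def by auto
    have hS: "h \<in> ?S" using h(1) I_S by blast
    have div: "\<exists>l\<in>R. l \<noteq> 0 \<and> dvd_in ?S h (smult l W)" if W: "W \<in> I" for W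
    proof -
      obtain k q r where qr: "q \<in> ?S" "r \<in> ?S" "smult (lead_coeff h ^ k) W = q * h + r"
          "r = 0 \<or> degree r < degree h"
        using pseudo_division[OF sR hS h(2)] W I_S by blast
      have lR: "lead_coeff h ^ k \<in> R" using hS by (auto simp: polys_over_def intro!: subring_ofD[OF sR])
      have "r = smult (lead_coeff h ^ k) W - q * h" using qr(3) by simp
      then have "r \<in> I" using I_comb[OF W h(1) lR qr(1)] by simp
      then have "r = 0" using h(3) qr(4) by fastforce
      then have "dvd_in ?S h (smult (lead_coeff h ^ k) W)" using qr by (auto simp: dvd_in_def)
      then show ?thesis using lR h(2) by (intro bexI[of _ "lead_coeff h ^ k"]) auto
    qed
    show ?thesis
    proof (cases "degree h = 0")
      case True
      then obtain c where c: "h = [:c:]" by (meson degree_eq_zeroE)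
      then have cR: "c \<in> R" "c \<noteq> 0" using hS h(2) by (auto simp: pCons_in_polys_over)
      obtain r s where rs: "r \<in> ?S" "s \<in> ?S" "h = r * F + s * A" using h(1) unfolding I_def by blast
      obtain k where k: "k \<in> ?S" "A * B = F * k" using AB(3) by (auto simp: dvd_in_def)
      have "smult c B = h * B" by (simp add: c)
      also have "\<dots> = F * (r * B) + s * (A * B)" by (simp add: rs algebra_simps)
      also have "\<dots> = F * (r * B + s * k)" unfolding k(2) by (simp add: algebra_simps)
      finally have "dvd_in ?S F (smult c B)"
        unfolding dvd_in_def using AB rs k by (intro bexI[of _ "r * B + s * k"]) (auto intro!: subring_ofD[OF S])
      then show ?thesis using primitive_dvd_in_smult[OF R F AB(2) cR] by blast
    next
      \<comment> \<open>This case is contradictory: the primitive part \<open>h'\<close> of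
        \<open>h\<close> divides all of \<open>I\<close>, so \<open>F = h' * G\<close> with
        \<open>G\<close> constant by irreducibility and a unit by primitivity; then \<open>F\<close>
        divides \<open>h'\<close> and with it \<open>A\<close>.\<close>
      case False
      obtain qs h' where h': "\<forall>q\<in>set qs. prime_in R q" "primitive_on R h'" "h = smult (prod_list qs) h'"
        using primitive_part_exists[OF R hS h(2)] by blast
      have qs: "prod_list qs \<in> R" using h'(1) by (intro subring_of_prod_list[OF sR]) (auto simp: prime_in_def)
      have h'S: "h' \<in> ?S" using h'(2) by (simp add: primitive_on_def)
      have h'h: "dvd_in ?S h' h" unfolding dvd_in_def h'(3)
        using const_in_polys_over[OF sR qs] by (intro bexI[of _ "[:prod_list qs:]"]) auto
      have h'W: "dvd_in ?S h' W" if W: "W \<in> I" for W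
      proof -
        obtain l where l: "l \<in> R" "l \<noteq> 0" "dvd_in ?S h (smult l W)" using div[OF W] by blast
        show ?thesis using primitive_dvd_in_smult[OF R h'(2) _ l(1,2)] dvd_in_trans[OF S h'h l(3)] W I_S by blast
      qed
      obtain G where G: "G \<in> ?S" "F = h' * G" using h'W[OF FI] by (auto simp: dvd_in_def)
      have "degree h' \<noteq> 0" using False h'(3) by (auto split: if_splits)
      then have "degree G = 0" using irr[OF h'S G] by simp
      then obtain g where g: "G = [:g:]" by (meson degree_eq_zeroE)
      have gR: "g \<in> R" "g \<noteq> 0" using G g FS(2) by (auto simp: pCons_in_polys_over)
      have "dvd_in R g 1"
      proof -
        obtain u ps where u: "u \<in> R" "dvd_in R u 1" "\<forall>p\<in>set ps. prime_in R p" "g = u * prod_list ps"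
          using R gR unfolding ufd_on_def by blast
        show ?thesis
        proof (cases ps)
          case (Cons p ps')
          have "dvd_in ?S [:p:] F" unfolding dvd_in_def
          proof (intro bexI[of _ "smult (u * prod_list ps') h'"])
            show "F = [:p:] * smult (u * prod_list ps') h'" using G(2) g u(4) Cons by (simp add: mult_ac)
            have "prod_list ps' \<in> R" using u(3) Cons by (intro subring_of_prod_list[OF sR]) (auto simp: prime_in_def)
            then show "smult (u * prod_list ps') h' \<in> ?S"
              using u(1) h'S by (auto intro!: smult_in_polys_over[OF sR] subring_ofD[OF sR])
          qed
          then show ?thesis using F u(3) Cons by (auto simp: primitive_on_def)
        qed (use u in auto)
      qed
      then obtain g' where g': "g' \<in> R" "1 = g * g'" by (auto simp: dvd_in_def)
      have "h' = F * [:g':]" using G(2) g g'(2) by (simp add: mult.commute)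
      then have "dvd_in ?S F h'" using const_in_polys_over[OF sR g'(1)] unfolding dvd_in_def by blast
      then show ?thesis using dvd_in_trans[OF S _ h'W[OF AI]] AB(4) by blast
    qed
  qed
  then show ?thesis using FS unit unfolding prime_in_def by blast
qed

text \<open>The content factors into constants. The primitive part is split as long as both factors
  have positive degree; what cannot be split is prime by
  \<open>primitive_irreducible_prime_in\<close>.\<close>

lemma ufd_on_polys_over:
  fixes R :: "'a::idom set"
  assumes R: "ufd_on R"
  shows "ufd_on (polys_over R)"
proof -
  let ?S = "polys_over R"
  let ?fac = "\<lambda>F. \<exists>u ps. u \<in> ?S \<and> dvd_in ?S u 1 \<and> (\<forall>p\<in>set ps. prime_in ?S p) \<and> F = u * prod_list ps"
  have sR: "subring_of R" using R by (simp add: ufd_on_def)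
  have S: "subring_of ?S" by (rule subring_of_polys_over[OF sR])
  have fac_const: "?fac [:a:]" if a: "a \<in> R" "a \<noteq> 0" for a
  proof -
    obtain u ps where u: "u \<in> R" "dvd_in R u 1" "\<forall>p\<in>set ps. prime_in R p" "a = u * prod_list ps"
      using R a unfolding ufd_on_def by blast
    have "prod_list (map (\<lambda>p. [:p:]) ps) = [:prod_list ps:]" by (induction ps) (auto simp: pCons_one)
    then have "[:a:] = [:u:] * prod_list (map (\<lambda>p. [:p:]) ps)" by (simp add: u(4))
    moreover obtain u' where u': "u' \<in> R" "1 = u * u'" using u(2) by (auto simp: dvd_in_def)
    have "dvd_in ?S [:u:] 1"
      unfolding dvd_in_def using u' const_in_polys_over[OF sR u'(1)] by (intro bexI[of _ "[:u':]"]) (auto simp: one_pCons mult.commute)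
    ultimately show ?thesis using u const_in_polys_over[OF sR u(1)] prime_in_const[OF sR]
      by (intro exI[of _ "[:u:]"] exI[of _ "map (\<lambda>p. [:p:]) ps"]) auto
  qed
  have fac_mult: "?fac (F * G)" if F: "?fac F" and G: "?fac G" for F G
  proof -
    obtain u ps where u: "u \<in> ?S" "dvd_in ?S u 1" "\<forall>p\<in>set ps. prime_in ?S p" "F = u * prod_list ps" using F by blast
    obtain w qs where w: "w \<in> ?S" "dvd_in ?S w 1" "\<forall>p\<in>set qs. prime_in ?S p" "G = w * prod_list qs" using G by blast
    show ?thesis
      using u w dvd_in_one_mult[OF S u(2) w(2)] subring_ofD(6)[OF S u(1) w(1)]
      by (intro exI[of _ "u * w"] exI[of _ "ps @ qs"]) (auto simp: mult_ac)
  qed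
  have "?fac F" if "F \<in> ?S" "F \<noteq> 0" for F
    using that
  proof (induction "degree F" arbitrary: F rule: less_induct)
    case less
    obtain qs G where G: "\<forall>q\<in>set qs. prime_in R q" "primitive_on R G" "F = smult (prod_list qs) G"
      using primitive_part_exists[OF R less.prems] by blast
    have qs: "prod_list qs \<in> R" using G(1) by (intro subring_of_prod_list[OF sR]) (auto simp: prime_in_def)
    have nz: "prod_list qs \<noteq> 0" "G \<noteq> 0" using G(3) less.prems(2) by auto
    have GS: "G \<in> ?S" using G(2) by (simp add: primitive_on_def)
    have dG: "degree G = degree F" using G(3) nz by simp
    have "?fac G"
    proof (cases "degree G = 0")
      case True
      then show ?thesis using fac_const GS nz(2) by (metis degree_eq_zeroE pCons_0_0 pCons_in_polys_over)
    next
      case dpos: False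
      show ?thesis
      proof (cases "\<exists>A B. A \<in> ?S \<and> B \<in> ?S \<and> G = A * B \<and> degree A \<noteq> 0 \<and> degree B \<noteq> 0")
        case True
        then obtain A B where AB: "A \<in> ?S" "B \<in> ?S" "G = A * B" "degree A \<noteq> 0" "degree B \<noteq> 0" by blast
        then have nz': "A \<noteq> 0" "B \<noteq> 0" by auto
        then have "degree G = degree A + degree B" using AB(3) degree_mult_eq by blast
        then have "?fac A" "?fac B" using less.hyps[of A] less.hyps[of B] AB nz' dG by auto
        then show ?thesis using fac_mult AB(3) by blast
      next
        case False
        then have "prime_in ?S G" using primitive_irreducible_prime_in[OF R G(2)] dpos by blast
        then show ?thesis using subring_ofD(2)[OF S]
          by (intro exI[of _ 1] exI[of _ "[G]"]) (force simp: dvd_in_def)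
      qed
    qed
    then show ?case using fac_mult[OF fac_const[OF qs nz(1)]] G(3) by simp
  qed
  then show ?thesis using S unfolding ufd_on_def by blast
qed

section \<open>Adjoining a transcendental element\<close>

definition adjoin :: "'a::comm_ring_1 set \<Rightarrow> 'a \<Rightarrow> 'a set" where
  "adjoin R x = (\<lambda>P. poly P x) ` polys_over R"

context
  fixes R :: "'a::idom set" and x :: 'a
  assumes trans: "\<And>P. P \<in> polys_over R \<Longrightarrow> poly P x = 0 \<Longrightarrow> P = 0"
    and R: "subring_of R"
begin

lemma poly_eq_transcendental:
  "P \<in> polys_over R \<Longrightarrow> Q \<in> polys_over R \<Longrightarrow> poly P x = poly Q x \<longleftrightarrow> P = Q"
  using trans[of "P - Q"] subring_ofD(5)[OF subring_of_polys_over[OF R]] by auto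

lemma subring_of_adjoin: "subring_of (adjoin R x)"
proof -
  have "1 \<in> adjoin R x"
    unfolding adjoin_def using imageI[OF subring_ofD(2)[OF subring_of_polys_over[OF R]], of "\<lambda>P. poly P x"] by simp
  moreover have "poly P x - poly Q x \<in> adjoin R x" "poly P x * poly Q x \<in> adjoin R x"
    if "P \<in> polys_over R" "Q \<in> polys_over R" for P Q
    unfolding adjoin_def poly_diff[symmetric] poly_mult[symmetric]
    by (intro imageI subring_ofD[OF subring_of_polys_over[OF R]] that)+
  ultimately show ?thesis unfolding subring_of_def by (auto simp: adjoin_def)
qed

lemma dvd_in_adjoin:
  assumes "P \<in> polys_over R" "Q \<in> polys_over R"
  shows "dvd_in (adjoin R x) (poly P x) (poly Q x) \<longleftrightarrow> dvd_in (polys_over R) P Q"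
proof
  assume "dvd_in (adjoin R x) (poly P x) (poly Q x)"
  then obtain C where C: "C \<in> polys_over R" "poly Q x = poly P x * poly C x"
    by (auto simp: dvd_in_def adjoin_def)
  then have "Q = P * C"
    using poly_eq_transcendental[OF assms(2), of "P * C"] assms(1) subring_ofD(6)[OF subring_of_polys_over[OF R]] by simp
  then show "dvd_in (polys_over R) P Q" using C by (auto simp: dvd_in_def)
qed (auto simp: dvd_in_def adjoin_def)

lemma prime_in_adjoin:
  assumes "prime_in (polys_over R) P"
  shows "prime_in (adjoin R x) (poly P x)"
proof -
  have P: "P \<in> polys_over R" using assms by (simp add: prime_in_def)
  have "\<not> dvd_in (adjoin R x) (poly P x) (poly 1 x)"
    using assms P subring_ofD(2)[OF subring_of_polys_over[OF R]] unfolding prime_in_def by (subst dvd_in_adjoin) auto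
  moreover have "dvd_in (adjoin R x) (poly P x) (poly A x) \<or> dvd_in (adjoin R x) (poly P x) (poly B x)"
    if "A \<in> polys_over R" "B \<in> polys_over R" "dvd_in (adjoin R x) (poly P x) (poly A x * poly B x)" for A B
  proof -
    have "dvd_in (adjoin R x) (poly P x) (poly (A * B) x)" using that by simp
    then have "dvd_in (polys_over R) P (A * B)"
      using dvd_in_adjoin[OF P] that subring_ofD(6)[OF subring_of_polys_over[OF R]] by blast
    then show ?thesis using assms that P by (auto simp: prime_in_def dvd_in_adjoin)
  qed
  moreover have "poly P x \<noteq> 0" using trans P assms by (auto simp: prime_in_def)
  ultimately show ?thesis using P unfolding prime_in_def by (auto simp: adjoin_def)
qed

lemma prime_in_adjoin_base: "prime_in R p \<Longrightarrow> prime_in (adjoin R x) p"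
  using prime_in_adjoin[OF prime_in_const[OF R]] by fastforce

lemma ufd_on_adjoin:
  assumes "ufd_on R"
  shows "ufd_on (adjoin R x)"
proof -
  have 1: "1 \<in> polys_over R" using subring_ofD(2)[OF subring_of_polys_over[OF R]] .
  have "\<exists>u ps. u \<in> adjoin R x \<and> dvd_in (adjoin R x) u 1 \<and> (\<forall>p\<in>set ps. prime_in (adjoin R x) p) \<and> a = u * prod_list ps"
    if a: "a \<in> adjoin R x" "a \<noteq> 0" for a
  proof -
    obtain P where P: "P \<in> polys_over R" "a = poly P x" using a by (auto simp: adjoin_def)
    with a have "P \<noteq> 0" by auto
    then obtain u ps where u: "u \<in> polys_over R" "dvd_in (polys_over R) u 1"
        "\<forall>p\<in>set ps. prime_in (polys_over R) p" "P = u * prod_list ps"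
      using ufd_on_polys_over[OF assms] P(1) unfolding ufd_on_def by blast
    have "poly (prod_list ps) x = prod_list (map (\<lambda>p. poly p x) ps)" by (induction ps) auto
    moreover have "dvd_in (adjoin R x) (poly u x) 1" using dvd_in_adjoin[OF u(1) 1] u(2) by simp
    ultimately show ?thesis using u P prime_in_adjoin
      by (intro exI[of _ "poly u x"] exI[of _ "map (\<lambda>p. poly p x) ps"]) (auto simp: adjoin_def)
  qed
  then show ?thesis using subring_of_adjoin unfolding ufd_on_def by blast
qed

end


subsection \<open>The ring of polynomial functions\<close>

text \<open>An upper bound on the degree, attached to a function by the way it is built; the
  expansions along curves and lines below all follow this induction.\<close>

inductive pdeg :: "nat \<Rightarrow> ((nat \<Rightarrow> 'a::comm_ring_1) \<Rightarrow> 'a) \<Rightarrow> bool" where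
  pdeg_const: "pdeg d (\<lambda>x. c)"
| pdeg_var: "1 \<le> d \<Longrightarrow> pdeg d (\<lambda>x. x i)"
| pdeg_add: "pdeg d f \<Longrightarrow> pdeg d g \<Longrightarrow> pdeg d (\<lambda>x. f x + g x)"
| pdeg_mult: "pdeg d f \<Longrightarrow> pdeg e g \<Longrightarrow> d + e \<le> m \<Longrightarrow> pdeg m (\<lambda>x. f x * g x)"

lemma pdeg_mono: "pdeg d f \<Longrightarrow> d \<le> e \<Longrightarrow> pdeg e f"
proof (induction arbitrary: e rule: pdeg.induct)
  case (pdeg_mult d f e' g m)
  show ?case by (rule pdeg.pdeg_mult[OF pdeg_mult.hyps(1,2)]) (use pdeg_mult in simp)
qed (auto intro: pdeg.intros)

lemma pdeg_0_imp_const: "pdeg d f \<Longrightarrow> d = 0 \<Longrightarrow> f x = f y"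
  by (induction rule: pdeg.induct) auto

lemma pdeg_curve:
  fixes f :: "(nat \<Rightarrow> 'a::comm_ring_1) \<Rightarrow> 'a"
  assumes "pdeg d f" and \<gamma>: "\<And>i. degree (\<gamma> i) \<le> E"
  shows "\<exists>p. degree p \<le> d * E \<and> (\<forall>y. poly p y = f (\<lambda>i. poly (\<gamma> i) y))"
  using assms(1)
proof (induction rule: pdeg.induct)
  case (pdeg_const d c)
  show ?case by (intro exI[of _ "[:c:]"]) auto
next
  case (pdeg_var d i)
  have "degree (\<gamma> i) \<le> d * E" using \<gamma>[of i] pdeg_var by (metis mult_le_mono1 nat_mult_1 order.trans)
  then show ?case by blast
next
  case (pdeg_add d f g)
  then obtain p q where "degree p \<le> d * E" "degree q \<le> d * E" "\<forall>y. poly p y = f (\<lambda>i. poly (\<gamma> i) y)"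
    "\<forall>y. poly q y = g (\<lambda>i. poly (\<gamma> i) y)" by blast
  then show ?case by (intro exI[of _ "p + q"]) (auto intro: degree_add_le)
next
  case (pdeg_mult d f e g m)
  then obtain p q where pq: "degree p \<le> d * E" "degree q \<le> e * E" "\<forall>y. poly p y = f (\<lambda>i. poly (\<gamma> i) y)"
    "\<forall>y. poly q y = g (\<lambda>i. poly (\<gamma> i) y)" by blast
  have "degree (p * q) \<le> (d + e) * E" using degree_mult_le[of p q] pq by (simp add: algebra_simps)
  also have "\<dots> \<le> m * E" using pdeg_mult.hyps by simp
  finally show ?case using pq by (intro exI[of _ "p * q"]) auto
qed

text \<open>Here \<open>q\<close> is the parameter that a Kronecker substitution is about to replace
  and \<open>y\<close> the one that survives. Only the degrees in \<open>y\<close> have to be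
  controlled for it, whatever the degree in \<open>q\<close>.\<close>

lemma pdeg_curve2:
  fixes f :: "(nat \<Rightarrow> 'a::comm_ring_1) \<Rightarrow> 'a"
  assumes "pdeg d f" and \<gamma>: "\<And>i k. degree (coeff (\<gamma> i) k) \<le> E"
  shows "\<exists>p. (\<forall>k. degree (coeff p k) \<le> d * E) \<and> (\<forall>q y. poly (poly p q) y = f (\<lambda>i. poly (poly (\<gamma> i) q) y))"
  using assms(1)
proof (induction rule: pdeg.induct)
  case (pdeg_const d c)
  show ?case by (intro exI[of _ "[:[:c:]:]"]) (auto simp: coeff_pCons split: nat.splits)
next
  case (pdeg_var d i)
  have "degree (coeff (\<gamma> i) k) \<le> d * E" for k
    using \<gamma>[of i k] pdeg_var by (metis mult_le_mono1 nat_mult_1 order.trans)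
  then show ?case by blast
next
  case (pdeg_add d f g)
  then obtain p q where "\<forall>k. degree (coeff p k) \<le> d * E" "\<forall>k. degree (coeff q k) \<le> d * E"
    "\<forall>r y. poly (poly p r) y = f (\<lambda>i. poly (poly (\<gamma> i) r) y)"
    "\<forall>r y. poly (poly q r) y = g (\<lambda>i. poly (poly (\<gamma> i) r) y)" by blast
  then show ?case by (intro exI[of _ "p + q"]) (auto intro: degree_add_le)
next
  case (pdeg_mult d f e g m)
  then obtain p q where pq: "\<forall>k. degree (coeff p k) \<le> d * E" "\<forall>k. degree (coeff q k) \<le> e * E"
    "\<forall>r y. poly (poly p r) y = f (\<lambda>i. poly (poly (\<gamma> i) r) y)"
    "\<forall>r y. poly (poly q r) y = g (\<lambda>i. poly (poly (\<gamma> i) r) y)" by blast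
  have "degree (coeff (p * q) k) \<le> m * E" for k
    unfolding coeff_mult
  proof (rule degree_sum_le)
    fix j
    have "degree (coeff p j * coeff q (k - j)) \<le> d * E + e * E"
      using pq(1,2) degree_mult_le[of "coeff p j" "coeff q (k - j)"] by (meson add_mono order.trans)
    also have "\<dots> \<le> m * E" using pdeg_mult.hyps by (simp flip: distrib_right)
    finally show "degree (coeff p j * coeff q (k - j)) \<le> m * E" .
  qed simp
  then show ?case using pq by (intro exI[of _ "p * q"]) auto
qed

text \<open>With functions instead of formal expressions, substitution is composition and identities
  are checked pointwise; over an infinite field nothing is lost. All variables are available at
  once, each element using finitely many.\<close>

typedef (overloaded) 'a polyfun = "{f :: (nat \<Rightarrow> 'a::comm_ring_1) \<Rightarrow> 'a. \<exists>d. pdeg d f}"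
  morphisms evp Abs_polyfun
  using pdeg_const by blast

setup_lifting type_definition_polyfun

instantiation polyfun :: (comm_ring_1) comm_ring_1
begin

lift_definition zero_polyfun :: "'a polyfun" is "\<lambda>x. 0" using pdeg_const by blast
lift_definition one_polyfun :: "'a polyfun" is "\<lambda>x. 1" using pdeg_const by blast
lift_definition plus_polyfun :: "'a polyfun \<Rightarrow> 'a polyfun \<Rightarrow> 'a polyfun" is "\<lambda>f g x. f x + g x"
  by (metis pdeg_add pdeg_mono nat_le_linear)
lift_definition times_polyfun :: "'a polyfun \<Rightarrow> 'a polyfun \<Rightarrow> 'a polyfun" is "\<lambda>f g x. f x * g x"
  using pdeg_mult[OF _ _ order.refl] by blast
lift_definition uminus_polyfun :: "'a polyfun \<Rightarrow> 'a polyfun" is "\<lambda>f x. - f x"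
proof -
  fix f :: "(nat \<Rightarrow> 'a) \<Rightarrow> 'a"
  assume "\<exists>d. pdeg d f"
  then obtain d where "pdeg d f" by blast
  from pdeg_mult[OF pdeg_const[of 0 "-1"] this] have "pdeg d (\<lambda>x. - f x)" by simp
  then show "\<exists>d. pdeg d (\<lambda>x. - f x)" by blast
qed
definition minus_polyfun :: "'a polyfun \<Rightarrow> 'a polyfun \<Rightarrow> 'a polyfun" where "minus_polyfun f g = f + - g"

instance
proof
  fix a b c :: "'a polyfun"
  show "a + b + c = a + (b + c)" by transfer (simp add: add.assoc)
  show "a + b = b + a" by transfer (simp add: add.commute)
  show "0 + a = a" by transfer simp
  show "- a + a = 0" by transfer simp
  show "a - b = a + - b" by (rule minus_polyfun_def)
  show "a * b * c = a * (b * c)" by transfer (simp add: mult.assoc)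
  show "a * b = b * a" by transfer (simp add: mult.commute)
  show "1 * a = a" by transfer simp
  show "(a + b) * c = a * c + b * c" by transfer (simp add: distrib_right)
  show "(0::'a polyfun) \<noteq> 1" by transfer (simp add: fun_eq_iff)
qed

end

lift_definition cst :: "'a::comm_ring_1 \<Rightarrow> 'a polyfun" is "\<lambda>c x. c" using pdeg_const by blast
lift_definition Xv :: "nat \<Rightarrow> 'a::comm_ring_1 polyfun" is "\<lambda>i x. x i" using pdeg_var by blast

lemma evp_add [simp]: "evp (f + g) x = evp f x + evp g x"
  and evp_mult [simp]: "evp (f * g) x = evp f x * evp g x"
  and evp_minus [simp]: "evp (- f) x = - evp f x"
  and evp_0 [simp]: "evp 0 x = 0"
  and evp_1 [simp]: "evp 1 x = 1"
  and evp_cst [simp]: "evp (cst c) x = c"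
  and evp_Xv [simp]: "evp (Xv i) x = x i"
  by (transfer, simp)+

lemma evp_diff [simp]: "evp (f - g) x = evp f x - evp g x"
  by (simp only: minus_polyfun_def evp_add evp_minus) simp

lemma evp_power [simp]: "evp (f ^ k) x = evp f x ^ k"
  by (induction k) auto

lemma evp_sum [simp]: "evp (sum f I) x = (\<Sum>i\<in>I. evp (f i) x)"
  by (induction I rule: infinite_finite_induct) auto

lemma evp_prod [simp]: "evp (prod f I) x = (\<Prod>i\<in>I. evp (f i) x)"
  by (induction I rule: infinite_finite_induct) auto

lemma pf_eqI: "(\<And>x. evp f x = evp g x) \<Longrightarrow> f = g"
  by transfer auto

lemma pf_eq_0_iff: "f = 0 \<longleftrightarrow> (\<forall>x. evp f x = 0)"
  using pf_eqI[of f 0] by auto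

lemma ex_pdeg: "\<exists>d. pdeg d (evp f)"
  using evp[of f] by simp

lemma pdeg_evp_add: "pdeg d (evp f) \<Longrightarrow> pdeg d (evp g) \<Longrightarrow> pdeg d (evp (f + g))"
  using pdeg_add[of d "evp f" "evp g"] by (simp flip: evp_add)

lemma pdeg_evp_mult: "pdeg d (evp f) \<Longrightarrow> pdeg e (evp g) \<Longrightarrow> d + e \<le> m \<Longrightarrow> pdeg m (evp (f * g))"
  using pdeg_mult[of d "evp f" e "evp g"] by (simp flip: evp_mult)

lemma pdeg_evp_cst: "pdeg d (evp (cst c))"
  using pdeg_const[of d c] by (simp add: cst.rep_eq)

lemma pdeg_evp_0: "pdeg d (evp 0)"
  using pdeg_const[of d 0] by (simp add: zero_polyfun.rep_eq)

lemma pdeg_evp_1: "pdeg d (evp 1)"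
  using pdeg_const[of d 1] by (simp add: one_polyfun.rep_eq)

lemma pdeg_evp_Xv: "1 \<le> d \<Longrightarrow> pdeg d (evp (Xv i))"
  using pdeg_var[of d i] by (simp add: Xv.rep_eq)

lemma pdeg_evp_sum: "(\<And>i. i \<in> I \<Longrightarrow> pdeg d (evp (f i))) \<Longrightarrow> pdeg d (evp (sum f I))"
  by (induction I rule: infinite_finite_induct) (auto intro: pdeg_evp_add simp: pdeg_evp_0)

lemma pdeg_evp_prod:
  "(\<And>i. i \<in> I \<Longrightarrow> pdeg d (evp (f i))) \<Longrightarrow> pdeg (card I * d) (evp (prod f I))"
proof (induction I rule: infinite_finite_induct)
  case (insert i I)
  then show ?case by (auto intro!: pdeg_mult[of d _ "card I * d"])
qed (auto simp: pdeg_evp_1)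

lemma pf_induct [case_names cst Xv add mult]:
  assumes "\<And>c. P (cst c)" "\<And>i. P (Xv i)" "\<And>f g. P f \<Longrightarrow> P g \<Longrightarrow> P (f + g)" "\<And>f g. P f \<Longrightarrow> P g \<Longrightarrow> P (f * g)"
  shows "P (f :: 'a::comm_ring_1 polyfun)"
proof -
  have "\<exists>q. evp q = h \<and> P q" if "pdeg d h" for d and h :: "(nat \<Rightarrow> 'a) \<Rightarrow> 'a"
    using that
  proof (induction rule: pdeg.induct)
    case (pdeg_const d c)
    show ?case using assms(1) by (intro exI[of _ "cst c"]) (auto simp: cst.rep_eq)
  next
    case (pdeg_var d i)
    show ?case using assms(2) by (intro exI[of _ "Xv i"]) (auto simp: Xv.rep_eq)
  next
    case (pdeg_add d f g)
    then obtain p q where "evp p = f" "evp q = g" "P p" "P q" by blast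
    then show ?case using assms(3) by (intro exI[of _ "p + q"]) (auto simp: plus_polyfun.rep_eq)
  next
    case (pdeg_mult d f e g m)
    then obtain p q where "evp p = f" "evp q = g" "P p" "P q" by blast
    then show ?case using assms(4) by (intro exI[of _ "p * q"]) (auto simp: times_polyfun.rep_eq)
  qed
  then show ?thesis using ex_pdeg[of f] by (metis evp_inject)
qed

lemma pf_subst: "\<exists>g. \<forall>x. evp g x = evp f (\<lambda>i. evp (\<sigma> i) x)"
proof (induction f rule: pf_induct)
  case (cst c)
  show ?case by (intro exI[of _ "cst c"]) simp
next
  case (Xv i)
  show ?case by (intro exI[of _ "\<sigma> i"]) simp
next
  case (add f g)
  then show ?case by (metis evp_add)
next
  case (mult f g)
  then show ?case by (metis evp_mult)
qed

text \<open>Over a finite field, 1 plus the product of all \<open>x - a\<close> has positive degree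
  but no root.\<close>

lemma infinite_UNIV_alg_closed: "infinite (UNIV :: 'a::alg_closed_field set)"
proof
  assume fin: "finite (UNIV :: 'a set)"
  define p where "p = (\<Prod>a\<in>(UNIV::'a set). [:-a, 1:])"
  have "degree p = card (UNIV :: 'a set)" unfolding p_def by (subst degree_prod_eq_sum_degree) auto
  then have "degree p > 0" using fin by (simp add: card_gt_0_iff)
  then have "degree (p + 1) > 0" by (simp add: degree_add_eq_left)
  then obtain x where "poly (p + 1) x = 0" using alg_closed_imp_poly_has_root by blast
  moreover have "poly p x = 0" unfolding p_def poly_prod using fin by (auto simp: prod_zero_iff)
  ultimately show False by simp
qed

text \<open>Omitting one point is harmless in an infinite field; it admits identities that were
  obtained by dividing by \<open>y\<close>.\<close>

lemma poly_eqI_alg_closed: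
  fixes p q :: "'a::alg_closed_field poly"
  assumes "\<And>y. y \<noteq> 0 \<Longrightarrow> poly p y = poly q y"
  shows "p = q"
proof (rule ccontr)
  assume "p \<noteq> q"
  then have "finite {y. poly (p - q) y = 0}" by (intro poly_roots_finite) simp
  moreover have "UNIV - {0} \<subseteq> {y. poly (p - q) y = 0}" using assms by auto
  ultimately have "finite (UNIV - {0 :: 'a})" by (rule rev_finite_subset)
  then show False using infinite_UNIV_alg_closed[where 'a = 'a] by simp
qed

lemma poly_nonzero_ex:
  fixes p :: "'a::alg_closed_field poly"
  assumes "p \<noteq> 0" shows "\<exists>y. poly p y \<noteq> 0"
  using poly_eqI_alg_closed[of p 0] assms by auto

text \<open>Join a point where \<open>f\<close> is nonzero to one where \<open>g\<close> is: on this
  line both restrict to nonzero univariate polynomials, whose product is nonzero somewhere.\<close>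

instance polyfun :: (alg_closed_field) idom
proof
  fix f g :: "'a polyfun"
  assume "f \<noteq> 0" "g \<noteq> 0"
  then obtain a b where ab: "evp f a \<noteq> 0" "evp g b \<noteq> 0" by (auto simp: pf_eq_0_iff)
  define \<gamma> where "\<gamma> i = [:a i, b i - a i:]" for i
  have \<gamma>: "degree (\<gamma> i) \<le> 1" for i by (simp add: \<gamma>_def)
  obtain d e where "pdeg d (evp f)" "pdeg e (evp g)" using ex_pdeg by metis
  then obtain p q where pq: "\<And>y. poly p y = evp f (\<lambda>i. poly (\<gamma> i) y)" "\<And>y. poly q y = evp g (\<lambda>i. poly (\<gamma> i) y)"
    using pdeg_curve[where \<gamma> = \<gamma> and E = 1, OF _ \<gamma>] by meson
  have "poly p 0 \<noteq> 0" "poly q 1 \<noteq> 0" using ab by (auto simp: pq \<gamma>_def)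
  then have "p * q \<noteq> 0" by auto
  then obtain y where "poly (p * q) y \<noteq> 0" using poly_nonzero_ex by blast
  then have "evp (f * g) (\<lambda>i. poly (\<gamma> i) y) \<noteq> 0" by (simp add: pq)
  then show "f * g \<noteq> 0" by (auto simp: pf_eq_0_iff)
qed

text \<open>A polynomial \<open>F\<close> over the ring of polynomial functions is regarded as a polynomial
  function of \<open>(u, t)\<close>.\<close>

abbreviation ev2 :: "'a::comm_ring_1 polyfun poly \<Rightarrow> (nat \<Rightarrow> 'a) \<Rightarrow> 'a \<Rightarrow> 'a" where
  "ev2 F u t \<equiv> evp (poly F (cst t)) u"

definition at_pt :: "'a::comm_ring_1 polyfun poly \<Rightarrow> (nat \<Rightarrow> 'a) \<Rightarrow> 'a poly" where
  "at_pt F u = map_poly (\<lambda>c. evp c u) F"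

lemma coeff_at_pt [simp]: "coeff (at_pt F u) i = evp (coeff F i) u"
  by (simp add: at_pt_def coeff_map_poly)

lemma degree_at_pt_le: "degree (at_pt F u) \<le> degree F"
  by (rule degree_le) (auto simp: coeff_eq_0)

lemma poly_at_pt: "poly (at_pt F u) t = ev2 F u t"
  unfolding at_pt_def by (induction F) (auto simp: map_poly_pCons)

lemma ev2_eq_sum:
  assumes "degree F \<le> d"
  shows "ev2 F u t = (\<Sum>i\<le>d. evp (coeff F i) u * t ^ i)"
proof -
  have "ev2 F u t = (\<Sum>i\<le>degree (at_pt F u). coeff (at_pt F u) i * t ^ i)"
    unfolding poly_at_pt[symmetric] by (rule poly_altdef)
  also have "\<dots> = (\<Sum>i\<le>d. coeff (at_pt F u) i * t ^ i)"
    by (rule sum.mono_neutral_left)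
      (use assms degree_at_pt_le[of F u] in \<open>auto simp: coeff_eq_0 simp del: coeff_at_pt\<close>)
  finally show ?thesis by simp
qed

lemma ev2_eqD:
  fixes F G :: "'a::alg_closed_field polyfun poly"
  assumes "\<And>t. t \<noteq> 0 \<Longrightarrow> ev2 F u t = ev2 G w t"
  shows "evp (coeff F i) u = evp (coeff G i) w"
proof -
  have "at_pt F u = at_pt G w" by (rule poly_eqI_alg_closed) (simp add: assms poly_at_pt)
  then show ?thesis by (metis coeff_at_pt)
qed

lemma ev2_eqI:
  fixes F G :: "'a::alg_closed_field polyfun poly"
  assumes "\<And>u t. ev2 F u t = ev2 G u t"
  shows "F = G"
  using ev2_eqD[of F _ G, OF assms] by (intro poly_eqI pf_eqI) auto

section \<open>Expansion along lines, homogeneous components and degrees\<close>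

text \<open>A Taylor expansion: each power of \<open>t\<close> uses up one degree in
  \<open>u\<close>. This drop drives the induction in
  \<open>vanishing_on_power_sum_pt\<close>.\<close>

lemma line_expansion:
  fixes f :: "(nat \<Rightarrow> 'a::comm_ring_1) \<Rightarrow> 'a"
  assumes "pdeg d f"
  shows "\<exists>F. degree F \<le> d \<and> (\<forall>i. pdeg (d - i) (evp (coeff F i))) \<and>
    (\<forall>u t. ev2 F u t = f (\<lambda>i. u i + t * v i))"
  using assms
proof (induction rule: pdeg.induct)
  case (pdeg_const d c)
  show ?case by (intro exI[of _ "[:cst c:]"]) (auto simp: coeff_pCons pdeg_evp_cst pdeg_evp_0 split: nat.splits)
next
  case (pdeg_var d i)
  then show ?case by (intro exI[of _ "[:Xv i, cst (v i):]"])
      (auto simp: coeff_pCons pdeg_evp_cst pdeg_evp_0 pdeg_evp_Xv split: nat.splits)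
next
  case (pdeg_add d f g)
  then obtain F G where "degree F \<le> d" "degree G \<le> d"
    "\<forall>i. pdeg (d - i) (evp (coeff F i))" "\<forall>i. pdeg (d - i) (evp (coeff G i))"
    "\<forall>u t. ev2 F u t = f (\<lambda>i. u i + t * v i)" "\<forall>u t. ev2 G u t = g (\<lambda>i. u i + t * v i)" by blast
  then show ?case by (intro exI[of _ "F + G"]) (auto intro: degree_add_le pdeg.pdeg_add)
next
  case (pdeg_mult d f e g m)
  then obtain F G where FG: "degree F \<le> d" "degree G \<le> e"
    "\<forall>i. pdeg (d - i) (evp (coeff F i))" "\<forall>i. pdeg (e - i) (evp (coeff G i))"
    "\<forall>u t. ev2 F u t = f (\<lambda>i. u i + t * v i)" "\<forall>u t. ev2 G u t = g (\<lambda>i. u i + t * v i)" by blast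
  have "pdeg (m - i) (evp (coeff (F * G) i))" for i
    unfolding coeff_mult
  proof (rule pdeg_evp_sum)
    fix j assume j: "j \<in> {..i}"
    show "pdeg (m - i) (evp (coeff F j * coeff G (i - j)))"
    \<comment> \<open>Where neither subtraction is truncated, the degree bounds \<open>d - j\<close>
      and \<open>e - (i - j)\<close> add up to at most \<open>m - i\<close>; elsewhere the product
      of coefficients is 0.\<close>
    proof (cases "j \<le> d \<and> i - j \<le> e")
      case True
      show ?thesis by (rule pdeg_evp_mult[OF FG(3)[rule_format, of j] FG(4)[rule_format, of "i - j"]])
          (use True j pdeg_mult.hyps in auto)
    next
      case False
      then have "coeff F j * coeff G (i - j) = 0" using FG(1,2) by (auto simp: coeff_eq_0 not_le)
      then show ?thesis by (simp add: pdeg_evp_0)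
    qed
  qed
  moreover have "degree (F * G) \<le> m" using degree_mult_le[of F G] FG(1,2) pdeg_mult.hyps by linarith
  ultimately show ?case using FG(5,6) by (intro exI[of _ "F * G"]) auto
qed

text \<open>The coefficient of \<open>t ^ i\<close> in \<open>f (t x)\<close> is the homogeneous
  component of \<open>f\<close> of degree \<open>i\<close>.\<close>

lemma homogeneous_expansion:
  fixes f :: "(nat \<Rightarrow> 'a::comm_ring_1) \<Rightarrow> 'a"
  assumes "pdeg d f"
  shows "\<exists>H. degree H \<le> d \<and> (\<forall>i. pdeg i (evp (coeff H i))) \<and>
    (\<forall>x t. ev2 H x t = f (\<lambda>i. t * x i))"
  using assms
proof (induction rule: pdeg.induct)
  case (pdeg_const d c)
  show ?case by (intro exI[of _ "[:cst c:]"]) (auto simp: coeff_pCons pdeg_evp_cst pdeg_evp_0 split: nat.splits)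
next
  case (pdeg_var d i)
  then show ?case by (intro exI[of _ "[:0, Xv i:]"])
      (auto simp: coeff_pCons pdeg_evp_0 pdeg_evp_Xv split: nat.splits)
next
  case (pdeg_add d f g)
  then obtain F G where "degree F \<le> d" "degree G \<le> d"
    "\<forall>i. pdeg i (evp (coeff F i))" "\<forall>i. pdeg i (evp (coeff G i))"
    "\<forall>u t. ev2 F u t = f (\<lambda>i. t * u i)" "\<forall>u t. ev2 G u t = g (\<lambda>i. t * u i)" by blast
  then show ?case by (intro exI[of _ "F + G"]) (auto intro: degree_add_le pdeg.pdeg_add)
next
  case (pdeg_mult d f e g m)
  then obtain F G where FG: "degree F \<le> d" "degree G \<le> e"
    "\<forall>i. pdeg i (evp (coeff F i))" "\<forall>i. pdeg i (evp (coeff G i))"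
    "\<forall>u t. ev2 F u t = f (\<lambda>i. t * u i)" "\<forall>u t. ev2 G u t = g (\<lambda>i. t * u i)" by blast
  have "pdeg i (evp (coeff (F * G) i))" for i
    unfolding coeff_mult
    by (rule pdeg_evp_sum, rule pdeg_evp_mult[OF FG(3)[rule_format] FG(4)[rule_format]]) auto
  moreover have "degree (F * G) \<le> m" using degree_mult_le[of F G] FG(1,2) pdeg_mult.hyps by linarith
  ultimately show ?case using FG(5,6) by (intro exI[of _ "F * G"]) auto
qed

text \<open>Semantic counterpart of membership in \<open>pf_vars n\<close>: it passes to
  coefficients, determinants and cofactors without inspecting how they are built.\<close>

definition depends_below :: "nat \<Rightarrow> 'a::comm_ring_1 polyfun \<Rightarrow> bool" where
  "depends_below n f \<longleftrightarrow> (\<forall>x y. (\<forall>i<n. x i = y i) \<longrightarrow> evp f x = evp f y)"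

lemma depends_belowD: "depends_below n f \<Longrightarrow> (\<And>i. i < n \<Longrightarrow> x i = y i) \<Longrightarrow> evp f x = evp f y"
  by (simp add: depends_below_def)

text \<open>\<open>T\<close> is the homogeneous component of top degree; it is the constant leading coefficient
  of \<open>f\<close> on every line in direction \<open>v\<close>.\<close>

lemma top_form_exists:
  fixes f :: "'a::alg_closed_field polyfun"
  assumes "f \<noteq> 0"
  shows "\<exists>d T. pdeg d (evp f) \<and> T \<noteq> 0 \<and> pdeg d (evp T) \<and> (\<forall>e. pdeg e (evp f) \<longrightarrow> d \<le> e) \<and>
    (\<forall>n. depends_below n f \<longrightarrow> depends_below n T) \<and>
    (\<forall>v. \<exists>F. degree F \<le> d \<and> coeff F d = cst (evp T v) \<and> (\<forall>i. pdeg d (evp (coeff F i))) \<and>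
       (\<forall>u t. ev2 F u t = evp f (\<lambda>i. u i + t * v i)))"
proof -
  define d where "d = (LEAST d. pdeg d (evp f))"
  have d: "pdeg d (evp f)" unfolding d_def using ex_pdeg by (metis LeastI)
  have least: "d \<le> e" if "pdeg e (evp f)" for e unfolding d_def using that by (rule Least_le)
  obtain H where H: "degree H \<le> d" "\<And>i. pdeg i (evp (coeff H i))" "\<And>x t. ev2 H x t = evp f (\<lambda>i. t * x i)"
    using homogeneous_expansion[OF d] by blast
  have top: "coeff H d \<noteq> 0"
  proof
    assume 0: "coeff H d = 0"
    have f: "evp f x = (\<Sum>i\<le>d. evp (coeff H i) x)" for x
      using ev2_eq_sum[OF H(1), where u = x and t = 1] H(3)[where x = x and t = 1] by simp
    show False
    proof (cases d)
      case 0
      then have "evp f x = 0" for x using f[of x] \<open>coeff H d = 0\<close> by simp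
      then show False using assms by (auto simp: pf_eq_0_iff)
    next
      case (Suc e)
      have "f = (\<Sum>i\<le>e. coeff H i)"
        using f 0 Suc by (intro pf_eqI) simp
      moreover have "pdeg e (evp (\<Sum>i\<le>e. coeff H i))"
        by (rule pdeg_evp_sum) (use H(2) pdeg_mono in blast)
      ultimately show False using least[of e] Suc by simp
    qed
  qed
  have depends_below: "depends_below n (coeff H d)" if "depends_below n f" for n
    unfolding depends_below_def
  proof (intro allI impI)
    fix x y :: "nat \<Rightarrow> 'a" assume "\<forall>i<n. x i = y i"
    then have "ev2 H x t = ev2 H y t" for t unfolding H(3) by (intro depends_belowD[OF that]) simp
    then show "evp (coeff H d) x = evp (coeff H d) y" by (rule ev2_eqD)
  qed
  have "\<exists>F. degree F \<le> d \<and> coeff F d = cst (evp (coeff H d) v) \<and> (\<forall>i. pdeg d (evp (coeff F i))) \<and>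
       (\<forall>u t. ev2 F u t = evp f (\<lambda>i. u i + t * v i))" for v
  proof -
    obtain F where F: "degree F \<le> d" "\<And>i. pdeg (d - i) (evp (coeff F i))"
        "\<And>u t. ev2 F u t = evp f (\<lambda>i. u i + t * v i)"
      using line_expansion[OF d] by blast
    \<comment> \<open>At \<open>u = 0\<close> the line expansion becomes that of
      \<open>f (t v)\<close>, whose coefficient of \<open>t ^ d\<close> is the top form at
      \<open>v\<close>. As \<open>coeff F d\<close> has degree at most \<open>d - d = 0\<close>, it
      takes this value everywhere.\<close>
    have "evp (coeff F d) (\<lambda>_. 0) = evp (coeff H d) v"
      by (rule ev2_eqD) (simp add: F(3) H(3))
    then have "coeff F d = cst (evp (coeff H d) v)"
      using pdeg_0_imp_const[OF F(2)[of d]] by (intro pf_eqI) (metis diff_self_eq_0 evp_cst)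
    then show ?thesis using F pdeg_mono[OF F(2)] by (intro exI[of _ F]) auto
  qed
  then show ?thesis using d least top H(2) depends_below by (intro exI[of _ d] exI[of _ "coeff H d"]) auto
qed

text \<open>Degrees add: on the line through the origin in a direction where neither top form
  vanishes, \<open>g\<close> and \<open>h\<close> keep their full degrees \<open>d\<close> and
  \<open>e\<close>, while \<open>g * h\<close> has degree at most \<open>\<delta>\<close>
  there.\<close>

lemma pdeg_factor:
  fixes g h :: "'a::alg_closed_field polyfun"
  assumes "pdeg \<delta> (evp (g * h))" "g * h \<noteq> 0"
  shows "pdeg \<delta> (evp g)"
proof -
  have nz: "g \<noteq> 0" "h \<noteq> 0" using assms(2) by auto
  obtain d T where T: "pdeg d (evp g)" "T \<noteq> 0"
    "\<And>v. \<exists>F. degree F \<le> d \<and> coeff F d = cst (evp T v) \<and> (\<forall>u t. ev2 F u t = evp g (\<lambda>i. u i + t * v i))"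
    using top_form_exists[OF nz(1)] by meson
  obtain e U where U: "U \<noteq> 0"
    "\<And>v. \<exists>F. degree F \<le> e \<and> coeff F e = cst (evp U v) \<and> (\<forall>u t. ev2 F u t = evp h (\<lambda>i. u i + t * v i))"
    using top_form_exists[OF nz(2)] by meson
  have "T * U \<noteq> 0" using T(2) U(1) by simp
  then obtain v where "evp (T * U) v \<noteq> 0" using pf_eq_0_iff by blast
  then have v: "evp T v \<noteq> 0" "evp U v \<noteq> 0" by auto
  obtain F where F: "degree F \<le> d" "coeff F d = cst (evp T v)" "\<And>u t. ev2 F u t = evp g (\<lambda>i. u i + t * v i)"
    using T(3) by blast
  obtain G where G: "degree G \<le> e" "coeff G e = cst (evp U v)" "\<And>u t. ev2 G u t = evp h (\<lambda>i. u i + t * v i)"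
    using U(2) by blast
  define p where "p = at_pt F (\<lambda>_. 0)"
  define q where "q = at_pt G (\<lambda>_. 0)"
  have p: "degree p = d" unfolding p_def
    using v(1) F degree_at_pt_le[of F] by (intro antisym le_degree) (auto intro: order.trans)
  have q: "degree q = e" unfolding q_def
    using v(2) G degree_at_pt_le[of G] by (intro antisym le_degree) (auto intro: order.trans)
  have "coeff p d \<noteq> 0" "coeff q e \<noteq> 0" using v F(2) G(2) by (auto simp: p_def q_def)
  then have pq: "p \<noteq> 0" "q \<noteq> 0" by auto
  have "degree [:0, v i:] \<le> 1" for i by simp
  from pdeg_curve[OF assms(1), where \<gamma> = "\<lambda>i. [:0, v i:]", OF this] obtain r where r: "degree r \<le> \<delta> * 1" "\<And>t. poly r t = evp (g * h) (\<lambda>i. poly [:0, v i:] t)"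
    by blast
  have "r = p * q"
    by (rule poly_eqI_alg_closed) (simp add: r(2) p_def q_def poly_at_pt F(3) G(3))
  then have "d + e \<le> \<delta>" using r(1) degree_mult_eq[OF pq] p q by simp
  then show ?thesis using pdeg_mono[OF T(1)] by simp
qed

lemma unit_pf_const:
  fixes u :: "'a::alg_closed_field polyfun"
  assumes "u dvd 1"
  shows "\<exists>c. c \<noteq> 0 \<and> u = cst c"
proof -
  obtain w where w: "1 = u * w" using assms by (auto simp: dvd_def)
  then have "pdeg 0 (evp u)" using pdeg_factor[of 0 u w] pdeg_evp_1[of 0] by simp
  then have "u = cst (evp u (\<lambda>_. 0))" by (intro pf_eqI) (metis evp_cst pdeg_0_imp_const)
  moreover have "evp u (\<lambda>_. 0) \<noteq> 0" using w by (metis evp_1 evp_mult mult_zero_left zero_neq_one)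
  ultimately show ?thesis by blast
qed

lemma cst_dvd_1: "c \<noteq> 0 \<Longrightarrow> cst (c :: 'a::field) dvd 1"
  by (rule dvdI[of _ _ "cst (inverse c)"]) (auto intro!: pf_eqI)

section \<open>Unique factorisation of polynomial functions\<close>

fun pf_vars :: "nat \<Rightarrow> 'a::comm_ring_1 polyfun set" where
  "pf_vars 0 = range cst"
| "pf_vars (Suc n) = adjoin (pf_vars n) (Xv n)"

lemma evp_poly_Xv: "evp (poly P (Xv n)) x = poly (at_pt P x) (x n)"
  unfolding at_pt_def by (induction P) (auto simp: map_poly_pCons)

lemma depends_below_pf_vars: "f \<in> pf_vars n \<Longrightarrow> depends_below n f"
proof (induction n arbitrary: f)
  case (Suc n)
  then obtain P where P: "P \<in> polys_over (pf_vars n)" "f = poly P (Xv n)" by (auto simp: adjoin_def)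
  then have "depends_below n (coeff P i)" for i using Suc.IH by (simp add: polys_over_def)
  then have "at_pt P x = at_pt P y" if "\<forall>i<Suc n. x i = y i" for x y
    using that by (intro poly_eqI) (auto simp: depends_below_def)
  then show ?case unfolding depends_below_def P(2) evp_poly_Xv by (metis lessI)
qed (auto simp: depends_below_def)

text \<open>The coefficients do not see variable \<open>n\<close>, so varying it alone turns the
  relation into a univariate polynomial with fixed coefficients that vanishes everywhere.\<close>

lemma Xv_transcendental:
  fixes P :: "'a::alg_closed_field polyfun poly"
  assumes P: "P \<in> polys_over (pf_vars n)" and 0: "poly P (Xv n) = 0"
  shows "P = 0"
proof (intro poly_eqI pf_eqI)
  fix i x
  have d: "depends_below n (coeff P j)" for j using P depends_below_pf_vars by (auto simp: polys_over_def)
  have "poly (at_pt P x) y = 0" for y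
  proof -
    have "at_pt P x = at_pt P (x(n := y))"
    proof (rule poly_eqI)
      fix j
      have "\<forall>i<n. x i = (x(n := y)) i" by simp
      then show "coeff (at_pt P x) j = coeff (at_pt P (x(n := y))) j"
        using d[of j] unfolding depends_below_def coeff_at_pt by blast
    qed
    then show ?thesis using evp_poly_Xv[of P n "x(n := y)"] 0 by simp
  qed
  then have "at_pt P x = 0" by (intro poly_eqI_alg_closed) simp
  then show "evp (coeff P i) x = evp (coeff 0 i) x" by (metis coeff_0 coeff_at_pt evp_0)
qed

lemma ufd_on_pf_vars: "ufd_on (pf_vars n :: 'a::alg_closed_field polyfun set)"
proof (induction n)
  case 0
  have one: "(1 :: 'a polyfun) = cst 1" by (rule pf_eqI) simp
  have "cst a - cst b \<in> range cst" "cst a * cst b \<in> range cst" for a b :: 'a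
    by (rule image_eqI[of _ _ "a - b"], rule pf_eqI, simp, simp)
      (rule image_eqI[of _ _ "a * b"], rule pf_eqI, simp, simp)
  then have "subring_of (range (cst :: 'a \<Rightarrow> 'a polyfun))" unfolding subring_of_def one by auto
  moreover have "\<exists>u ps. u \<in> range cst \<and> dvd_in (range cst) u 1 \<and> (\<forall>p\<in>set ps. prime_in (range cst) p) \<and> cst c = u * prod_list ps"
    if "cst c \<noteq> 0" for c :: 'a
  proof (intro exI[of _ "cst c"] exI[of _ "[]"] conjI)
    have "c \<noteq> 0" using that by (auto simp: pf_eq_0_iff)
    then show "dvd_in (range cst) (cst c) 1"
      unfolding dvd_in_def by (intro bexI[of _ "cst (inverse c)"] pf_eqI) auto
  qed auto
  ultimately show ?case unfolding ufd_on_def by auto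
next
  case (Suc n)
  then show ?case using ufd_on_adjoin[of "pf_vars n" "Xv n"] Xv_transcendental by (auto simp: ufd_on_def)
qed

lemma subring_of_pf_vars: "subring_of (pf_vars n :: 'a::alg_closed_field polyfun set)"
  using ufd_on_pf_vars by (auto simp: ufd_on_def)

lemma pf_vars_mono:
  assumes "m \<le> n"
  shows "(pf_vars m :: 'a::alg_closed_field polyfun set) \<subseteq> pf_vars n"
  using assms
proof (induction rule: dec_induct)
  case (step n)
  have "(pf_vars n :: 'a polyfun set) \<subseteq> adjoin (pf_vars n) (Xv n)"
  proof
    fix f :: "'a polyfun" assume "f \<in> pf_vars n"
    then have "poly [:f:] (Xv n) \<in> adjoin (pf_vars n) (Xv n)"
      unfolding adjoin_def by (intro imageI const_in_polys_over subring_of_pf_vars)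
    then show "f \<in> adjoin (pf_vars n) (Xv n)" by simp
  qed
  then show ?case using step by auto
qed simp

lemma cst_in_pf_vars: "cst (c :: 'a::alg_closed_field) \<in> pf_vars n"
  using pf_vars_mono[of 0 n] by auto

lemma Xv_in_pf_vars:
  assumes "i < n" shows "(Xv i :: 'a::alg_closed_field polyfun) \<in> pf_vars n"
proof -
  have "poly (monom 1 1) (Xv i :: 'a polyfun) \<in> adjoin (pf_vars i) (Xv i)"
    unfolding adjoin_def by (intro imageI monom_in_polys_over subring_of_pf_vars subring_ofD(2))
  then have "(Xv i :: 'a polyfun) \<in> pf_vars (Suc i)" by (simp add: poly_monom)
  then show ?thesis using pf_vars_mono[of "Suc i" n] assms by auto
qed

lemma ex_pf_vars: "\<exists>n. (f :: 'a::alg_closed_field polyfun) \<in> pf_vars n"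
proof (induction f rule: pf_induct)
  case (cst c)
  show ?case using cst_in_pf_vars by blast
next
  case (Xv i)
  show ?case using Xv_in_pf_vars by blast
next
  case (add f g)
  then obtain m n where "f \<in> pf_vars m" "g \<in> pf_vars n" by blast
  then have "f \<in> pf_vars (max m n)" "g \<in> pf_vars (max m n)"
    using pf_vars_mono[of m "max m n"] pf_vars_mono[of n "max m n"] by auto
  then show ?case using subring_ofD(4)[OF subring_of_pf_vars] by blast
next
  case (mult f g)
  then obtain m n where "f \<in> pf_vars m" "g \<in> pf_vars n" by blast
  then have "f \<in> pf_vars (max m n)" "g \<in> pf_vars (max m n)"
    using pf_vars_mono[of m "max m n"] pf_vars_mono[of n "max m n"] by auto
  then show ?case using subring_ofD(6)[OF subring_of_pf_vars] by blast
qed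

lemma prime_in_pf_vars_mono:
  assumes "n \<le> m" "prime_in (pf_vars n) (p :: 'a::alg_closed_field polyfun)"
  shows "prime_in (pf_vars m) p"
  using assms
proof (induction rule: dec_induct)
  case (step m)
  then show ?case using prime_in_adjoin_base[of "pf_vars m" "Xv m"] Xv_transcendental subring_of_pf_vars by auto
qed

text \<open>A divisibility involves finitely many elements and so takes place in some
  \<open>pf_vars m\<close> with \<open>m \<ge> n\<close>, where \<open>p\<close> is still
  prime.\<close>

lemma prime_elem_pf:
  assumes p: "prime_in (pf_vars n) (p :: 'a::alg_closed_field polyfun)"
  shows "prime_elem p"
proof (rule prime_elemI)
  have p': "\<exists>m. prime_in (pf_vars m) p \<and> a \<in> pf_vars m \<and> b \<in> pf_vars m \<and> c \<in> pf_vars m" for a b c :: "'a polyfun"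
  proof -
    obtain k l r where "a \<in> pf_vars k" "b \<in> pf_vars l" "c \<in> pf_vars r" using ex_pf_vars by metis
    then show ?thesis
      using prime_in_pf_vars_mono[OF _ p, of "n + k + l + r"] pf_vars_mono[of k "n + k + l + r"]
        pf_vars_mono[of l "n + k + l + r"] pf_vars_mono[of r "n + k + l + r"]
      by (intro exI[of _ "n + k + l + r"]) auto
  qed
  show "p \<noteq> 0" using p by (simp add: prime_in_def)
  show "\<not> p dvd 1"
  proof
    assume "p dvd 1"
    then obtain c where c: "1 = p * c" by (auto simp: dvd_def)
    obtain m where "prime_in (pf_vars m) p" "c \<in> pf_vars m" using p' by blast
    then show False using c by (auto simp: prime_in_def dvd_in_def)
  qed
  fix a b assume "p dvd a * b"
  then obtain c where c: "a * b = p * c" by (auto simp: dvd_def)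
  obtain m where m: "prime_in (pf_vars m) p" "a \<in> pf_vars m" "b \<in> pf_vars m" "c \<in> pf_vars m" using p' by blast
  then have "dvd_in (pf_vars m) p (a * b)" using c by (auto simp: dvd_in_def)
  then have "dvd_in (pf_vars m) p a \<or> dvd_in (pf_vars m) p b" using m by (auto simp: prime_in_def)
  then show "p dvd a \<or> p dvd b" by (auto simp: dvd_in_def)
qed

text \<open>Units are constants, and the primes use no new variables; the latter keeps the
  distinguishing prime \<open>g\<close> within the \<open>n\<close> variables of the
  circuit.\<close>

lemma pf_prime_factorization:
  assumes "f \<in> pf_vars n" "(f :: 'a::alg_closed_field polyfun) \<noteq> 0"
  shows "\<exists>c ps. c \<noteq> 0 \<and> (\<forall>p\<in>set ps. prime_elem p \<and> p \<in> pf_vars n) \<and> f = cst c * prod_list ps"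
proof -
  obtain u ps where u: "dvd_in (pf_vars n) u 1" "\<forall>p\<in>set ps. prime_in (pf_vars n) p" "f = u * prod_list ps"
    using ufd_on_pf_vars[of n] assms unfolding ufd_on_def by blast
  from u(1) have "u dvd 1" unfolding dvd_in_def by (metis dvdI)
  then obtain c where "c \<noteq> 0" "u = cst c" using unit_pf_const by blast
  moreover have "prime_elem p \<and> p \<in> pf_vars n" if "p \<in> set ps" for p
    using that u(2) prime_elem_pf[of n p] by (simp add: prime_in_def)
  ultimately show ?thesis using u(3) by blast
qed


subsection \<open>Power sum points hit every polynomial of low degree\<close>

text \<open>Setting the variables from \<open>n\<close> on to 0 changes neither \<open>f\<close> nor
  \<open>g\<close>; cancelling \<open>g\<close> shows that it does not change \<open>h\<close>
  either.\<close>

lemma depends_below_cofactor: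
  fixes f g h :: "'a::alg_closed_field polyfun"
  assumes "f = g * h" "g \<noteq> 0" "depends_below n f" "depends_below n g"
  shows "depends_below n h"
proof -
  define \<pi> where "\<pi> x = (\<lambda>i. if i < n then x i else 0)" for x :: "nat \<Rightarrow> 'a"
  have \<pi>: "evp q (\<pi> x) = evp q x" if "depends_below n q" for q x using that by (auto simp: depends_below_def \<pi>_def)
  obtain h' where h': "\<And>x. evp h' x = evp h (\<lambda>i. evp (if i < n then Xv i else 0) x)"
    using pf_subst[of h "\<lambda>i. if i < n then Xv i else 0"] by blast
  have h'\<pi>: "evp h' x = evp h (\<pi> x)" for x
    unfolding h' \<pi>_def by (intro arg_cong[of _ _ "evp h"]) auto
  have "g * h' = g * h"
  proof (rule pf_eqI)
    fix x
    have "evp (g * h') x = evp f (\<pi> x)" using \<pi>[OF assms(4), of x] by (simp add: h'\<pi> assms(1))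
    then show "evp (g * h') x = evp (g * h) x" using \<pi>[OF assms(3)] assms(1) by simp
  qed
  then have "h = h'" using assms(2) by simp
  then have *: "evp h x = evp h (\<pi> x)" for x using h'\<pi> by simp
  have "\<pi> x = \<pi> y" if "\<forall>i<n. x i = y i" for x y using that by (auto simp: \<pi>_def)
  then show ?thesis unfolding depends_below_def using * by metis
qed

text \<open>A linear combination of \<open>D\<close> points of the moment curve
  \<open>(1, y, y^2, ...)\<close>, with nodes \<open>y k\<close> and weights
  \<open>z k\<close>.\<close>

definition power_sum_pt :: "nat \<Rightarrow> (nat \<Rightarrow> 'a::comm_ring_1) \<Rightarrow> (nat \<Rightarrow> 'a) \<Rightarrow> nat \<Rightarrow> 'a" where
  "power_sum_pt D y z = (\<lambda>i. \<Sum>k<D. z k * y k ^ i)"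

text \<open>The summands are concatenated and \<open>t\<close> is absorbed into the weights; so a
  line whose base point and direction are power sum points consists of such points.\<close>

lemma power_sum_pt_add: "\<exists>y'' z''. power_sum_pt (D + D') y'' z'' = (\<lambda>i. power_sum_pt D y z i + t * power_sum_pt D' y' z' i)"
proof (intro exI ext)
  fix i
  let ?y = "\<lambda>k. if k < D then y k else y' (k - D)" and ?z = "\<lambda>k. if k < D then z k else t * z' (k - D)"
  have "power_sum_pt (D + D') ?y ?z i = (\<Sum>k<D. ?z k * ?y k ^ i) + (\<Sum>k=D..<D + D'. ?z k * ?y k ^ i)"
    unfolding power_sum_pt_def by (simp only: lessThan_atLeast0 sum.atLeastLessThan_concat[of 0 D "D + D'"] le_add1 zero_le)
  also have "(\<Sum>k<D. ?z k * ?y k ^ i) = power_sum_pt D y z i" unfolding power_sum_pt_def by (intro sum.cong) auto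
  also have "(\<Sum>k=D..<D + D'. ?z k * ?y k ^ i) = t * power_sum_pt D' y' z' i"
    unfolding power_sum_pt_def sum_distrib_left using sum.shift_bounds_nat_ivl[of "\<lambda>k. ?z k * ?y k ^ i" 0 D D']
    by (simp add: lessThan_atLeast0 add.commute mult.assoc)
  finally show "power_sum_pt (D + D') ?y ?z i = power_sum_pt D y z i + t * power_sum_pt D' y' z' i" .
qed

text \<open>If \<open>Q\<close> is constant in direction \<open>P y = (\<Sum>j<m. y ^ j * a j)\<close> for all \<open>y \<noteq> 0\<close>, then also
  for \<open>y = 0\<close> by polynomial identity, i.e. in direction \<open>a 0\<close>; now divide \<open>P y - a 0\<close> by \<open>y\<close>.\<close>

lemma invariant_directions:
  fixes Q :: "'a::alg_closed_field polyfun"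
  assumes "\<And>y w t. y \<noteq> 0 \<Longrightarrow> evp Q (\<lambda>i. w i + t * (\<Sum>j<m. y ^ j * a j i)) = evp Q w" "j < m"
  shows "evp Q (\<lambda>i. w i + t * a j i) = evp Q w"
  using assms
proof (induction m arbitrary: a j w t)
  case (Suc m)
  have a0: "evp Q (\<lambda>i. w i + t * a 0 i) = evp Q w" for w t
  proof -
    obtain d where d: "pdeg d (evp Q)" using ex_pdeg by blast
    define \<gamma> where "\<gamma> i = [:w i:] + smult t (\<Sum>j<Suc m. monom (a j i) j)" for i
    have "degree (\<Sum>j<Suc m. monom (a j i) j) \<le> m" for i
      by (rule degree_sum_le) (auto intro: order.trans[OF degree_monom_le])
    then have "degree (\<gamma> i) \<le> m" for i
      unfolding \<gamma>_def by (intro degree_add_le order.trans[OF degree_smult_le]) auto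
    from pdeg_curve[OF d, where \<gamma> = \<gamma>, OF this] obtain p
      where p: "\<And>y. poly p y = evp Q (\<lambda>i. poly (\<gamma> i) y)" by blast
    have \<gamma>: "poly (\<gamma> i) y = w i + t * (\<Sum>j<Suc m. y ^ j * a j i)" for i y
      by (simp add: \<gamma>_def poly_sum poly_monom mult.commute)
    have "p = [:evp Q w:]"
      by (rule poly_eqI_alg_closed) (simp add: p \<gamma> Suc.prems(1) del: sum.lessThan_Suc)
    then have "evp Q w = evp Q (\<lambda>i. poly (\<gamma> i) 0)" using p[of 0] by simp
    moreover have "poly (\<gamma> i) 0 = w i + t * a 0 i" for i
      unfolding \<gamma> by (subst sum.lessThan_Suc_shift) simp
    ultimately show ?thesis by simp
  qed
  show ?case
  proof (cases j)
    case (Suc j')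
    have "evp Q (\<lambda>i. w i + t * (\<Sum>j<m. y ^ j * a (Suc j) i)) = evp Q w" if y: "y \<noteq> 0" for y w t
    proof -
      have "t * (\<Sum>j<m. y ^ j * a (Suc j) i) = (t / y) * (\<Sum>j<Suc m. y ^ j * a j i) + (- (t / y)) * a 0 i" for i
      proof -
        have "(\<Sum>j<Suc m. y ^ j * a j i) = a 0 i + y * (\<Sum>j<m. y ^ j * a (Suc j) i)"
          by (subst sum.lessThan_Suc_shift) (simp add: sum_distrib_left mult.assoc)
        then show ?thesis using y by (simp only:) (simp add: field_simps)
      qed
      then have "evp Q (\<lambda>i. w i + t * (\<Sum>j<m. y ^ j * a (Suc j) i)) =
          evp Q (\<lambda>i. (w i + (t / y) * (\<Sum>j<Suc m. y ^ j * a j i)) + (- (t / y)) * a 0 i)"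
        by (simp only: add.assoc)
      also have "\<dots> = evp Q w" unfolding a0 by (rule Suc.prems(1)[OF y])
      finally show ?thesis .
    qed
    from Suc.IH[of "\<lambda>j. a (Suc j)", OF this, of j'] show ?thesis using Suc Suc.prems(2) by simp
  qed (use a0 in simp)
qed simp

text \<open>Expand \<open>Q (w + z * p y)\<close>, \<open>p y = (y ^ i)\<^sub>i\<close>, in powers of \<open>z\<close>: the coefficients of positive
  powers have smaller degree in \<open>w\<close> and vanish by induction, so \<open>Q\<close> is invariant under translation
  by all \<open>p y\<close>, which span the space.\<close>

lemma vanishing_on_power_sum_pt:
  fixes Q :: "'a::alg_closed_field polyfun"
  assumes "pdeg D (evp Q)" "depends_below n Q" "\<And>y z. evp Q (power_sum_pt D y z) = 0"
  shows "Q = 0"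
  using assms
proof (induction D arbitrary: Q)
  case 0
  then show ?case
    using pdeg_0_imp_const[OF 0(1) refl, of _ "power_sum_pt 0 (\<lambda>_. 0) (\<lambda>_. 0)"] by (intro pf_eqI) auto
next
  case (Suc D)
  have inv: "evp Q (\<lambda>i. w i + t * y ^ i) = evp Q w" for y w t
  proof -
    obtain F where F: "\<And>i. pdeg (Suc D - i) (evp (coeff F i))"
        "\<And>u t. ev2 F u t = evp Q (\<lambda>i. u i + t * y ^ i)"
      using line_expansion[OF Suc.prems(1), of "\<lambda>i. y ^ i"] by blast
    \<comment> \<open>Adding \<open>t\<close> times a point of the moment curve supplies the one
      summand missing for the assumption on \<open>Q\<close>, so the coefficients of
      \<open>F\<close> vanish at all points with \<open>D\<close> summands.\<close>
    have "coeff F i = 0" if i: "i > 0" for i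
    proof (rule Suc.IH)
      show "pdeg D (evp (coeff F i))" by (rule pdeg_mono[OF F(1)]) (use i in simp)
      show "depends_below n (coeff F i)" unfolding depends_below_def
      proof (intro allI impI)
        fix x x' :: "nat \<Rightarrow> 'a" assume "\<forall>i<n. x i = x' i"
        then have "ev2 F x t = ev2 F x' t" for t
          unfolding F(2) by (intro depends_belowD[OF Suc.prems(2)]) simp
        then show "evp (coeff F i) x = evp (coeff F i) x'" by (rule ev2_eqD)
      qed
      fix ys zs
      have "ev2 F (power_sum_pt D ys zs) t = ev2 0 (power_sum_pt D ys zs) t" for t
      proof -
        have "(\<lambda>i. power_sum_pt D ys zs i + t * y ^ i) = power_sum_pt (Suc D) (ys(D := y)) (zs(D := t))"
          by (auto simp: power_sum_pt_def intro!: ext sum.cong)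
        then show ?thesis using F(2) Suc.prems(3) by simp
      qed
      then have "evp (coeff F i) (power_sum_pt D ys zs) = evp (coeff 0 i) (power_sum_pt D ys zs)" by (rule ev2_eqD)
      then show "evp (coeff F i) (power_sum_pt D ys zs) = 0" by simp
    qed
    then have "degree F = 0" by (intro antisym degree_le) auto
    then obtain c where c: "F = [:c:]" by (meson degree_eq_zeroE)
    show ?thesis using F(2)[where u = w and t = t] F(2)[where u = w and t = 0] by (simp add: c)
  qed
  \<comment> \<open>On the first \<open>n\<close> coordinates a curve point is the sum of
    \<open>y ^ j\<close> times the unit vectors, so invariance passes from the curve to the unit
    vectors.\<close>
  have unit: "evp Q (\<lambda>i. w i + t * (if i = j then 1 else 0)) = evp Q w" if "j < n" for j w t
  proof (rule invariant_directions[where m = n and a = "\<lambda>j i. if i = j then 1 else 0", OF _ that])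
    fix y t :: 'a and w :: "nat \<Rightarrow> 'a"
    have "(\<Sum>j<n. y ^ j * (if i = j then 1 else 0)) = y ^ i" if "i < n" for i
      using that by (subst sum.remove[of _ i]) auto
    then have "evp Q (\<lambda>i. w i + t * (\<Sum>j<n. y ^ j * (if i = j then 1 else 0))) = evp Q (\<lambda>i. w i + t * y ^ i)"
      by (intro depends_belowD[OF Suc.prems(2)]) simp
    then show "evp Q (\<lambda>i. w i + t * (\<Sum>j<n. y ^ j * (if i = j then 1 else 0))) = evp Q w"
      using inv by simp
  qed
  have *: "evp Q (\<lambda>i. if i < k then x i else 0) = evp Q (\<lambda>_. 0)" if "k \<le> n" for k x
    using that
  proof (induction k)
    case (Suc k)
    have "(\<lambda>i. if i < Suc k then x i else 0) = (\<lambda>i. (if i < k then x i else 0) + x k * (if i = k then 1 else 0))"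
      by (auto simp: less_Suc_eq)
    then show ?case using unit[of k "\<lambda>i. if i < k then x i else 0" "x k"] Suc by simp
  qed simp
  \<comment> \<open>Zero weights give the origin, so the constant value of \<open>Q\<close> is one
    of the values known to be 0.\<close>
  have z0: "power_sum_pt (Suc D) y (\<lambda>_. 0) = (\<lambda>_. 0)" for y :: "nat \<Rightarrow> 'a" by (simp add: power_sum_pt_def)
  show ?case
  proof (rule pf_eqI)
    fix x
    have "evp Q x = evp Q (\<lambda>i. if i < n then x i else 0)" by (intro depends_belowD[OF Suc.prems(2)]) simp
    then show "evp Q x = evp 0 x" using *[of n x] Suc.prems(3)[of _ "\<lambda>_. 0"] z0 by simp
  qed
qed

text \<open>The pullback of each \<open>Q\<close> to the parameters is nonzero, and so is the
  product of these pullbacks; hence \<open>D\<close> need not grow with the size of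
  \<open>A\<close>. The parameters \<open>y k\<close> and \<open>z k\<close> become the variables
  \<open>2 * k\<close> and \<open>2 * k + 1\<close>.\<close>

lemma common_power_sum_pt:
  fixes A :: "'a::alg_closed_field polyfun set"
  assumes "finite A" "\<And>Q. Q \<in> A \<Longrightarrow> Q \<noteq> 0 \<and> pdeg D (evp Q) \<and> depends_below n Q"
  shows "\<exists>y z. \<forall>Q\<in>A. evp Q (power_sum_pt D y z) \<noteq> 0"
proof -
  define \<sigma> :: "nat \<Rightarrow> 'a polyfun" where "\<sigma> i = (\<Sum>k<D. Xv (2 * k + 1) * Xv (2 * k) ^ i)" for i
  have "\<exists>S. \<forall>Q. \<forall>x. evp (S Q) x = evp Q (\<lambda>i. evp (\<sigma> i) x)"
    using pf_subst[of _ \<sigma>] by metis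
  then obtain S where S: "\<And>Q x. evp (S Q) x = evp Q (\<lambda>i. evp (\<sigma> i) x)" by blast
  have S_power_sum_pt: "evp (S Q) c = evp Q (power_sum_pt D (\<lambda>k. c (2 * k)) (\<lambda>k. c (2 * k + 1)))" for Q c
    unfolding S \<sigma>_def power_sum_pt_def by simp
  have "S Q \<noteq> 0" if Q: "Q \<in> A" for Q
  proof
    assume 0: "S Q = 0"
    have "evp Q (power_sum_pt D y z) = 0" for y z
      using S_power_sum_pt[of Q "\<lambda>k. if even k then y (k div 2) else z (k div 2)"] 0 by simp
    then show False using vanishing_on_power_sum_pt assms(2)[OF Q] by blast
  qed
  then have "prod S A \<noteq> 0" using assms(1) by simp
  then obtain c where "evp (prod S A) c \<noteq> 0" using pf_eq_0_iff by blast
  then have "\<forall>Q\<in>A. evp (S Q) c \<noteq> 0" using assms(1) by simp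
  then show ?thesis unfolding S_power_sum_pt by blast
qed


subsection \<open>Elimination and prime multiplicities\<close>

lemma shear_ex:
  fixes S :: "'a::comm_ring_1 polyfun poly"
  shows "\<exists>S'. \<forall>u t. ev2 S' u t = ev2 S (\<lambda>i. u i + t * w i) t"
proof (induction S)
  case 0
  show ?case by (intro exI[of _ 0]) simp
next
  case (pCons a S)
  then obtain S' where S': "\<And>u t. ev2 S' u t = ev2 S (\<lambda>i. u i + t * w i) t" by blast
  obtain d where "pdeg d (evp a)" using ex_pdeg by blast
  from line_expansion[OF this, of w] obtain F where F: "\<And>u t. ev2 F u t = evp a (\<lambda>i. u i + t * w i)" by blast
  show ?case by (intro exI[of _ "F + pCons 0 S'"]) (simp add: F S')
qed

text \<open>The substitution \<open>u \<mapsto> u - t v\<close> turns \<open>g (u + t v)\<close> into \<open>g u\<close>, so that the primality of \<open>g\<close>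
  can be applied to each coefficient with respect to \<open>t\<close>.\<close>

lemma prime_no_relation:
  fixes g h :: "'a::alg_closed_field polyfun"
  assumes g: "prime_elem g" "\<not> g dvd h"
    and F: "\<And>u t. ev2 F u t = evp g (\<lambda>i. u i + t * v i)"
    and G: "\<And>u t. ev2 G u t = evp h (\<lambda>i. u i + t * v i)"
    and rel: "r * F + s * G = 0" and deg: "degree s < degree F \<or> s = 0"
  shows "s = 0"
proof -
  obtain r' where r': "\<And>u t. ev2 r' u t = ev2 r (\<lambda>i. u i + t * - v i) t"
    using shear_ex[of r "\<lambda>i. - v i"] by blast
  obtain s' where s': "\<And>u t. ev2 s' u t = ev2 s (\<lambda>i. u i + t * - v i) t"
    using shear_ex[of s "\<lambda>i. - v i"] by blast
  have "smult g r' + smult h s' = 0"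
  proof (rule ev2_eqI)
    fix u t
    let ?u = "\<lambda>i. u i + t * - v i"
    have "ev2 (r * F + s * G) ?u t = 0" by (simp add: rel)
    then have "ev2 r ?u t * evp g u + ev2 s ?u t * evp h u = 0" by (simp add: F G)
    then show "ev2 (smult g r' + smult h s') u t = ev2 0 u t"
      by (simp add: r' s' mult.commute)
  qed
  then have "g * coeff r' i + h * coeff s' i = 0" for i
    by (metis coeff_0 coeff_add coeff_smult)
  then have "h * coeff s' i = g * (- coeff r' i)" for i
    by (metis add_eq_0_iff mult_minus_right add.commute)
  then have "g dvd coeff s' i" for i
    using prime_elem_dvd_multD[OF g(1), of h "coeff s' i"] g(2) by (metis dvdI)
  then have "[:g:] dvd s'" by (simp add: const_poly_dvd_iff)
  then obtain k where k: "s' = smult g k" by (auto simp: dvd_def)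
  obtain k' where k': "\<And>u t. ev2 k' u t = ev2 k (\<lambda>i. u i + t * v i) t"
    using shear_ex[of k v] by blast
  \<comment> \<open>Shearing back turns the factor \<open>g\<close> of \<open>s'\<close> into the
    factor \<open>F\<close> of \<open>s\<close>, whose degree is too large unless
    \<open>s = 0\<close>.\<close>
  have "s = F * k'"
  proof (rule ev2_eqI)
    fix u t
    have "ev2 s u t = ev2 s' (\<lambda>i. u i + t * v i) t" by (simp add: s')
    then show "ev2 s u t = ev2 (F * k') u t" by (simp add: k F k')
  qed
  show ?thesis
  proof (rule ccontr)
    assume "s \<noteq> 0"
    then have "degree s = degree F + degree k'" using \<open>s = F * k'\<close> degree_mult_eq by fastforce
    then show False using deg \<open>s \<noteq> 0\<close> by simp
  qed
qed

section \<open>Resultants as Sylvester determinants\<close>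

lemma pdeg_evp_det:
  fixes A :: "'a::comm_ring_1 polyfun mat"
  assumes A: "A \<in> carrier_mat N N" and e: "\<And>i j. i < N \<Longrightarrow> j < N \<Longrightarrow> pdeg \<delta> (evp (A $$ (i, j)))"
  shows "pdeg (N * \<delta>) (evp (det A))"
proof -
  have s: "pdeg 0 (evp (signof p :: 'a polyfun))" for p
  proof -
    have "(signof p :: 'a polyfun) = cst (signof p)" by (rule pf_eqI) (auto simp: sign_def)
    then show ?thesis by (metis pdeg_evp_cst)
  qed
  have "pdeg (N * \<delta>) (evp (\<Prod>i = 0..<N. A $$ (i, p i)))" if "p permutes {0..<N}" for p
    using pdeg_evp_prod[of "{0..<N}" \<delta> "\<lambda>i. A $$ (i, p i)"] e permutes_in_image[OF that] by simp
  then show ?thesis unfolding det_def'[OF A]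
    by (intro pdeg_evp_sum pdeg_evp_mult[OF s]) auto
qed

lemma evp_det: "evp (det A) u = det (map_mat (\<lambda>c. evp c u) A)"
proof -
  interpret comm_ring_hom "\<lambda>c. evp c u" by unfold_locales auto
  show ?thesis by simp
qed

text \<open>\<open>Q\<close> is the resultant of \<open>F\<close> and \<open>G\<close>, the
  determinant of their Sylvester matrix. A null vector would be a relation ruled out by
  \<open>prime_no_relation\<close>; at a common zero \<open>t\<close>, the powers of
  \<open>t\<close> form a null vector of the transpose. There are \<open>d + e\<close> rows with
  entries of degree at most \<open>\<delta>\<close>, whence the degree bound.\<close>

lemma eliminant_exists:
  fixes g h :: "'a::alg_closed_field polyfun"
  assumes g: "prime_elem g" "\<not> g dvd h"
    and F: "degree F \<le> d" "coeff F d = cst a" "a \<noteq> 0" "\<And>i. pdeg \<delta> (evp (coeff F i))"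
      "\<And>u t. ev2 F u t = evp g (\<lambda>i. u i + t * v i)"
    and G: "degree G \<le> e" "\<And>i. pdeg \<delta> (evp (coeff G i))"
      "\<And>u t. ev2 G u t = evp h (\<lambda>i. u i + t * v i)"
    and depends_below: "depends_below n g" "depends_below n h"
  shows "\<exists>Q. Q \<noteq> 0 \<and> pdeg ((d + e) * \<delta>) (evp Q) \<and> depends_below n Q \<and>
    (\<forall>u t. evp Q u \<noteq> 0 \<longrightarrow> evp g (\<lambda>i. u i + t * v i) = 0 \<longrightarrow> evp h (\<lambda>i. u i + t * v i) \<noteq> 0)"
proof -
  define N where "N = d + e"
  \<comment> \<open>The columns are the shifts of \<open>F\<close> and \<open>G\<close>. The degree
    of \<open>F\<close> is exactly \<open>d\<close>, but \<open>e\<close> may exceed the degree of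
    \<open>G\<close>.\<close>
  define col where "col j = (if j < e then monom 1 j * F else monom 1 (j - e) * G)" for j
  define A where "A = mat N N (\<lambda>(c, j). coeff (col j) c)"
  have A: "A \<in> carrier_mat N N" by (simp add: A_def)
  have a0: "cst a \<noteq> 0" using F(3) by (auto simp: pf_eq_0_iff)
  have dF: "degree F = d" using F(1,2) a0 by (intro antisym le_degree) auto
  have F0: "F \<noteq> 0" using a0 F(2) by auto
  have col_deg: "degree (col j) < N" if "j < N" for j
  proof (cases "j < e")
    case True
    then have "degree (col j) \<le> j + d"
      using degree_mult_le[of "monom 1 j" F] F(1) degree_monom_le[of "1 :: 'a polyfun" j] by (simp add: col_def)
    then show ?thesis using True by (simp add: N_def)
  next
    case False
    then have "degree (col j) \<le> (j - e) + e"
      using degree_mult_le[of "monom 1 (j - e)" G] G(1) degree_monom_le[of "1 :: 'a polyfun" "j - e"] by (simp add: col_def)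
    then show ?thesis using False that by (simp add: N_def)
  qed
  have col_coeff: "coeff (col j) c = 0 \<or> (\<exists>i. coeff (col j) c = coeff F i) \<or> (\<exists>i. coeff (col j) c = coeff G i)" for j c
    by (auto simp: col_def coeff_monom_mult)
  have depF: "depends_below n (coeff F i)" for i
    unfolding depends_below_def
  proof (intro allI impI)
    fix x y :: "nat \<Rightarrow> 'a" assume "\<forall>i<n. x i = y i"
    then have "ev2 F x t = ev2 F y t" for t unfolding F(5) by (intro depends_belowD[OF depends_below(1)]) simp
    then show "evp (coeff F i) x = evp (coeff F i) y" by (rule ev2_eqD)
  qed
  have depG: "depends_below n (coeff G i)" for i
    unfolding depends_below_def
  proof (intro allI impI)
    fix x y :: "nat \<Rightarrow> 'a" assume "\<forall>i<n. x i = y i"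
    then have "ev2 G x t = ev2 G y t" for t unfolding G(3) by (intro depends_belowD[OF depends_below(2)]) simp
    then show "evp (coeff G i) x = evp (coeff G i) y" by (rule ev2_eqD)
  qed
  have pd: "pdeg (N * \<delta>) (evp (det A))"
  proof (rule pdeg_evp_det[OF A])
    fix c j assume "c < N" "j < N"
    then show "pdeg \<delta> (evp (A $$ (c, j)))"
      using col_coeff[of j c] F(4) G(2) pdeg_evp_0 by (auto simp: A_def)
  qed
  have depQ: "depends_below n (det A)"
    unfolding depends_below_def
  proof (intro allI impI)
    fix x y :: "nat \<Rightarrow> 'a" assume xy: "\<forall>i<n. x i = y i"
    have "evp (coeff (col j) c) x = evp (coeff (col j) c) y" for j c
      using col_coeff[of j c] depF depG xy unfolding depends_below_def by (metis evp_0)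
    then have "map_mat (\<lambda>c. evp c x) A = map_mat (\<lambda>c. evp c y) A"
      unfolding A_def by (intro eq_matI) auto
    then show "evp (det A) x = evp (det A) y" by (simp add: evp_det)
  qed
  have "det A \<noteq> 0"
  proof
    assume "det A = 0"
    then obtain x where x: "x \<in> carrier_vec N" "x \<noteq> 0\<^sub>v N" "A *\<^sub>v x = 0\<^sub>v N"
      using det_0_iff_vec_prod_zero[OF A] by blast
    define r where "r = (\<Sum>j<e. monom (x $ j) j)"
    define s where "s = (\<Sum>j<d. monom (x $ (e + j)) j)"
    define P where "P = (\<Sum>j<N. smult (x $ j) (col j))"
    have "coeff P c = 0" for c
    proof (cases "c < N")
      case True
      have "coeff P c = (\<Sum>j<N. coeff (col j) c * x $ j)" by (simp add: P_def coeff_sum mult.commute)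
      also have "\<dots> = (A *\<^sub>v x) $ c"
        using True x(1) by (simp add: A_def scalar_prod_def lessThan_atLeast0)
      finally show ?thesis using x(3) True by simp
    next
      case False
      then have "coeff (col j) c = 0" if "j < N" for j using col_deg[OF that] by (intro coeff_eq_0) simp
      then show ?thesis unfolding P_def coeff_sum by (intro sum.neutral) auto
    qed
    then have P0: "P = 0" by (intro poly_eqI) simp
    have "P = (\<Sum>j<e. smult (x $ j) (col j)) + (\<Sum>j=e..<N. smult (x $ j) (col j))"
      unfolding P_def by (simp add: lessThan_atLeast0 sum.atLeastLessThan_concat N_def)
    also have "(\<Sum>j<e. smult (x $ j) (col j)) = r * F"
      unfolding r_def sum_distrib_right
      by (intro sum.cong) (auto simp: col_def smult_monom simp flip: mult_smult_left)
    also have "(\<Sum>j=e..<N. smult (x $ j) (col j)) = (\<Sum>j=0..<d. smult (x $ (j + e)) (col (j + e)))"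
      using sum.shift_bounds_nat_ivl[of "\<lambda>j. smult (x $ j) (col j)" 0 e d] by (simp add: N_def)
    also have "\<dots> = s * G"
      unfolding s_def sum_distrib_right lessThan_atLeast0
      by (intro sum.cong) (auto simp: col_def smult_monom add.commute simp flip: mult_smult_left)
    finally have rel: "r * F + s * G = 0" using P0 by simp
    have sdeg: "degree s < degree F \<or> s = 0"
    proof (cases "d = 0")
      case False
      have "degree s \<le> d - 1" unfolding s_def
        by (rule degree_sum_le) (auto intro: order.trans[OF degree_monom_le])
      then show ?thesis using False dF by linarith
    qed (simp add: s_def)
    have s0: "s = 0" by (rule prime_no_relation[OF g F(5) G(3) rel sdeg])
    then have r0: "r = 0" using rel F0 by simp
    have rc: "coeff r j = x $ j" if "j < e" for j
      using that unfolding r_def coeff_sum by (simp add: sum.delta)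
    have sc: "coeff s j = x $ (e + j)" if "j < d" for j
      using that unfolding s_def coeff_sum by (simp add: sum.delta)
    have "x $ j = 0" if "j < N" for j
    proof (cases "j < e")
      case True
      then show ?thesis using rc r0 by simp
    next
      case False
      then show ?thesis using sc[of "j - e"] s0 that by (simp add: N_def)
    qed
    then have "x = 0\<^sub>v N" using x(1) by (intro eq_vecI) auto
    then show False using x(2) by simp
  qed
  moreover have "evp h (\<lambda>i. u i + t * v i) \<noteq> 0"
    if u: "evp (det A) u \<noteq> 0" "evp g (\<lambda>i. u i + t * v i) = 0" for u t
  proof
    assume h0: "evp h (\<lambda>i. u i + t * v i) = 0"
    let ?B = "map_mat (\<lambda>c. evp c u) A"
    have B: "?B \<in> carrier_mat N N" using A by simp
    define x where "x = vec N (\<lambda>c. t ^ c)"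
    \<comment> \<open>An empty matrix would have no nonzero null vector; but then \<open>F\<close>
      is a nonzero constant and \<open>g\<close> has no zero on the line.\<close>
    have N0: "N > 0"
    proof (rule ccontr)
      assume "\<not> N > 0"
      then have "d = 0" by (simp add: N_def)
      then have "F = [:cst a:]" using dF F(2) by (metis degree_eq_zeroE coeff_pCons_0)
      then have "ev2 F u t = a" by simp
      then show False using u(2) F(3,5) by simp
    qed
    have "x \<noteq> 0\<^sub>v N"
    proof
      assume "x = 0\<^sub>v N"
      then have "x $ 0 = 0" using N0 by simp
      then show False using N0 by (simp add: x_def)
    qed
    moreover have "transpose_mat ?B *\<^sub>v x = 0\<^sub>v N"
    proof (rule eq_vecI)
      fix j assume "j < dim_vec (0\<^sub>v N :: 'a vec)"
      then have j: "j < N" by simp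
      have "ev2 (col j) u t = 0"
        using u(2) h0 F(5) G(3) by (auto simp: col_def poly_monom)
      moreover have "ev2 (col j) u t = (\<Sum>c\<le>N - 1. evp (coeff (col j) c) u * t ^ c)"
        by (rule ev2_eq_sum) (use col_deg[OF j] in simp)
      moreover have "{..N - 1} = {0..<N}" using N0 by auto
      ultimately have "(\<Sum>c=0..<N. evp (coeff (col j) c) u * t ^ c) = 0" by simp
      then show "(transpose_mat ?B *\<^sub>v x) $ j = 0\<^sub>v N $ j"
        using j by (simp add: A_def x_def scalar_prod_def)
    qed (simp add: A_def)
    moreover have "x \<in> carrier_vec N" "transpose_mat ?B \<in> carrier_mat N N" using B by (auto simp: x_def)
    ultimately have "det (transpose_mat ?B) = 0" using det_0_iff_vec_prod_zero by blast
    then show False using u(1) det_transpose[OF B] by (simp add: evp_det)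
  qed
  ultimately show ?thesis using pd depQ unfolding N_def by blast
qed

section \<open>Multiplicities of a prime factor\<close>

text \<open>Each prime of the list is either \<open>g\<close> up to a unit, and then counted by
  \<open>m\<close>, or not divisible by \<open>g\<close>.\<close>

lemma prime_power_split_prod:
  fixes g :: "'a::idom"
  assumes g: "prime_elem g" and "u dvd 1" "\<forall>p\<in>set ps. prime_elem p"
  shows "\<exists>m h. u * prod_list ps = g ^ m * h \<and> \<not> g dvd h"
  using assms(3)
proof (induction ps)
  case Nil
  have "\<not> g dvd u" using g assms(2) by (meson dvd_trans prime_elem_not_unit)
  then show ?case by (intro exI[of _ 0] exI[of _ u]) auto
next
  case (Cons p ps)
  then obtain m h where mh: "u * prod_list ps = g ^ m * h" "\<not> g dvd h" by auto
  show ?case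
  proof (cases "g dvd p")
    case True
    then obtain w where w: "p = g * w" by (auto simp: dvd_def)
    have "prime_elem p" using Cons.prems by simp
    then have "w dvd 1" using w g prime_elem_imp_irreducible[of p] irreducibleD[of p g w] prime_elem_not_unit by blast
    then have "\<not> g dvd w" using g by (meson dvd_trans prime_elem_not_unit)
    then have "\<not> g dvd h * w" using mh g prime_elem_dvd_multD by blast
    then show ?thesis using mh(1) w by (intro exI[of _ "Suc m"] exI[of _ "h * w"]) (auto simp: mult_ac)
  next
    case False
    then have "\<not> g dvd h * p" using mh g prime_elem_dvd_multD by blast
    then show ?thesis using mh(1) by (intro exI[of _ m] exI[of _ "h * p"]) (auto simp: mult_ac)
  qed
qed

lemma prime_power_split:
  fixes g f :: "'a::alg_closed_field polyfun"
  assumes g: "prime_elem g" and "f \<noteq> 0"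
  shows "\<exists>m h. f = g ^ m * h \<and> \<not> g dvd h"
proof -
  obtain n where "f \<in> pf_vars n" using ex_pf_vars by blast
  then obtain c ps where "c \<noteq> 0" "\<forall>p\<in>set ps. prime_elem p" "f = cst c * prod_list ps"
    using pf_prime_factorization assms(2) by blast
  then show ?thesis using prime_power_split_prod[OF g cst_dvd_1] by blast
qed

lemma prime_power_unique:
  fixes g :: "'a::idom"
  assumes g: "prime_elem g" and "g ^ m * a = g ^ k * b" "\<not> g dvd a" "\<not> g dvd b"
  shows "m = k"
proof (rule ccontr)
  have g0: "g \<noteq> 0" using g by auto
  have *: False if "i < j" "g ^ i * a = g ^ j * b" "\<not> g dvd a" for i j a b
  proof -
    have "g ^ j = g ^ i * (g * g ^ (j - i - 1))" using that(1) by (simp flip: power_add power_Suc)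
    then have "a = g * (g ^ (j - i - 1) * b)" using that(2) g0 by (simp add: mult.assoc)
    then show False using that(3) by (metis dvdI)
  qed
  assume "m \<noteq> k"
  then show False using *[of m k a b] *[of k m b a] assms by (metis linorder_neqE_nat)
qed

text \<open>Primes common to both products, up to units, are cancelled. As the products are not
  proportional, some prime remains on one side that does not divide what is left of the other. Its
  multiplicities in the original products differ as well, since every cancelled prime contributes
  equally to both.\<close>

lemma distinguishing_prime:
  fixes a b :: "'a::alg_closed_field"
  assumes "a \<noteq> 0" "b \<noteq> 0" "\<forall>p\<in>set ps. prime_elem p \<and> p \<in> S" "\<forall>q\<in>set qs. prime_elem q \<and> q \<in> S"
    "\<And>c. cst a * prod_list ps \<noteq> cst c * (cst b * prod_list qs)"
  shows "\<exists>g\<in>S. \<exists>i j A B. prime_elem g \<and> i \<noteq> j \<and> cst a * prod_list ps = g ^ i * A \<and>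
    cst b * prod_list qs = g ^ j * B \<and> \<not> g dvd A \<and> \<not> g dvd B"
  using assms
proof (induction ps arbitrary: b qs)
  case Nil
  show ?case
  proof (cases qs)
    case Nil
    \<comment> \<open>Two empty products leave two constants, which are proportional.\<close>
    have "cst a = cst (a / b) * cst b" using \<open>b \<noteq> 0\<close> by (intro pf_eqI) simp
    then show ?thesis using Nil.prems(5)[of "a / b"] Nil by simp
  next
    case (Cons q qs')
    then have q: "prime_elem q" "q \<in> S" using Nil.prems(4) by auto
    obtain j B where B: "cst b * prod_list qs = q ^ j * B" "\<not> q dvd B"
      using prime_power_split_prod[OF q(1) cst_dvd_1[OF \<open>b \<noteq> 0\<close>]] Nil.prems(4) by blast
    have "q dvd cst b * prod_list qs" using Cons by simp
    then have "j \<noteq> 0" using B by (metis mult_1 power_0)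
    moreover have "\<not> q dvd cst a" using q cst_dvd_1[OF \<open>a \<noteq> 0\<close>] by (meson dvd_trans prime_elem_not_unit)
    ultimately show ?thesis using q B
      by (intro bexI[OF _ q(2)] exI[of _ 0] exI[of _ j] exI[of _ "cst a"] exI[of _ B]) auto
  qed
next
  case (Cons p ps)
  have p: "prime_elem p" "p \<in> S" using Cons.prems(3) by auto
  show ?case
  proof (cases "p dvd cst b * prod_list qs")
    case False
    obtain i A where A: "cst a * prod_list (p # ps) = p ^ i * A" "\<not> p dvd A"
      using prime_power_split_prod[OF p(1) cst_dvd_1[OF \<open>a \<noteq> 0\<close>], of "p # ps"] Cons.prems(3) by blast
    have "p dvd cst a * prod_list (p # ps)" by simp
    then have "i \<noteq> 0" using A by (metis mult_1 power_0)
    then show ?thesis using A False p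
      by (intro bexI[OF _ p(2)] exI[of _ i] exI[of _ 0] exI[of _ A] exI[of _ "cst b * prod_list qs"]) auto
  next
    case True
    moreover have "\<not> p dvd cst b" using p cst_dvd_1[OF \<open>b \<noteq> 0\<close>] by (meson dvd_trans prime_elem_not_unit)
    ultimately have "p dvd prod_list qs" using p(1) prime_elem_dvd_multD by blast
    then obtain q where q: "q \<in> set qs" "p dvd q"
      by (induction qs) (use p(1) prime_elem_dvd_multD in \<open>auto simp: prime_elem_def\<close>)
    then obtain w where w: "q = p * w" by (auto simp: dvd_def)
    have "prime_elem q" using Cons.prems(4) q by blast
    then have "w dvd 1" using w p prime_elem_imp_irreducible[of q] irreducibleD[of q p w] prime_elem_not_unit by blast
    then obtain c where c: "c \<noteq> 0" "w = cst c" using unit_pf_const by blast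
    obtain xs ys where qs: "qs = xs @ q # ys" using q(1) by (meson split_list)
    have bc: "cst (b * c) = cst b * cst c" by (rule pf_eqI) simp
    have B1: "cst b * prod_list qs = p * (cst (b * c) * prod_list (xs @ ys))"
      by (simp add: qs w c bc mult_ac)
    have "\<exists>g\<in>S. \<exists>i j A B. prime_elem g \<and> i \<noteq> j \<and> cst a * prod_list ps = g ^ i * A \<and>
      cst (b * c) * prod_list (xs @ ys) = g ^ j * B \<and> \<not> g dvd A \<and> \<not> g dvd B"
    proof (rule Cons.IH)
      fix k
      show "cst a * prod_list ps \<noteq> cst k * (cst (b * c) * prod_list (xs @ ys))"
      proof
        assume "cst a * prod_list ps = cst k * (cst (b * c) * prod_list (xs @ ys))"
        then have "cst a * prod_list (p # ps) = cst k * (cst b * prod_list qs)"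
          unfolding B1 by (simp add: mult.left_commute[of _ p])
        then show False using Cons.prems(5) by blast
      qed
    qed (use Cons.prems c qs in auto)
    then obtain g i j A B where g: "g \<in> S" "prime_elem g" "i \<noteq> j" "cst a * prod_list ps = g ^ i * A"
      "cst (b * c) * prod_list (xs @ ys) = g ^ j * B" "\<not> g dvd A" "\<not> g dvd B" by blast
    \<comment> \<open>The prime \<open>g\<close> found for the remainders may agree with
      \<open>p\<close> up to a unit; its multiplicity \<open>m\<close> in \<open>p\<close> shifts
      both exponents alike.\<close>
    have "p \<noteq> 0" using p(1) by auto
    then obtain m p' where p': "p = g ^ m * p'" "\<not> g dvd p'" using prime_power_split[OF g(2)] by blast
    have "cst a * prod_list (p # ps) = p * (g ^ i * A)" using g(4) by (simp add: mult_ac)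
    then have 1: "cst a * prod_list (p # ps) = g ^ (m + i) * (p' * A)" by (simp add: p'(1) power_add mult_ac)
    have 2: "cst b * prod_list qs = g ^ (m + j) * (p' * B)"
      unfolding B1 g(5) by (subst p'(1)) (simp add: power_add mult_ac)
    have "\<not> g dvd p' * A" "\<not> g dvd p' * B" using p'(2) g prime_elem_dvd_multD by blast+
    then show ?thesis using 1 2 g(3)
      by (intro bexI[OF _ g(1)] exI[of _ "m + i"] exI[of _ "m + j"] exI[of _ "p' * A"] exI[of _ "p' * B"])
        (use g(2) in auto)
  qed
qed


subsection \<open>Hitting a sum of two products\<close>

lemma power_sum_pt_pad:
  assumes "D \<le> D'"
  shows "\<exists>y' z'. power_sum_pt D' y' z' = power_sum_pt D y z"
  using power_sum_pt_add[of D "D' - D" y z 0 y z] assms by simp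

lemma prime_elem_dvd_prod:
  fixes g :: "'a::idom"
  assumes "prime_elem g" "finite I" "g dvd prod f I"
  shows "\<exists>i\<in>I. g dvd f i"
  using assms(2,3)
proof (induction I rule: finite_induct)
  case empty
  then show ?case using assms(1) prime_elem_not_unit by auto
next
  case (insert i I)
  then have "g dvd f i \<or> g dvd prod f I" using assms(1) prime_elem_dvd_multD by auto
  then show ?case using insert by auto
qed

lemma prod_in_pf_vars:
  "(\<And>i. i \<in> I \<Longrightarrow> (f i :: 'a::alg_closed_field polyfun) \<in> pf_vars n) \<Longrightarrow> prod f I \<in> pf_vars n"
  by (induction I rule: infinite_finite_induct) (auto intro!: subring_ofD[OF subring_of_pf_vars])

lemma power_in_pf_vars: "(g :: 'a::alg_closed_field polyfun) \<in> pf_vars n \<Longrightarrow> g ^ m \<in> pf_vars n"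
  by (rule subring_ofD(7)[OF subring_of_pf_vars])

lemma line_poly:
  fixes f :: "'a::alg_closed_field polyfun"
  shows "\<exists>p. \<forall>t. poly p t = evp f (\<lambda>i. u i + t * v i)"
proof -
  obtain d where "pdeg d (evp f)" using ex_pdeg by blast
  then show ?thesis using line_expansion[of d "evp f" v] by (metis poly_at_pt)
qed

text \<open>At a zero \<open>t\<^sub>0\<close> of \<open>g\<close> on a generic line, the second product vanishes but none of the
  factors \<open>h j\<close> of the first one once the powers of \<open>g\<close> have been divided out.\<close>

lemma power_sum_pt_nonzero_of_prime:
  fixes f :: "nat \<Rightarrow> 'a::alg_closed_field polyfun"
  assumes J: "finite J" and f: "\<And>j. j \<in> J \<Longrightarrow> f j \<noteq> 0 \<and> f j \<in> pf_vars n \<and> pdeg \<delta> (evp (f j))"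
    and g: "prime_elem g" "g \<in> pf_vars n" "pdeg \<delta> (evp g)"
    and A: "(\<Prod>j\<in>J. f j) = g ^ i * A" "\<not> g dvd A" and B: "B = g ^ k * B'" "i < k" and \<delta>: "\<delta> \<ge> 1"
  shows "\<exists>y z. evp ((\<Prod>j\<in>J. f j) + B) (power_sum_pt (3 * \<delta>\<^sup>2) y z) \<noteq> 0"
proof -
  have g0: "g \<noteq> 0" using g(1) by auto
  have dep_g: "depends_below n g" "depends_below n (g ^ m)" for m using g(2) power_in_pf_vars depends_below_pf_vars by blast+
  have "\<forall>j\<in>J. \<exists>m h. f j = g ^ m * h \<and> \<not> g dvd h" using prime_power_split[OF g(1)] f by blast
  then obtain m h where mh: "\<And>j. j \<in> J \<Longrightarrow> f j = g ^ m j * h j \<and> \<not> g dvd h j" by metis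
  have h0: "h j \<noteq> 0" if "j \<in> J" for j using mh[OF that] by auto
  have h_dep: "depends_below n (h j)" if "j \<in> J" for j
    using depends_below_cofactor[of "f j" "g ^ m j" "h j" n] mh[OF that] g0 f[OF that] dep_g depends_below_pf_vars by auto
  have h_deg: "pdeg \<delta> (evp (h j))" if "j \<in> J" for j
  proof -
    have "f j = h j * g ^ m j" using mh[OF that] by (simp add: mult.commute)
    then show ?thesis using pdeg_factor[of \<delta> "h j" "g ^ m j"] f[OF that] by metis
  qed
  have prodf: "(\<Prod>j\<in>J. f j) = g ^ (\<Sum>j\<in>J. m j) * (\<Prod>j\<in>J. h j)"
    using mh by (simp add: prod.distrib power_sum)
  have "\<not> g dvd (\<Prod>j\<in>J. h j)" using prime_elem_dvd_prod[OF g(1) J] mh by blast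
  then have i: "(\<Sum>j\<in>J. m j) = i" using prime_power_unique[OF g(1)] prodf A by metis
  obtain d T where T: "pdeg d (evp g)" "T \<noteq> 0" "pdeg d (evp T)" "d \<le> \<delta>" "depends_below n T"
    "\<And>v. \<exists>F. degree F \<le> d \<and> coeff F d = cst (evp T v) \<and> (\<forall>i. pdeg d (evp (coeff F i))) \<and>
       (\<forall>u t. ev2 F u t = evp g (\<lambda>i. u i + t * v i))"
    using top_form_exists[OF g0] g(3) dep_g(1) by blast
  \<comment> \<open>Positive degree guarantees a zero of \<open>g\<close> on the line; degree 0
    would make \<open>g\<close> a unit.\<close>
  have d0: "d > 0"
  proof (rule ccontr)
    assume "\<not> d > 0"
    then have "g = cst (evp g (\<lambda>_. 0))" using T(1) by (intro pf_eqI) (metis evp_cst gr0I pdeg_0_imp_const)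
    moreover have "evp g (\<lambda>_. 0) \<noteq> 0" using g0 calculation by (metis evp_0 evp_cst pf_eqI)
    ultimately have "g dvd 1" using cst_dvd_1 by metis
    then show False using g(1) prime_elem_not_unit by blast
  qed
  obtain y z where T0: "evp T (power_sum_pt \<delta> y z) \<noteq> 0"
    using common_power_sum_pt[of "{T}" \<delta> n] T(2,5) pdeg_mono[OF T(3,4)] by blast
  define v where "v = power_sum_pt \<delta> y z"
  obtain F where F: "degree F \<le> d" "coeff F d = cst (evp T v)" "\<And>i. pdeg d (evp (coeff F i))"
      "\<And>u t. ev2 F u t = evp g (\<lambda>i. u i + t * v i)"
    using T(6)[of v] by blast
  have "\<forall>j\<in>J. \<exists>Q. Q \<noteq> 0 \<and> pdeg (2 * \<delta>\<^sup>2) (evp Q) \<and> depends_below n Q \<and>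
    (\<forall>u t. evp Q u \<noteq> 0 \<longrightarrow> evp g (\<lambda>i. u i + t * v i) = 0 \<longrightarrow> evp (h j) (\<lambda>i. u i + t * v i) \<noteq> 0)"
  proof
    fix j assume j: "j \<in> J"
    obtain G where G: "degree G \<le> \<delta>" "\<And>i. pdeg (\<delta> - i) (evp (coeff G i))"
        "\<And>u t. ev2 G u t = evp (h j) (\<lambda>i. u i + t * v i)"
      using line_expansion[OF h_deg[OF j], of v] by blast
    have "\<exists>Q. Q \<noteq> 0 \<and> pdeg ((d + \<delta>) * \<delta>) (evp Q) \<and> depends_below n Q \<and>
      (\<forall>u t. evp Q u \<noteq> 0 \<longrightarrow> evp g (\<lambda>i. u i + t * v i) = 0 \<longrightarrow> evp (h j) (\<lambda>i. u i + t * v i) \<noteq> 0)"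
    proof (rule eliminant_exists[OF g(1) _ F(1,2) _ _ F(4) G(1) _ G(3) dep_g(1) h_dep[OF j]])
      show "\<not> g dvd h j" using mh[OF j] by blast
      show "evp T v \<noteq> 0" using T0 by (simp add: v_def)
      show "pdeg \<delta> (evp (coeff F i))" for i by (rule pdeg_mono[OF F(3) T(4)])
      show "pdeg \<delta> (evp (coeff G i))" for i by (rule pdeg_mono[OF G(2)]) simp
    qed
    moreover have "(d + \<delta>) * \<delta> \<le> 2 * \<delta>\<^sup>2" using T(4) by (simp add: power2_eq_square)
    ultimately show "\<exists>Q. Q \<noteq> 0 \<and> pdeg (2 * \<delta>\<^sup>2) (evp Q) \<and> depends_below n Q \<and>
      (\<forall>u t. evp Q u \<noteq> 0 \<longrightarrow> evp g (\<lambda>i. u i + t * v i) = 0 \<longrightarrow> evp (h j) (\<lambda>i. u i + t * v i) \<noteq> 0)"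
      using pdeg_mono by blast
  qed
  from bchoice[OF this] obtain Q where Q: "\<And>j. j \<in> J \<Longrightarrow> Q j \<noteq> 0 \<and> pdeg (2 * \<delta>\<^sup>2) (evp (Q j)) \<and> depends_below n (Q j) \<and>
    (\<forall>u t. evp (Q j) u \<noteq> 0 \<longrightarrow> evp g (\<lambda>i. u i + t * v i) = 0 \<longrightarrow> evp (h j) (\<lambda>i. u i + t * v i) \<noteq> 0)"
    by blast
  have "\<exists>y z. \<forall>R\<in>Q ` J. evp R (power_sum_pt (2 * \<delta>\<^sup>2) y z) \<noteq> 0"
    by (rule common_power_sum_pt[where n = n]) (use J Q in auto)
  then obtain y' z' where u0: "\<And>j. j \<in> J \<Longrightarrow> evp (Q j) (power_sum_pt (2 * \<delta>\<^sup>2) y' z') \<noteq> 0" by blast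
  define u where "u = power_sum_pt (2 * \<delta>\<^sup>2) y' z'"
  define p where "p = at_pt F u"
  have "coeff p d \<noteq> 0" unfolding p_def using F(2) T0 by (simp add: v_def)
  then have "degree p > 0" using d0 le_degree by (metis gr_zeroI le_zero_eq)
  then obtain t0 where t0: "poly p t0 = 0" using alg_closed_imp_poly_has_root by blast
  have p: "poly p t = evp g (\<lambda>i. u i + t * v i)" for t unfolding p_def by (simp add: poly_at_pt F(4))
  \<comment> \<open>The circuit with \<open>g ^ i\<close> divided out; its second summand vanishes
    wherever \<open>g\<close> does, because \<open>k > i\<close>.\<close>
  define E where "E = (\<Prod>j\<in>J. h j) + g ^ (k - i) * B'"
  have "evp (h j) (\<lambda>i. u i + t0 * v i) \<noteq> 0" if "j \<in> J" for j
    using Q[OF that] u0[OF that] p[of t0] t0 by (simp add: u_def)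
  then have E0: "evp E (\<lambda>i. u i + t0 * v i) \<noteq> 0"
    unfolding E_def using p[of t0] t0 J B(2) by (simp add: zero_power)
  obtain q where q: "\<And>t. poly q t = evp E (\<lambda>i. u i + t * v i)" using line_poly by blast
  have "q \<noteq> 0" using E0 q[of t0] by auto
  moreover have "p \<noteq> 0" using \<open>degree p > 0\<close> by auto
  \<comment> \<open>For \<open>i > 0\<close> the circuit itself vanishes at \<open>t0\<close>. But
    its restriction to the line is the nonzero polynomial \<open>p ^ i * q\<close>, so another
    \<open>t\<close> on the same line serves.\<close>
  ultimately have "p ^ i * q \<noteq> 0" by simp
  then obtain t where t: "poly (p ^ i * q) t \<noteq> 0" using poly_nonzero_ex by blast
  have "g ^ k = g ^ i * g ^ (k - i)" using B(2) by (simp flip: power_add)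
  then have "(\<Prod>j\<in>J. f j) + B = g ^ i * E"
    unfolding prodf i B(1) E_def by (simp add: algebra_simps)
  then have nz: "evp ((\<Prod>j\<in>J. f j) + B) (\<lambda>i. u i + t * v i) \<noteq> 0" using t p q by simp
  obtain y1 z1 where 1: "power_sum_pt (2 * \<delta>\<^sup>2 + \<delta>) y1 z1 = (\<lambda>i. u i + t * v i)"
    using power_sum_pt_add[of "2 * \<delta>\<^sup>2" \<delta> y' z' t y z] unfolding u_def v_def by blast
  have "2 * \<delta>\<^sup>2 + \<delta> \<le> 3 * \<delta>\<^sup>2" using \<delta> by (simp add: power2_eq_square)
  from power_sum_pt_pad[OF this] 1 nz show ?thesis by metis
qed

text \<open>Either the circuit is a multiple of one product, and it suffices to avoid the zeros of
  each factor, or some prime has different multiplicities in the two products. In the latter case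
  the product with the smaller multiplicity takes the first place in
  \<open>power_sum_pt_nonzero_of_prime\<close>.\<close>

lemma power_sum_pt_hits_circuit:
  fixes f1 f2 :: "nat \<Rightarrow> 'a::alg_closed_field polyfun"
  assumes J: "finite J" and \<delta>: "\<delta> \<ge> 1"
    and f1: "\<And>j. j \<in> J \<Longrightarrow> f1 j \<in> pf_vars n \<and> pdeg \<delta> (evp (f1 j))"
    and f2: "\<And>j. j \<in> J \<Longrightarrow> f2 j \<in> pf_vars n \<and> pdeg \<delta> (evp (f2 j))"
    and nz: "(\<Prod>j\<in>J. f1 j) + (\<Prod>j\<in>J. f2 j) \<noteq> 0"
  shows "\<exists>y z. evp ((\<Prod>j\<in>J. f1 j) + (\<Prod>j\<in>J. f2 j)) (power_sum_pt (3 * \<delta>\<^sup>2) y z) \<noteq> 0"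
proof -
  let ?A = "\<Prod>j\<in>J. f1 j" and ?B = "\<Prod>j\<in>J. f2 j"
  have single: "\<exists>y z. evp (cst c * (\<Prod>j\<in>J. f j)) (power_sum_pt (3 * \<delta>\<^sup>2) y z) \<noteq> 0"
    if f: "\<And>j. j \<in> J \<Longrightarrow> f j \<in> pf_vars n \<and> pdeg \<delta> (evp (f j))" and "cst c * (\<Prod>j\<in>J. f j) \<noteq> 0"
    for f :: "nat \<Rightarrow> 'a polyfun" and c
  proof -
    have "prod f J \<noteq> 0" using \<open>cst c * prod f J \<noteq> 0\<close> by auto
    then have f0: "f j \<noteq> 0" if "j \<in> J" for j using that J by auto
    have c0: "c \<noteq> 0" using \<open>cst c * prod f J \<noteq> 0\<close> by (auto simp: pf_eq_0_iff)
    have "\<exists>y z. \<forall>R\<in>f ` J. evp R (power_sum_pt \<delta> y z) \<noteq> 0"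
      by (rule common_power_sum_pt[where n = n]) (use J f f0 depends_below_pf_vars in auto)
    then obtain y z where "\<And>j. j \<in> J \<Longrightarrow> evp (f j) (power_sum_pt \<delta> y z) \<noteq> 0" by blast
    then have "evp (cst c * (\<Prod>j\<in>J. f j)) (power_sum_pt \<delta> y z) \<noteq> 0" using J c0 by simp
    moreover have "\<delta> \<le> 3 * \<delta>\<^sup>2" using \<delta> by (simp add: power2_eq_square)
    ultimately show ?thesis using power_sum_pt_pad by metis
  qed
  consider "?B = 0" | c where "?A = cst c * ?B" | "?B \<noteq> 0" "\<And>c. ?A \<noteq> cst c * ?B" by blast
  then show ?thesis
  proof cases
    case 1
    have "cst 1 * ?A = ?A + ?B" using 1 by (intro pf_eqI) simp
    then show ?thesis using single[of f1 1] f1 nz by metis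
  next
    case 2
    have "cst (c + 1) * ?B = ?A + ?B" unfolding 2 by (intro pf_eqI) (simp add: algebra_simps)
    then show ?thesis using single[of f2 "c + 1"] f2 nz by metis
  next
    case 3
    have "cst (0 :: 'a) = 0" by (rule pf_eqI) simp
    then have A0: "?A \<noteq> 0" using 3(2)[of 0] by simp
    have f10: "f1 j \<noteq> 0" if "j \<in> J" for j using A0 J that by auto
    have f20: "f2 j \<noteq> 0" if "j \<in> J" for j using 3(1) J that by auto
    have "?A \<in> pf_vars n" "?B \<in> pf_vars n" using f1 f2 by (auto intro!: prod_in_pf_vars)
    then obtain a ps b qs where a: "a \<noteq> 0" "\<forall>p\<in>set ps. prime_elem p \<and> p \<in> pf_vars n" "?A = cst a * prod_list ps"
      and b: "b \<noteq> 0" "\<forall>q\<in>set qs. prime_elem q \<and> q \<in> pf_vars n" "?B = cst b * prod_list qs"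
      using pf_prime_factorization A0 3(1) by metis
    obtain g i j A B where g: "g \<in> pf_vars n" "prime_elem g" "i \<noteq> j" "?A = g ^ i * A" "?B = g ^ j * B"
        "\<not> g dvd A" "\<not> g dvd B"
      using distinguishing_prime[OF a(1) b(1) a(2) b(2)] 3(2) unfolding a(3) b(3) by blast
    \<comment> \<open>A prime dividing a product divides one of its factors and thus has degree at
      most \<open>\<delta>\<close>; this applies to the product with the larger
      multiplicity.\<close>
    have pdeg_g: "pdeg \<delta> (evp g)" if gf: "g dvd prod f J" and f: "\<And>j. j \<in> J \<Longrightarrow> f j \<noteq> 0 \<and> pdeg \<delta> (evp (f j))" for f
    proof -
      obtain k where k: "k \<in> J" "g dvd f k" using prime_elem_dvd_prod[OF g(2) J gf] by blast
      then obtain w where "f k = g * w" by (auto simp: dvd_def)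
      then show ?thesis using pdeg_factor[of \<delta> g w] f[OF k(1)] by simp
    qed
    show ?thesis
    proof (cases "i < j")
      case True
      then have "g dvd ?B" unfolding g(5) by (simp add: dvd_mult2 dvd_power)
      then have "pdeg \<delta> (evp g)" using pdeg_g f2 f20 by blast
      then show ?thesis using power_sum_pt_nonzero_of_prime[OF J _ g(2,1) _ g(4,6,5) True \<delta>] f1 f10 by blast
    next
      case False
      then have ji: "j < i" using g(3) by simp
      then have "g dvd ?A" unfolding g(4) by (simp add: dvd_mult2 dvd_power)
      then have "pdeg \<delta> (evp g)" using pdeg_g f1 f10 by blast
      then have "\<exists>y z. evp (?B + ?A) (power_sum_pt (3 * \<delta>\<^sup>2) y z) \<noteq> 0"
        using power_sum_pt_nonzero_of_prime[OF J _ g(2,1) _ g(5,7,4) ji \<delta>] f2 f20 by blast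
      then show ?thesis by (simp add: add.commute)
    qed
  qed
qed

section \<open>Kronecker substitution and the grid\<close>

text \<open>Horner's scheme shows that nothing cancels: if the inner value \<open>q\<close> is
  nonzero, then \<open>x ^ B * q\<close> has degree at least \<open>B\<close>, beyond that of the
  next coefficient.\<close>

lemma kronecker_nonzero:
  fixes p :: "'a::idom poly poly"
  assumes "p \<noteq> 0" "\<And>k. degree (coeff p k) < B"
  shows "poly p (monom 1 B) \<noteq> 0"
  using assms
proof (induction p)
  case (pCons a p)
  show ?case
  proof (cases "p = 0")
    case False
    have deg: "degree (coeff p k) < B" for k using pCons.prems(2)[of "Suc k"] by simp
    define q where "q = poly p (monom 1 B)"
    have q: "q \<noteq> 0" unfolding q_def using pCons.IH[OF False deg] .
    have "degree (monom 1 B * q) = B + degree q" using q by (subst degree_mult_eq) (auto simp: degree_monom_eq)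
    then have "degree a < degree (monom 1 B * q)" using pCons.prems(2)[of 0] by simp
    then have "degree (a + monom 1 B * q) = degree (monom 1 B * q)" by (rule degree_add_eq_right)
    then have "a + monom 1 B * q \<noteq> 0" using \<open>degree a < degree (monom 1 B * q)\<close> by auto
    then show ?thesis by (simp add: q_def)
  qed (use pCons in simp)
qed simp

lemma kronecker_subst:
  fixes f :: "(nat \<Rightarrow> 'a::alg_closed_field) \<Rightarrow> 'a"
  assumes "pdeg d f" "\<And>i k. degree (coeff (\<gamma> i) k) \<le> E" "d * E < B"
    and "f (\<lambda>i. poly (poly (\<gamma> i) [:b:]) \<zeta>) \<noteq> 0"
  shows "\<exists>\<zeta>. f (\<lambda>i. poly (poly (\<gamma> i) (monom 1 B)) \<zeta>) \<noteq> 0"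
proof -
  obtain p where p: "\<And>k. degree (coeff p k) \<le> d * E" "\<And>q y. poly (poly p q) y = f (\<lambda>i. poly (poly (\<gamma> i) q) y)"
    using pdeg_curve2[where \<gamma> = \<gamma>, OF assms(1,2)] by blast
  have "p \<noteq> 0" using p(2)[of "[:b:]" \<zeta>] assms(4) by auto
  moreover have "degree (coeff p k) < B" for k using p(1)[of k] assms(3) by simp
  ultimately have "poly p (monom 1 B) \<noteq> 0" by (rule kronecker_nonzero)
  then show ?thesis using poly_nonzero_ex p(2) by metis
qed

text \<open>The power sum point with nodes \<open>\<zeta> ^ (M ^ (2 * k))\<close> and weights
  \<open>\<zeta> ^ (M ^ (2 * k + 1))\<close>: parameter number \<open>j\<close> becomes
  \<open>\<zeta> ^ (M ^ j)\<close>. It is written with iterated \<open>M\<close>-th powers because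
  the program computes it that way.\<close>

definition kronecker_pt :: "nat \<Rightarrow> nat \<Rightarrow> 'a::comm_ring_1 \<Rightarrow> nat \<Rightarrow> 'a" where
  "kronecker_pt M D \<zeta> = (\<lambda>i. \<Sum>k<D. (\<zeta> ^ (M ^ (2 * k))) ^ M * (\<zeta> ^ (M ^ (2 * k))) ^ i)"

text \<open>The parameters are replaced one after another. When the first \<open>j\<close> are
  powers of a common \<open>\<zeta>\<close> and the others are frozen at values keeping
  \<open>C\<close> nonzero, parameter \<open>j\<close> is set free and replaced by the power
  \<open>M ^ j\<close>, at the price of a new \<open>\<zeta>\<close>.\<close>

lemma kronecker_pt_nonzero:
  fixes C :: "'a::alg_closed_field polyfun"
  assumes C: "pdeg d (evp C)" "depends_below n C" and M: "d * n < M" "n \<ge> 1" and nz: "evp C (power_sum_pt D y z) \<noteq> 0"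
  shows "\<exists>\<zeta>. evp C (kronecker_pt M D \<zeta>) \<noteq> 0"
proof -
  \<comment> \<open>Coordinates from \<open>n\<close> on are cut off, since their degrees in the
    nodes are unbounded.\<close>
  define pt :: "(nat \<Rightarrow> 'a) \<Rightarrow> nat \<Rightarrow> 'a" where "pt c = (\<lambda>i. if i < n then \<Sum>k<D. c (2 * k + 1) * c (2 * k) ^ i else 0)" for c
  define c0 where "c0 k = (if even k then y (k div 2) else z (k div 2))" for k
  have "\<exists>\<zeta>. evp C (pt (\<lambda>k. if k < j then \<zeta> ^ (M ^ k) else c0 k)) \<noteq> 0" for j
  proof (induction j)
    case 0
    have "evp C (pt c0) = evp C (power_sum_pt D y z)"
      by (rule depends_belowD[OF C(2)]) (simp add: pt_def power_sum_pt_def c0_def)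
    then show ?case using nz by simp
  next
    case (Suc j)
    then obtain \<zeta> where \<zeta>: "evp C (pt (\<lambda>k. if k < j then \<zeta> ^ (M ^ k) else c0 k)) \<noteq> 0" by blast
    \<comment> \<open>A bound on the exponents in use so far: \<open>M ^ (j - 1)\<close> for
      \<open>j > 0\<close>, while for \<open>j = 0\<close> there are none to bound.\<close>
    define E' where "E' = M ^ j div M"
    have ME: "M * E' \<le> M ^ j" unfolding E'_def by simp
    have M0: "M > 0" using M(1) by simp
    have kE: "M ^ k \<le> E'" if "k < j" for k
    proof -
      have "M ^ k * M \<le> M ^ j" using power_increasing[of "Suc k" j M] that M0 by (simp add: mult.commute)
      then have "M ^ k * M div M \<le> E'" unfolding E'_def by (rule div_le_mono)
      then show ?thesis using M0 by simp
    qed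
    define c :: "nat \<Rightarrow> 'a poly poly" where
      "c k = (if k < j then [:monom 1 (M ^ k):] else if k = j then [:0, 1:] else [:[:c0 k:]:])" for k
    \<comment> \<open>The outer variable is the parameter being replaced; the bound concerns the
      inner variable, the common base of the earlier parameters.\<close>
    define low where "low E = {p :: 'a poly poly. \<forall>k. degree (coeff p k) \<le> E}" for E
    have low_mult: "p * q \<in> low (E1 + E2)" if "p \<in> low E1" "q \<in> low E2" for p q E1 E2
      unfolding low_def mem_Collect_eq coeff_mult
    proof (intro allI degree_sum_le)
      fix k i
      show "degree (coeff p i * coeff q (k - i)) \<le> E1 + E2"
        using that degree_mult_le[of "coeff p i" "coeff q (k - i)"] unfolding low_def
        by (metis (mono_tags, lifting) add_mono mem_Collect_eq order.trans)
    qed simp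
    have low_power: "p ^ i \<in> low (i * E1)" if "p \<in> low E1" for p i E1
    proof (induction i)
      case 0
      show ?case by (auto simp: low_def one_pCons coeff_pCons split: nat.splits)
    next
      case (Suc i)
      then show ?case using low_mult[OF that Suc] by simp
    qed
    have c_low: "c k \<in> low E'" for k
      using kE by (auto simp: c_def low_def coeff_pCons degree_monom_eq split: nat.splits)
    define \<gamma> where "\<gamma> i = (if i < n then \<Sum>k<D. c (2 * k + 1) * c (2 * k) ^ i else 0)" for i
    have \<gamma>: "degree (coeff (\<gamma> i) k) \<le> n * E'" for i k
    proof (cases "i < n")
      case True
      have "degree (coeff (c (2 * l + 1) * c (2 * l) ^ i) k) \<le> n * E'" for l
      proof -
        have "c (2 * l + 1) * c (2 * l) ^ i \<in> low (E' + i * E')" by (intro low_mult low_power c_low)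
        then have "degree (coeff (c (2 * l + 1) * c (2 * l) ^ i) k) \<le> Suc i * E'" by (simp add: low_def)
        also have "\<dots> \<le> n * E'" using True by (intro mult_le_mono1) simp
        finally show ?thesis .
      qed
      then show ?thesis unfolding \<gamma>_def coeff_sum using True by (simp add: coeff_sum degree_sum_le)
    qed (simp add: \<gamma>_def)
    have ev: "(\<lambda>i. poly (poly (\<gamma> i) q) x) = pt (\<lambda>k. poly (poly (c k) q) x)" for q x
      by (auto simp: pt_def \<gamma>_def poly_sum)
    have "d * (n * E') < M ^ j"
    proof (cases "E' = 0")
      case False
      have "d * (n * E') < M * E'" using M(1) False by (simp add: mult.assoc[symmetric])
      then show ?thesis using ME by (rule less_le_trans)
    qed (use M0 in simp)
    moreover have "evp C (\<lambda>i. poly (poly (\<gamma> i) [:c0 j:]) \<zeta>) \<noteq> 0"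
    proof -
      have "(\<lambda>k. poly (poly (c k) [:c0 j:]) \<zeta>) = (\<lambda>k. if k < j then \<zeta> ^ (M ^ k) else c0 k)"
        by (auto simp: c_def poly_monom)
      then show ?thesis using \<zeta> by (simp add: ev)
    qed
    ultimately obtain \<xi> where \<xi>: "evp C (\<lambda>i. poly (poly (\<gamma> i) (monom 1 (M ^ j))) \<xi>) \<noteq> 0"
      using kronecker_subst[where \<gamma> = \<gamma>, OF C(1) \<gamma>] by blast
    have "(\<lambda>k. poly (poly (c k) (monom 1 (M ^ j))) \<xi>) = (\<lambda>k. if k < Suc j then \<xi> ^ (M ^ k) else c0 k)"
      by (auto simp: c_def poly_monom less_Suc_eq)
    then show ?case using \<xi> by (auto simp: ev)
  qed
  then obtain \<zeta> where \<zeta>: "evp C (pt (\<lambda>k. if k < 2 * D then \<zeta> ^ (M ^ k) else c0 k)) \<noteq> 0" by blast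
  have "evp C (pt (\<lambda>k. if k < 2 * D then \<zeta> ^ (M ^ k) else c0 k)) = evp C (kronecker_pt M D \<zeta>)"
    by (rule depends_belowD[OF C(2)]) (auto simp: pt_def kronecker_pt_def power_mult[symmetric] mult.commute intro!: sum.cong)
  then show ?thesis using \<zeta> by metis
qed

text \<open>As a polynomial in \<open>\<zeta>\<close> the value of \<open>C\<close> has degree at
  most \<open>d * n * M ^ (2 * D - 1) < M ^ (2 * D)\<close>, so it cannot vanish at
  \<open>M ^ (2 * D)\<close> distinct points.\<close>

lemma kronecker_pt_nonzero_grid:
  fixes C :: "'a::alg_closed_field polyfun"
  assumes C: "pdeg d (evp C)" "depends_below n C" and M: "d * n < M" "n \<ge> 1" "D \<ge> 1" and nz: "evp C (power_sum_pt D y z) \<noteq> 0"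
    and e: "inj (e :: nat \<Rightarrow> 'a)"
  shows "\<exists>k<M ^ (2 * D). evp C (kronecker_pt M D (e k)) \<noteq> 0"
proof -
  obtain \<zeta> where \<zeta>: "evp C (kronecker_pt M D \<zeta>) \<noteq> 0" using kronecker_pt_nonzero[OF C M(1,2) nz] by blast
  have M0: "M > 0" using M(1) by simp
  define \<gamma> where "\<gamma> i = (if i < n then \<Sum>k<D. monom (1::'a) (M ^ (2 * k) * (M + i)) else 0)" for i
  have "M ^ (2 * k) * (M + i) \<le> n * M ^ (2 * D - 1)" if "k < D" "i < n" for k i
  proof -
    have "M + i \<le> n * M"
    proof -
      have "i \<le> (n - 1) * M" using that(2) M0 by (cases n) (auto intro: order.trans[of _ "n - 1"])
      then show ?thesis using that(2) by (cases n) auto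
    qed
    then have "M ^ (2 * k) * (M + i) \<le> M ^ (2 * k) * (n * M)" by simp
    also have "\<dots> = n * M ^ (2 * k + 1)" by simp
    also have "\<dots> \<le> n * M ^ (2 * D - 1)" using that(1) M0 by (intro mult_le_mono2 power_increasing) auto
    finally show ?thesis .
  qed
  then have "degree (\<gamma> i) \<le> n * M ^ (2 * D - 1)" for i
    unfolding \<gamma>_def by (auto intro!: degree_sum_le order.trans[OF degree_monom_le])
  then obtain p where p: "degree p \<le> d * (n * M ^ (2 * D - 1))" "\<And>x. poly p x = evp C (\<lambda>i. poly (\<gamma> i) x)"
    using pdeg_curve[where \<gamma> = \<gamma>, OF C(1)] by blast
  have p': "poly p x = evp C (kronecker_pt M D x)" for x
    unfolding p(2) by (rule depends_belowD[OF C(2)])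
      (auto simp: \<gamma>_def kronecker_pt_def poly_sum poly_monom power_mult power_add intro!: sum.cong)
  have p0: "p \<noteq> 0" using \<zeta> p'[of \<zeta>] by auto
  have "d * (n * M ^ (2 * D - 1)) < M * M ^ (2 * D - 1)" using M(1) M0 by (simp add: mult.assoc[symmetric])
  also have "\<dots> = M ^ (2 * D)" using M(3) by (simp flip: power_Suc)
  finally have deg: "degree p < M ^ (2 * D)" using p(1) by simp
  show ?thesis
  proof (rule ccontr)
    assume "\<not> ?thesis"
    then have "e ` {..<M ^ (2 * D)} \<subseteq> {x. poly p x = 0}" using p' by auto
    then have "card (e ` {..<M ^ (2 * D)}) \<le> card {x. poly p x = 0}"
      by (rule card_mono[OF poly_roots_finite[OF p0]])
    also have "\<dots> \<le> degree p" using card_poly_roots_bound[OF p0] .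
    finally show False using deg card_image[OF inj_on_subset[OF e subset_UNIV]] by simp
  qed
qed


subsection \<open>From formal polynomials to polynomial functions\<close>

abbreviation monom_val :: "(nat \<Rightarrow> 'a::comm_ring_1) \<Rightarrow> (nat \<Rightarrow>\<^sub>0 nat) \<Rightarrow> 'a" where
  "monom_val x m \<equiv> (\<Prod>i\<in>Poly_Mapping.keys m. x i ^ Poly_Mapping.lookup m i)"

lemma monom_val_superset:
  assumes "finite I" "Poly_Mapping.keys m \<subseteq> I"
  shows "monom_val x m = (\<Prod>i\<in>I. x i ^ Poly_Mapping.lookup m i)"
  using assms by (intro prod.mono_neutral_left) (auto simp: in_keys_iff)

lemma monom_val_add: "monom_val x (m + m') = monom_val x m * monom_val x m'"
proof -
  let ?I = "Poly_Mapping.keys m \<union> Poly_Mapping.keys m'"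
  have "monom_val x (m + m') = (\<Prod>i\<in>?I. x i ^ Poly_Mapping.lookup (m + m') i)"
    using keys_add[of m m'] by (intro monom_val_superset) auto
  also have "\<dots> = monom_val x m * monom_val x m'"
    by (simp add: monom_val_superset[of ?I] lookup_add power_add prod.distrib)
  finally show ?thesis .
qed

lemma eval_ac_superset:
  assumes "finite S" "Poly_Mapping.keys q \<subseteq> S"
  shows "eval_ac q x = (\<Sum>m\<in>S. to_ac (Poly_Mapping.lookup q m) * monom_val x m)"
  unfolding eval_ac_def using assms by (intro sum.mono_neutral_left) (auto simp: in_keys_iff)

lemma eval_ac_add: "eval_ac (p + q) x = eval_ac p x + eval_ac q x"
proof -
  let ?S = "Poly_Mapping.keys p \<union> Poly_Mapping.keys q"
  have "eval_ac (p + q) x = (\<Sum>m\<in>?S. to_ac (Poly_Mapping.lookup (p + q) m) * monom_val x m)"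
    using keys_add[of p q] by (intro eval_ac_superset) auto
  also have "\<dots> = eval_ac p x + eval_ac q x"
    by (simp add: eval_ac_superset[of ?S] lookup_add distrib_right sum.distrib)
  finally show ?thesis .
qed

lemma eval_ac_0: "eval_ac 0 x = 0"
  by (simp add: eval_ac_def)

lemma eval_ac_sum: "eval_ac (sum f I) x = (\<Sum>i\<in>I. eval_ac (f i) x)"
  by (induction I rule: infinite_finite_induct) (auto simp: eval_ac_add eval_ac_0)

lemma eval_ac_single: "eval_ac (Poly_Mapping.single m a) x = to_ac a * monom_val x m"
  by (subst eval_ac_superset[of "{m}"]) auto

lemma mvpoly_eq_sum_single:
  "q = (\<Sum>m\<in>Poly_Mapping.keys q. Poly_Mapping.single m (Poly_Mapping.lookup q m))"
  by (rule poly_mapping_eqI) (auto simp: lookup_sum lookup_single when_def in_keys_iff)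

lemma eval_ac_mult: "eval_ac (p * q) x = eval_ac p x * eval_ac q x"
proof -
  have "p * q = (\<Sum>m\<in>Poly_Mapping.keys p. \<Sum>m'\<in>Poly_Mapping.keys q.
      Poly_Mapping.single (m + m') (Poly_Mapping.lookup p m * Poly_Mapping.lookup q m'))"
    by (subst mvpoly_eq_sum_single[of p], subst mvpoly_eq_sum_single[of q])
      (simp add: sum_product mult_single)
  then have "eval_ac (p * q) x = (\<Sum>m\<in>Poly_Mapping.keys p. \<Sum>m'\<in>Poly_Mapping.keys q.
      (to_ac (Poly_Mapping.lookup p m) * monom_val x m) * (to_ac (Poly_Mapping.lookup q m') * monom_val x m'))"
    by (simp add: eval_ac_sum eval_ac_single monom_val_add mult_ac)
  then show ?thesis by (simp add: eval_ac_def sum_product)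
qed

lemma eval_ac_1: "eval_ac 1 x = 1"
  using eval_ac_single[of 0 1 x] by simp

lemma eval_ac_prod: "eval_ac (prod f I) x = (\<Prod>i\<in>I. eval_ac (f i) x)"
  by (induction I rule: infinite_finite_induct) (auto simp: eval_ac_mult eval_ac_1)

text \<open>The monomials are distinct multiplicative characters, hence linearly independent.\<close>

lemma monom_val_independent:
  fixes a :: "(nat \<Rightarrow>\<^sub>0 nat) \<Rightarrow> 'a::alg_closed_field"
  assumes "finite S" "\<And>x. (\<Sum>m\<in>S. a m * monom_val x m) = 0" "m \<in> S"
  shows "a m = 0"
  using assms
proof (induction S arbitrary: a m rule: finite_induct)
  case (insert m0 S)
  have aS: "a m = 0" if m: "m \<in> S" for m
  proof -
    have "m \<noteq> m0" using m insert.hyps by auto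
    then obtain i where i: "Poly_Mapping.lookup m i \<noteq> Poly_Mapping.lookup m0 i"
      using poly_mapping_eqI by metis
    then have "monom (1::'a) (Poly_Mapping.lookup m i) - monom 1 (Poly_Mapping.lookup m0 i) \<noteq> 0"
      by (metis coeff_monom eq_iff_diff_eq_0 zero_neq_one)
    from poly_nonzero_ex[OF this] obtain c :: 'a where c: "c ^ Poly_Mapping.lookup m i \<noteq> c ^ Poly_Mapping.lookup m0 i"
      by (auto simp: poly_monom)
    \<comment> \<open>Scaling by \<open>y\<close> multiplies the monomial \<open>m'\<close> by
      \<open>c ^ lookup m' i\<close>. As this differs for \<open>m\<close> and \<open>m0\<close>,
      subtracting a multiple of the original relation from the scaled one eliminates
      \<open>m0\<close> but keeps \<open>m\<close>.\<close>
    define y where "y k = (if k = i then c else 1)" for k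
    have y: "monom_val y m' = c ^ Poly_Mapping.lookup m' i" for m'
    proof -
      have "monom_val y m' = (\<Prod>k\<in>insert i (Poly_Mapping.keys m'). y k ^ Poly_Mapping.lookup m' k)"
        by (intro monom_val_superset) auto
      also have "\<dots> = y i ^ Poly_Mapping.lookup m' i"
        by (subst prod.remove[of _ i]) (auto simp: y_def)
      finally show ?thesis by (simp add: y_def)
    qed
    have "a m * (monom_val y m - monom_val y m0) = 0"
    proof (rule insert.IH[OF _ m])
      fix x
      have yx: "monom_val (\<lambda>k. y k * x k) m' = monom_val y m' * monom_val x m'" for m'
        by (simp add: power_mult_distrib prod.distrib)
      have "(\<Sum>m\<in>S. a m * (monom_val y m - monom_val y m0) * monom_val x m) =
          (\<Sum>m\<in>insert m0 S. a m * (monom_val y m - monom_val y m0) * monom_val x m)"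
        using insert.hyps by simp
      also have "\<dots> = (\<Sum>m\<in>insert m0 S. a m * monom_val (\<lambda>k. y k * x k) m) -
          monom_val y m0 * (\<Sum>m\<in>insert m0 S. a m * monom_val x m)"
        unfolding yx sum_distrib_left sum_subtractf[symmetric] by (intro sum.cong) (auto simp: algebra_simps)
      also have "\<dots> = 0" using insert.prems(1) by simp
      finally show "(\<Sum>m\<in>S. a m * (monom_val y m - monom_val y m0) * monom_val x m) = 0" .
    qed
    then show ?thesis using c y by simp
  qed
  have "a m0 = 0" using insert.prems(1)[of "\<lambda>_. 1"] insert.hyps aS by simp
  then show ?case using insert.prems(2) aS by auto
qed simp

text \<open>The test asks for the formal polynomial to be 0; over the infinite closure this agrees
  with vanishing as a function, even if \<open>K\<close> is finite.\<close>

lemma eval_ac_eq_0_imp: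
  assumes "\<And>x. eval_ac q x = 0"
  shows "q = 0"
proof (rule poly_mapping_eqI)
  fix m
  have "to_ac (Poly_Mapping.lookup q m) = 0" if "m \<in> Poly_Mapping.keys q"
    by (rule monom_val_independent[OF finite_keys _ that]) (use assms in \<open>simp add: eval_ac_def\<close>)
  then show "Poly_Mapping.lookup q m = Poly_Mapping.lookup 0 m" by (cases "m \<in> Poly_Mapping.keys q") (auto simp: in_keys_iff)
qed

definition mv_pf :: "'k::field mvpoly \<Rightarrow> 'k alg_closure polyfun" where
  "mv_pf q = (\<Sum>m\<in>Poly_Mapping.keys q. cst (to_ac (Poly_Mapping.lookup q m)) *
     (\<Prod>i\<in>Poly_Mapping.keys m. Xv i ^ Poly_Mapping.lookup m i))"

lemma evp_mv_pf: "evp (mv_pf q) x = eval_ac q x"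
  by (simp add: mv_pf_def eval_ac_def)

lemma mv_pf_in_pf_vars:
  assumes "mvars q \<subseteq> {..<n}"
  shows "mv_pf q \<in> pf_vars n"
  unfolding mv_pf_def
proof (intro subring_of_sum[OF subring_of_pf_vars] subring_ofD(6)[OF subring_of_pf_vars] cst_in_pf_vars
    prod_in_pf_vars power_in_pf_vars Xv_in_pf_vars)
  fix m i assume "m \<in> Poly_Mapping.keys q" "i \<in> Poly_Mapping.keys m"
  then show "i < n" using assms by (auto simp: mvars_def)
qed

lemma pdeg_evp_monomial:
  "pdeg (\<Sum>i\<in>I. k i) (evp (\<Prod>i\<in>I. (Xv i :: 'a::comm_ring_1 polyfun) ^ k i))"
proof (induction I rule: infinite_finite_induct)
  case (insert i I)
  have "pdeg j (evp ((Xv i :: 'a polyfun) ^ j))" for j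
  proof (induction j)
    case (Suc j)
    show ?case unfolding power_Suc by (rule pdeg_evp_mult[OF pdeg_evp_Xv[OF order.refl] Suc]) simp
  qed (simp only: power_0 pdeg_evp_1)
  then have "pdeg (k i + sum k I) (evp (Xv i ^ k i * (\<Prod>i\<in>I. (Xv i :: 'a polyfun) ^ k i)))"
    by (rule pdeg_evp_mult[OF _ insert.IH order.refl])
  then show ?case by (simp only: prod.insert[OF insert.hyps] sum.insert[OF insert.hyps])
next
  case (infinite I)
  show ?case by (simp only: prod.infinite[OF infinite] pdeg_evp_1)
qed (simp only: prod.empty pdeg_evp_1)

lemma pdeg_mv_pf:
  assumes "total_degree q \<le> \<delta>"
  shows "pdeg \<delta> (evp (mv_pf q))"
  unfolding mv_pf_def
proof (rule pdeg_evp_sum)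
  fix m assume m: "m \<in> Poly_Mapping.keys q"
  have "monomial_degree m \<le> total_degree q" unfolding total_degree_def using m by (intro Max_ge) auto
  then show "pdeg \<delta> (evp (cst (to_ac (Poly_Mapping.lookup q m)) *
      (\<Prod>i\<in>Poly_Mapping.keys m. Xv i ^ Poly_Mapping.lookup m i)))"
    using assms by (intro pdeg_evp_mult[OF pdeg_evp_cst[of 0] pdeg_evp_monomial]) (simp add: monomial_degree_def)
qed

lemma mv_pf_SPSP:
  "mv_pf (SPSP_poly 2 s f) = (\<Prod>j=1..s. mv_pf (f 1 j)) + (\<Prod>j=1..s. mv_pf (f 2 j))"
proof (rule pf_eqI)
  fix x
  have "SPSP_poly 2 s f = (\<Prod>j=1..s. f 1 j) + (\<Prod>j=1..s. f 2 j)"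
    by (simp add: SPSP_poly_def numeral_2_eq_2)
  then show "evp (mv_pf (SPSP_poly 2 s f)) x = evp ((\<Prod>j=1..s. mv_pf (f 1 j)) + (\<Prod>j=1..s. mv_pf (f 2 j))) x"
    by (simp add: evp_mv_pf eval_ac_add eval_ac_prod)
qed

lemma circuit_factor_pf:
  assumes "is_SPSP_circuit \<delta> k s n f" "i \<in> {1..k}" "j \<in> {1..s}"
  shows "mv_pf (f i j) \<in> pf_vars n \<and> pdeg \<delta> (evp (mv_pf (f i j)))"
proof -
  have "mvars (f i j) \<subseteq> {..<n}" "total_degree (f i j) \<le> \<delta>"
    using assms unfolding is_SPSP_circuit_def by blast+
  then show ?thesis by (intro conjI mv_pf_in_pf_vars pdeg_mv_pf)
qed

lemma circuit_pf:
  assumes "is_SPSP_circuit \<delta> 2 s n f"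
  shows "depends_below n (mv_pf (SPSP_poly 2 s f))" "pdeg (s * \<delta>) (evp (mv_pf (SPSP_poly 2 s f)))"
proof -
  have f: "mv_pf (f i j) \<in> pf_vars n" "pdeg \<delta> (evp (mv_pf (f i j)))" if "i \<in> {1, 2}" "j \<in> {1..s}" for i j
    using circuit_factor_pf[OF assms, of i j] that by auto
  show "depends_below n (mv_pf (SPSP_poly 2 s f))"
    unfolding mv_pf_SPSP using f
    by (intro depends_below_pf_vars subring_ofD(4)[OF subring_of_pf_vars] prod_in_pf_vars) auto
  have "pdeg (s * \<delta>) (evp (\<Prod>j=1..s. mv_pf (f i j)))" if "i \<in> {1, 2}" for i
    using pdeg_evp_prod[of "{1..s}" \<delta> "\<lambda>j. mv_pf (f i j)"] f(2)[OF that] by simp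
  then show "pdeg (s * \<delta>) (evp (mv_pf (SPSP_poly 2 s f)))"
    unfolding mv_pf_SPSP by (intro pdeg_evp_add) auto
qed

text \<open>The base \<open>\<delta> * s * n + 1\<close> exceeds \<open>n\<close> times the degree
  bound \<open>s * \<delta>\<close>, as the Kronecker substitution requires; the exponent
  \<open>6 * \<delta>\<^sup>2\<close> counts two parameters for each of
  \<open>3 * \<delta>\<^sup>2\<close> summands.\<close>

lemma hitting_set:
  fixes f :: "nat \<Rightarrow> nat \<Rightarrow> 'k::field mvpoly"
  assumes f: "is_SPSP_circuit \<delta> 2 s n f" and pos: "\<delta> \<ge> 1" "s \<ge> 1" "n \<ge> 1"
    and e: "inj (e :: nat \<Rightarrow> 'k alg_closure)" and nz: "SPSP_poly 2 s f \<noteq> 0"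
  shows "\<exists>k<(\<delta> * s * n + 1) ^ (6 * \<delta>\<^sup>2). eval_ac (SPSP_poly 2 s f) (kronecker_pt (\<delta> * s * n + 1) (3 * \<delta>\<^sup>2) (e k)) \<noteq> 0"
proof -
  let ?C = "mv_pf (SPSP_poly 2 s f)"
  have "?C \<noteq> 0" using eval_ac_eq_0_imp[of "SPSP_poly 2 s f"] nz by (auto simp: pf_eq_0_iff evp_mv_pf)
  then have "\<exists>y z. evp ?C (power_sum_pt (3 * \<delta>\<^sup>2) y z) \<noteq> 0"
    unfolding mv_pf_SPSP using pos(1) circuit_factor_pf[OF f]
    by (intro power_sum_pt_hits_circuit[where n = n]) auto
  then obtain y z where yz: "evp ?C (power_sum_pt (3 * \<delta>\<^sup>2) y z) \<noteq> 0" by blast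
  have "\<exists>k<(\<delta> * s * n + 1) ^ (2 * (3 * \<delta>\<^sup>2)). evp ?C (kronecker_pt (\<delta> * s * n + 1) (3 * \<delta>\<^sup>2) (e k)) \<noteq> 0"
    by (rule kronecker_pt_nonzero_grid[OF circuit_pf(2,1)[OF f] _ pos(3) _ yz e]) (use pos in \<open>auto simp: mult_ac\<close>)
  then show ?thesis by (simp add: evp_mv_pf)
qed


subsection \<open>The blackbox program\<close>

text \<open>Total correctness with a time budget; budgets add along \<open>Seq\<close>, so the
  running time is read off the program text.\<close>

definition wp :: "(nat \<Rightarrow> 'l::field) \<Rightarrow> ((nat \<Rightarrow> 'l) \<Rightarrow> 'l) \<Rightarrow> prog \<Rightarrow> nat \<Rightarrow>
    ((nat \<Rightarrow> nat) \<Rightarrow> (nat \<Rightarrow> 'l) \<Rightarrow> bool) \<Rightarrow> (nat \<Rightarrow> nat) \<Rightarrow> (nat \<Rightarrow> 'l) \<Rightarrow> bool" where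
  "wp e B P T Q N F \<longleftrightarrow> (\<exists>t N' F'. exec e B P (N, F) t (N', F') \<and> t \<le> T \<and> Q N' F')"

lemma wp_mono:
  "wp e B P T Q N F \<Longrightarrow> T \<le> T' \<Longrightarrow> (\<And>N F. Q N F \<Longrightarrow> Q' N F) \<Longrightarrow> wp e B P T' Q' N F"
  unfolding wp_def by (meson order.trans)

lemma wp_atomic:
  "atomic_step e B c (N, F) = Some (N', F') \<Longrightarrow> Q N' F' \<Longrightarrow> wp e B c 1 Q N F"
  unfolding wp_def using exec.Atomic by blast

lemma wp_Seq: "wp e B P T (wp e B P' T' Q) N F \<Longrightarrow> wp e B (Seq P P') (T + T') Q N F"
  unfolding wp_def by (meson exec.Seq add_mono)

lemma wp_step:
  "atomic_step e B c (N, F) = Some (N', F') \<Longrightarrow> wp e B P T Q N' F' \<Longrightarrow> wp e B (Seq c P) (1 + T) Q N F"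
  by (rule wp_Seq) (rule wp_atomic)

lemmas wp_simple = atomic_step.simps(1-16)[THEN wp_step] atomic_step.simps(1-16)[THEN wp_atomic]

text \<open>The number \<open>k\<close> of rounds left is held by the counter cell \<open>i\<close>;
  it indexes the invariant and bounds the time.\<close>

lemma wp_WhileN:
  assumes body: "\<And>k N F. I (Suc k) N F \<Longrightarrow> wp e B P T (I k) N F"
    and count: "\<And>k N F. I k N F \<Longrightarrow> N i = k"
  shows "I k N F \<Longrightarrow> wp e B (WhileN i P) (k * (T + 1) + 1) (I 0) N F"
proof (induction k arbitrary: N F)
  case 0
  then show ?case unfolding wp_def using exec.WhileN_stop[of N i e B P F] count[OF 0] by fastforce
next
  case (Suc k)
  obtain t N' F' where t: "exec e B P (N, F) t (N', F')" "t \<le> T" "I k N' F'"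
    using body[OF Suc.prems] unfolding wp_def by blast
  obtain t' N'' F'' where t': "exec e B (WhileN i P) (N', F') t' (N'', F'')" "t' \<le> k * (T + 1) + 1" "I 0 N'' F''"
    using Suc.IH[OF t(3)] unfolding wp_def by blast
  have "exec e B (WhileN i P) (N, F) (t + t' + 1) (N'', F'')"
    using exec.WhileN_loop[OF _ t(1) t'(1)] count[OF Suc.prems] by simp
  then show ?case unfolding wp_def using t t' by (intro exI[of _ "t + t' + 1"] exI[of _ N''] exI[of _ F'']) auto
qed

text \<open>Numbers change only by one per step, so a product is counted up in two nested loops, in
  time of the order of the product plus the first operand.\<close>

definition mul_prog :: "nat \<Rightarrow> nat \<Rightarrow> nat \<Rightarrow> prog" where
  "mul_prog i j k = Seq (NConst i 0) (Seq (NCopy 7 j) (WhileN 7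
     (Seq (NPred 7) (Seq (NCopy 8 k) (WhileN 8 (Seq (NPred 8) (NSucc i)))))))"

lemma wp_mul_prog:
  assumes d: "i \<noteq> 7" "i \<noteq> 8" "j \<noteq> 7" "j \<noteq> 8" "k \<noteq> 7" "k \<noteq> 8" "i \<noteq> j" "i \<noteq> k"
    and xy: "N j = x" "N k = y"
    and Q: "\<And>N'. N' i = x * y \<Longrightarrow> (\<And>c. c \<notin> {i, 7, 8} \<Longrightarrow> N' c = N c) \<Longrightarrow> Q N' F"
  shows "wp e B (mul_prog i j k) (3 + x * (3 * y + 4)) Q N F"
proof -
  let ?eq = "\<lambda>N'. \<forall>c. c \<notin> {i, 7, 8} \<longrightarrow> N' c = N c"
  let ?I = "\<lambda>r N' F'. N' i + r * y = x * y \<and> N' 7 = r \<and> ?eq N' \<and> F' = F"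
  let ?inner = "WhileN 8 (Seq (NPred 8) (NSucc i))"
  have "wp e B (WhileN 7 (Seq (NPred 7) (Seq (NCopy 8 k) ?inner)))
      (x * ((1 + (1 + (y * ((1 + 1) + 1) + 1))) + 1) + 1) (?I 0) (N(i := 0, 7 := x)) F"
  proof (rule wp_WhileN[where I = ?I])
    fix r N1 F1 assume I: "?I (Suc r) N1 F1"
    let ?J = "\<lambda>q N' F'. N' i + q + r * y = x * y \<and> N' 8 = q \<and> N' 7 = r \<and> ?eq N' \<and> F' = F"
    have k: "N1 k = y" using I d xy by auto
    have "wp e B ?inner (y * ((1 + 1) + 1) + 1) (?J 0) (N1(7 := r, 8 := y)) F1"
    proof (rule wp_WhileN[where I = ?J])
      fix q N2 F2 assume "?J (Suc q) N2 F2"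
      then show "wp e B (Seq (NPred 8) (NSucc i)) (1 + 1) (?J q) N2 F2"
        using d by (intro wp_simple) auto
    qed (use I d in auto)
    then have "wp e B ?inner (y * ((1 + 1) + 1) + 1) (?I r) (N1(7 := r, 8 := y)) F1"
      by (rule wp_mono) auto
    then show "wp e B (Seq (NPred 7) (Seq (NCopy 8 k) ?inner)) (1 + (1 + (y * ((1 + 1) + 1) + 1))) (?I r) N1 F1"
      by (intro wp_simple) (use I d k in simp)
  qed (use d xy in auto)
  then have "wp e B (WhileN 7 (Seq (NPred 7) (Seq (NCopy 8 k) ?inner))) (x * (3 * y + 4) + 1) Q (N(i := 0, 7 := x)) F"
    by (rule wp_mono) (use Q in \<open>auto simp: algebra_simps\<close>)
  then have "wp e B (mul_prog i j k) (1 + (1 + (x * (3 * y + 4) + 1))) Q N F"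
    unfolding mul_prog_def by (intro wp_simple) (use d xy in simp)
  then show ?thesis by (rule wp_mono) simp_all
qed

text \<open>Number cells: 7 and 8 scratch loop counters, 3 grid parameter \<open>M\<close>, 4 number \<open>D\<close> of summands, 5 number of remaining points,
  6 flag, 9 pointer into the point, 10--14 fixed addresses of field cells, 15 counter.
  Field cells: 0 the current power of \<open>\<zeta>\<close>, 1 its \<open>M\<close>-th power, 2 an auxiliary product, 3 the answer
  of the blackbox; the point starts at field cell 4.\<close>

definition pow_prog :: "nat \<Rightarrow> nat \<Rightarrow> prog" where
  "pow_prog a b = Seq (FOne a) (Seq (NCopy 7 3) (WhileN 7 (Seq (NPred 7) (FMul a a b))))"

lemma wp_pow_prog:
  assumes ab: "a \<noteq> 7" "b \<noteq> 7" "N a \<noteq> N b" and M: "N 3 = M"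
    and Q: "Q (N(7 := 0)) (F(N a := F (N b) ^ N 3))"
  shows "wp e B (pow_prog a b) (3 * M + 3) Q N F"
proof -
  let ?I = "\<lambda>r N' F'. \<exists>m. m + r = N 3 \<and> N' = N(7 := r) \<and> F' = F(N a := F (N b) ^ m)"
  have "wp e B (WhileN 7 (Seq (NPred 7) (FMul a a b))) (N 3 * ((1 + 1) + 1) + 1) (?I 0) (N(7 := N 3)) (F(N a := 1))"
  proof (rule wp_WhileN[where I = ?I])
    fix r N1 F1 assume "?I (Suc r) N1 F1"
    then obtain m where m: "m + Suc r = N 3" "N1 = N(7 := Suc r)" "F1 = F(N a := F (N b) ^ m)" by blast
    show "wp e B (Seq (NPred 7) (FMul a a b)) (1 + 1) (?I r) N1 F1"
      using m ab by (intro wp_simple exI[of _ "Suc m"]) (auto simp: mult.commute)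
  qed auto
  then have "wp e B (WhileN 7 (Seq (NPred 7) (FMul a a b))) (3 * N 3 + 1) Q (N(7 := N 3)) (F(N a := 1))"
    by (rule wp_mono) (use Q in auto)
  then have "wp e B (pow_prog a b) (1 + (1 + (3 * N 3 + 1))) Q N F"
    unfolding pow_prog_def by (intro wp_simple) simp
  then show ?thesis by (rule wp_mono) (simp_all add: M)
qed

definition clear_prog :: prog where
  "clear_prog = Seq (NCopy 9 14) (Seq (NCopy 7 2) (WhileN 7 (Seq (NPred 7) (Seq (FZero 9) (NSucc 9)))))"

lemma wp_clear_prog:
  assumes N: "N 14 = 4" and n: "N 2 = n"
    and Q: "Q (N(7 := 0, 9 := 4 + N 2)) (\<lambda>a. if 4 \<le> a \<and> a < 4 + N 2 then 0 else F a)"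
  shows "wp e B clear_prog (4 * n + 3) Q N F"
proof -
  let ?F = "\<lambda>m a. if 4 \<le> a \<and> a < 4 + m then 0 else F a"
  let ?I = "\<lambda>r N' F'. \<exists>m. m + r = N 2 \<and> N' = N(7 := r, 9 := 4 + m) \<and> F' = ?F m"
  have "wp e B (WhileN 7 (Seq (NPred 7) (Seq (FZero 9) (NSucc 9)))) (N 2 * ((1 + (1 + 1)) + 1) + 1) (?I 0) (N(9 := 4, 7 := N 2)) F"
  proof (rule wp_WhileN[where I = ?I])
    fix r N1 F1 assume "?I (Suc r) N1 F1"
    then obtain m where m: "m + Suc r = N 2" "N1 = N(7 := Suc r, 9 := 4 + m)" "F1 = ?F m" by blast
    have "(?F m)(4 + m := 0) = ?F (Suc m)" by auto
    then show "wp e B (Seq (NPred 7) (Seq (FZero 9) (NSucc 9))) (1 + (1 + 1)) (?I r) N1 F1"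
      using m by (intro wp_simple exI[of _ "Suc m"]) (auto simp: fun_upd_twist)
  qed (auto simp: fun_upd_twist fun_eq_iff intro!: exI[of _ 0])
  then have "wp e B (WhileN 7 (Seq (NPred 7) (Seq (FZero 9) (NSucc 9)))) (4 * N 2 + 1) Q (N(9 := 4, 7 := N 2)) F"
    by (rule wp_mono) (use Q in auto)
  then have "wp e B clear_prog (1 + (1 + (4 * N 2 + 1))) Q N F"
    unfolding clear_prog_def by (intro wp_simple) (use N in simp)
  then show ?thesis by (rule wp_mono) (simp_all add: n)
qed

text \<open>One summand is added to all coordinates: with the node in field cell 0 and the weight in
  cell 1, cell 2 runs through the weight times the powers of the node.\<close>

definition add_prog :: prog where
  "add_prog = Seq (FCopy 12 11) (Seq (NCopy 9 14) (Seq (NCopy 7 2)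
     (WhileN 7 (Seq (NPred 7) (Seq (FAdd 9 9 12) (Seq (FMul 12 12 10) (NSucc 9)))))))"

lemma wp_add_prog:
  assumes N: "N 10 = 0" "N 11 = 1" "N 12 = 2" "N 14 = 4" and n: "N 2 = n"
    and Q: "Q (N(7 := 0, 9 := 4 + N 2))
      (\<lambda>a. if a = 2 then F 1 * F 0 ^ N 2 else if 4 \<le> a \<and> a < 4 + N 2 then F a + F 1 * F 0 ^ (a - 4) else F a)"
  shows "wp e B add_prog (5 * n + 4) Q N F"
proof -
  let ?F = "\<lambda>m a. if a = 2 then F 1 * F 0 ^ m else if 4 \<le> a \<and> a < 4 + m then F a + F 1 * F 0 ^ (a - 4) else F a"
  let ?I = "\<lambda>r N' F'. \<exists>m. m + r = N 2 \<and> N' = N(7 := r, 9 := 4 + m) \<and> F' = ?F m"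
  let ?body = "Seq (NPred 7) (Seq (FAdd 9 9 12) (Seq (FMul 12 12 10) (NSucc 9)))"
  have "wp e B (WhileN 7 ?body) (N 2 * ((1 + (1 + (1 + 1))) + 1) + 1) (?I 0) (N(9 := 4, 7 := N 2)) (F(2 := F 1))"
  proof (rule wp_WhileN[where I = ?I])
    fix r N1 F1 assume "?I (Suc r) N1 F1"
    then obtain m where m: "m + Suc r = N 2" "N1 = N(7 := Suc r, 9 := 4 + m)" "F1 = ?F m" by blast
    have "(?F m)(4 + m := F (4 + m) + F 1 * F 0 ^ m, 2 := F 1 * F 0 ^ m * F 0) = ?F (Suc m)"
      by (auto simp: mult_ac)
    then show "wp e B ?body (1 + (1 + (1 + 1))) (?I r) N1 F1"
      using m N by (intro wp_simple exI[of _ "Suc m"]) (auto simp: fun_upd_twist)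
  qed (auto simp: fun_upd_twist intro!: exI[of _ 0])
  then have "wp e B (WhileN 7 ?body) (5 * N 2 + 1) Q (N(9 := 4, 7 := N 2)) (F(2 := F 1))"
    by (rule wp_mono) (use Q in auto)
  then have "wp e B add_prog (1 + (1 + (1 + (5 * N 2 + 1)))) Q N F"
    unfolding add_prog_def by (intro wp_simple) (use N in simp)
  then show ?thesis by (rule wp_mono) (simp_all add: n)
qed

lemma wp_IfF:
  assumes "F (N i) = 0 \<Longrightarrow> wp e B P T Q N F" "F (N i) \<noteq> 0 \<Longrightarrow> wp e B P' T Q N F"
  shows "wp e B (IfF i P P') (T + 1) Q N F"
  using assms unfolding wp_def
  by (cases "F (N i) = 0") (meson exec.IfF_zero exec.IfF_nonzero add_le_mono1)+

lemma wp_IfN: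
  assumes "N i = 0 \<Longrightarrow> wp e B P T Q N F" "N i \<noteq> 0 \<Longrightarrow> wp e B P' T Q N F"
  shows "wp e B (IfN i P P') (T + 1) Q N F"
  using assms unfolding wp_def
  by (cases "N i = 0") (meson exec.IfN_zero exec.IfN_nonzero add_le_mono1)+

text \<open>The \<open>M\<close>-th power of the node in cell 0 is the weight, put into cell 1; once
  the summand has been added, the \<open>M\<close>-th power of the weight is the next node.\<close>

definition point_prog :: prog where
  "point_prog = Seq clear_prog (Seq (NCopy 15 4) (WhileN 15
     (Seq (NPred 15) (Seq (pow_prog 11 10) (Seq add_prog (pow_prog 10 11))))))"

definition point_time :: "nat \<Rightarrow> nat \<Rightarrow> nat \<Rightarrow> nat" where
  "point_time n M D = (4 * n + 3) + (1 + (D * ((1 + ((3 * M + 3) + ((5 * n + 4) + (3 * M + 3)))) + 1) + 1))"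

lemma wp_point_prog:
  assumes N: "N 2 = n" "N 3 = M" "N 4 = D" "N 10 = 0" "N 11 = 1" "N 12 = 2" "N 14 = 4"
    and Q: "\<And>N' F'. (\<And>c. c \<notin> {7, 9, 15} \<Longrightarrow> N' c = N c) \<Longrightarrow>
      (\<And>i. i < n \<Longrightarrow> F' (4 + i) = kronecker_pt M D (F 0) i) \<Longrightarrow> Q N' F'"
  shows "wp e B point_prog (point_time n M D) Q N F"
proof -
  let ?I = "\<lambda>r N' F'. \<exists>m. m + r = D \<and> (\<forall>c. c \<notin> {7, 9, 15} \<longrightarrow> N' c = N c) \<and> N' 15 = r \<and>
    F' 0 = F 0 ^ (M ^ (2 * m)) \<and> (\<forall>i<n. F' (4 + i) = kronecker_pt M m (F 0) i)"
  let ?body = "Seq (NPred 15) (Seq (pow_prog 11 10) (Seq add_prog (pow_prog 10 11)))"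
  let ?F = "\<lambda>a. if 4 \<le> a \<and> a < 4 + n then 0 else F a"
  have "wp e B (WhileN 15 ?body) (D * ((1 + ((3 * M + 3) + ((5 * n + 4) + (3 * M + 3)))) + 1) + 1) (?I 0)
      (N(7 := 0, 9 := 4 + n, 15 := D)) ?F"
  proof (rule wp_WhileN[where I = ?I])
    fix r N1 F1 assume "?I (Suc r) N1 F1"
    then obtain m where m: "m + Suc r = D" "\<forall>c. c \<notin> {7, 9, 15} \<longrightarrow> N1 c = N c" "N1 15 = Suc r"
        "F1 0 = F 0 ^ (M ^ (2 * m))" "\<forall>i<n. F1 (4 + i) = kronecker_pt M m (F 0) i" by blast
    have N1: "N1 2 = n" "N1 3 = M" "N1 10 = 0" "N1 11 = 1" "N1 12 = 2" "N1 14 = 4"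
      using m(2) N by simp_all
    have pow: "((F 0 ^ (M ^ (2 * m))) ^ M) ^ M = F 0 ^ (M ^ (2 * Suc m))"
      by (simp add: power_mult[symmetric] mult.assoc mult.commute)
    show "wp e B ?body (1 + ((3 * M + 3) + ((5 * n + 4) + (3 * M + 3)))) (?I r) N1 F1"
    proof (rule wp_simple, rule wp_Seq, rule wp_pow_prog, goal_cases)
      case 5
      show ?case
      proof (rule wp_Seq, rule wp_add_prog, goal_cases)
        case 6
        show ?case
        proof (rule wp_pow_prog, goal_cases)
          case 5
          show ?case
            using N1 m pow by (intro exI[of _ "Suc m"]) (auto simp: kronecker_pt_def)
        qed (use N1 in auto)
      qed (use N1 in auto)
    qed (use N1 in auto)
  next
    show "?I D (N(7 := 0, 9 := 4 + n, 15 := D)) ?F"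
      by (intro exI[of _ 0]) (auto simp: kronecker_pt_def)
  qed auto
  then have loop: "wp e B (WhileN 15 ?body) (D * ((1 + ((3 * M + 3) + ((5 * n + 4) + (3 * M + 3)))) + 1) + 1) Q
      (N(7 := 0, 9 := 4 + n, 15 := D)) ?F"
    by (rule wp_mono) (use Q in auto)
  show ?thesis
    unfolding point_prog_def point_time_def
  proof (rule wp_Seq, rule wp_clear_prog, goal_cases)
    case 3
    show ?case by (rule wp_simple) (use loop N in simp)
  qed (use N in auto)
qed

text \<open>The counter is decremented before use, so the supply is tried at \<open>Z - 1\<close>
  down to 0. The flag in cell 6 is only ever raised, and the search always runs to its end.\<close>

definition search_prog :: prog where
  "search_prog = WhileN 5 (Seq (NPred 5) (Seq (Supply 10 5) (Seq point_prog
     (Seq (Query 13 14) (IfF 13 Skip (NConst 6 1))))))"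

definition search_time :: "nat \<Rightarrow> nat \<Rightarrow> nat \<Rightarrow> nat \<Rightarrow> nat" where
  "search_time n M D Z = Z * ((1 + (1 + (point_time n M D + (1 + (1 + 1))))) + 1) + 1"

text \<open>A query also hands over the field cells behind the point; hence the assumption that
  \<open>B\<close> reads only the first \<open>n\<close> coordinates.\<close>

lemma wp_search_prog:
  assumes N: "N 2 = n" "N 3 = M" "N 4 = D" "N 5 = Z" "N 6 = 0" "N 10 = 0" "N 11 = 1" "N 12 = 2" "N 13 = 3" "N 14 = 4"
    and B: "\<And>x y. (\<And>i. i < n \<Longrightarrow> x i = y i) \<Longrightarrow> B x = B y"
    and Q: "\<And>N' F'. N' 6 = (if \<exists>k<Z. B (kronecker_pt M D (e k)) \<noteq> 0 then 1 else 0) \<Longrightarrow> Q N' F'"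
  shows "wp e B search_prog (search_time n M D Z) Q N F"
proof -
  let ?K = "\<lambda>N' :: nat \<Rightarrow> nat. N' 2 = n \<and> N' 3 = M \<and> N' 4 = D \<and> N' 10 = 0 \<and> N' 11 = 1 \<and> N' 12 = 2 \<and> N' 13 = 3 \<and> N' 14 = (4 :: nat)"
  let ?hit = "\<lambda>k. B (kronecker_pt M D (e k)) \<noteq> 0"
  let ?I = "\<lambda>r N' F'. ?K N' \<and> r \<le> Z \<and> N' 5 = r \<and> N' 6 = (if \<exists>k. r \<le> k \<and> k < Z \<and> ?hit k then 1 else 0)"
  have "wp e B search_prog (search_time n M D Z) (?I 0) N F"
    unfolding search_prog_def search_time_def
  proof (rule wp_WhileN[where I = ?I])
    fix r N1 and F1 :: "nat \<Rightarrow> 'a" assume I: "?I (Suc r) N1 F1"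
    have step: "(\<exists>k. r \<le> k \<and> k < Z \<and> ?hit k) \<longleftrightarrow> ?hit r \<or> (\<exists>k. Suc r \<le> k \<and> k < Z \<and> ?hit k)"
      using I by (metis Suc_le_eq le_eq_less_or_eq order.refl)
    show "wp e B (Seq (NPred 5) (Seq (Supply 10 5) (Seq point_prog (Seq (Query 13 14) (IfF 13 Skip (NConst 6 1))))))
        (1 + (1 + (point_time n M D + (1 + (1 + 1))))) (?I r) N1 F1"
    proof (rule wp_simple, rule wp_simple, rule wp_Seq, rule wp_point_prog, goal_cases)
      case (8 N2 F2)
      have N2: "N2 c = N1 c" if "c \<notin> {7, 9, 15, 5}" for c using 8(1)[of c] that by simp
      have N2': "?K N2" "N2 5 = r" "N2 6 = N1 6" using N2 8(1)[of 5] I by simp_all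
      have "B (\<lambda>k. F2 (N2 14 + k)) = B (kronecker_pt M D (e r))"
        by (rule B) (use 8(2) N2' I in simp)
      then show ?case
        by (intro wp_simple wp_IfF) (use N2' I step in auto)
    qed (use I in auto)
  qed (use N in auto)
  then show ?thesis by (rule wp_mono) (use Q in auto)
qed

text \<open>Each of the \<open>D\<close> rounds multiplies cell 5 by \<open>M\<close> twice, by way
  of cell 16, because \<open>mul_prog\<close> must not overwrite its operands. Cell 10 keeps its
  initial 0 as the address of field cell 0.\<close>

definition setup_prog :: prog where
  "setup_prog = Seq (mul_prog 16 0 1) (Seq (mul_prog 3 16 2) (Seq (NSucc 3)
     (Seq (mul_prog 16 0 0) (Seq (NConst 17 3) (Seq (mul_prog 4 16 17) (Seq (NConst 5 1) (Seq (NCopy 15 4)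
     (Seq (WhileN 15 (Seq (NPred 15) (Seq (mul_prog 16 5 3) (mul_prog 5 16 3))))
     (Seq (NConst 11 1) (Seq (NConst 12 2) (Seq (NConst 13 3) (NConst 14 4))))))))))))"

definition setup_time :: "nat \<Rightarrow> nat \<Rightarrow> nat \<Rightarrow> nat \<Rightarrow> nat \<Rightarrow> nat \<Rightarrow> nat" where
  "setup_time \<delta> s n M D Z = (3 + \<delta> * (3 * s + 4)) + ((3 + \<delta> * s * (3 * n + 4)) + (1 + ((3 + \<delta> * (3 * \<delta> + 4)) +
     (1 + ((3 + \<delta> * \<delta> * (3 * 3 + 4)) + (1 + (1 + ((D * ((1 + ((3 + Z * (3 * M + 4)) + (3 + Z * M * (3 * M + 4)))) + 1) + 1) +
     (1 + (1 + (1 + 1)))))))))))"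

lemma wp_setup_prog:
  fixes \<delta> s n :: nat
  defines "M \<equiv> \<delta> * s * n + 1" and "D \<equiv> 3 * \<delta>\<^sup>2"
  assumes N: "N 0 = \<delta>" "N 1 = s" "N 2 = n" "N 6 = 0" "N 10 = 0"
    and Q: "\<And>N'. N' 2 = n \<Longrightarrow> N' 3 = M \<Longrightarrow> N' 4 = D \<Longrightarrow> N' 5 = M ^ (2 * D) \<Longrightarrow> N' 6 = 0 \<Longrightarrow> N' 10 = 0 \<Longrightarrow>
      N' 11 = 1 \<Longrightarrow> N' 12 = 2 \<Longrightarrow> N' 13 = 3 \<Longrightarrow> N' 14 = 4 \<Longrightarrow> Q N' F"
  shows "wp e B setup_prog (setup_time \<delta> s n M D (M ^ (2 * D))) Q N F"
proof -
  let ?Z = "M ^ (2 * D)"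
  let ?body = "Seq (NPred 15) (Seq (mul_prog 16 5 3) (mul_prog 5 16 3))"
  let ?tail = "Seq (NConst 11 1) (Seq (NConst 12 2) (Seq (NConst 13 3) (NConst 14 4)))"
  have loop: "wp e B (WhileN 15 ?body) (D * ((1 + ((3 + ?Z * (3 * M + 4)) + (3 + ?Z * M * (3 * M + 4)))) + 1) + 1)
      (wp e B ?tail (1 + (1 + (1 + 1))) Q) N1 F"
    if N1: "N1 2 = n" "N1 3 = M" "N1 4 = D" "N1 5 = 1" "N1 15 = D" "N1 6 = 0" "N1 10 = 0" for N1
  proof -
    let ?I = "\<lambda>r (N' :: nat \<Rightarrow> nat) F'. \<exists>m. m + r = D \<and> N' 2 = n \<and> N' 3 = M \<and> N' 4 = D \<and> N' 5 = M ^ (2 * m) \<and> N' 15 = r \<and>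
      N' 6 = 0 \<and> N' 10 = 0 \<and> F' = F"
    have "wp e B (WhileN 15 ?body) (D * ((1 + ((3 + ?Z * (3 * M + 4)) + (3 + ?Z * M * (3 * M + 4)))) + 1) + 1) (?I 0) N1 F"
    proof (rule wp_WhileN[where I = ?I])
      fix r N2 F2 assume "?I (Suc r) N2 F2"
      then obtain m where m: "m + Suc r = D" "N2 2 = n" "N2 3 = M" "N2 4 = D" "N2 5 = M ^ (2 * m)"
        "N2 15 = Suc r" "N2 6 = 0" "N2 10 = 0" "F2 = F" by blast
      have "wp e B ?body (1 + ((3 + M ^ (2 * m) * (3 * M + 4)) + (3 + M ^ (2 * m) * M * (3 * M + 4)))) (?I r) N2 F2"
      proof (rule wp_simple, rule wp_Seq, rule wp_mul_prog, goal_cases)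
        case (11 N3)
        show ?case
        proof (rule wp_mul_prog, goal_cases)
          case (11 N4)
          then show ?case using m \<open>\<And>c. c \<notin> {16, 7, 8} \<Longrightarrow> N3 c = (N2(15 := N2 15 - 1)) c\<close>
            by (intro exI[of _ "Suc m"]) (auto simp: mult_ac)
        qed (use 11 m in auto)
      qed (use m in auto)
      \<comment> \<open>The cost of a round grows with the current power of \<open>M\<close>; every
        round is charged at the final value.\<close>
      moreover have le: "M ^ (2 * m) \<le> ?Z" using m(1) by (intro power_increasing) (auto simp: M_def)
      ultimately show "wp e B ?body (1 + ((3 + ?Z * (3 * M + 4)) + (3 + ?Z * M * (3 * M + 4)))) (?I r) N2 F2"
        by (elim wp_mono) (auto intro!: add_mono mult_le_mono)
    qed (use N1 in auto)
    then show ?thesis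
    proof (rule wp_mono)
      fix N' F' assume I: "?I 0 N' F'"
      then have F': "F' = F" by blast
      show "wp e B ?tail (1 + (1 + (1 + 1))) Q N' F'"
        unfolding F' by (intro wp_simple, rule Q) (use I in auto)
    qed simp
  qed
  show ?thesis
    unfolding setup_prog_def setup_time_def
  proof (rule wp_Seq, rule wp_mul_prog, goal_cases)
    case (11 N1)
    note N1 = 11
    show ?case
    proof (rule wp_Seq, rule wp_mul_prog, goal_cases)
      case (11 N2)
      note N2 = 11
      show ?case
      proof (rule wp_simple, rule wp_Seq, rule wp_mul_prog, goal_cases)
        case (11 N3)
        note N3 = 11
        show ?case
        proof (rule wp_simple, rule wp_Seq, rule wp_mul_prog, goal_cases)
          case (11 N4)
          note N4 = 11
          show ?case
            by (rule wp_simple, rule wp_simple, rule wp_Seq, rule loop)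
              (use N N1 N2 N3 N4 in \<open>auto simp: M_def D_def power2_eq_square\<close>)
        qed (use N N1 N2 N3 in auto)
      qed (use N N1 N2 in auto)
    qed (use N N1 in auto)
  qed (use N in auto)
qed

definition blackbox_prog :: prog where
  "blackbox_prog = Seq setup_prog (Seq search_prog (IfN 6 (NConst 0 1) (NConst 0 0)))"

lemma wp_blackbox_prog:
  fixes \<delta> s n :: nat
  defines "M \<equiv> \<delta> * s * n + 1" and "D \<equiv> 3 * \<delta>\<^sup>2"
  assumes N: "N 0 = \<delta>" "N 1 = s" "N 2 = n" "N 6 = 0" "N 10 = 0"
    and B: "\<And>x y. (\<And>i. i < n \<Longrightarrow> x i = y i) \<Longrightarrow> B x = B y"
  shows "wp e B blackbox_prog (setup_time \<delta> s n M D (M ^ (2 * D)) + (search_time n M D (M ^ (2 * D)) + (1 + 1)))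
    (\<lambda>N' F'. N' 0 = (if \<exists>k<M ^ (2 * D). B (kronecker_pt M D (e k)) \<noteq> 0 then 0 else 1)) N F"
  unfolding blackbox_prog_def
proof (rule wp_Seq, unfold M_def D_def, rule wp_setup_prog[OF N], fold M_def D_def, goal_cases)
  case (1 N1)
  show ?case
  proof (rule wp_Seq, rule wp_search_prog[OF 1 B], assumption, goal_cases)
    case (1 N2 F2)
    then show ?case by (intro wp_IfN wp_simple) (auto split: if_splits)
  qed
qed

section \<open>Running time and conclusion\<close>

text \<open>Everything is dominated by \<open>Z * M ^ 4\<close>: computing \<open>Z\<close> takes
  \<open>D \<le> 3 * M\<^sup>2\<close> rounds of order \<open>Z * M\<^sup>2\<close>, the search
  \<open>Z\<close> rounds of order \<open>M ^ 3\<close>. Since \<open>Z\<close> is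
  \<open>M ^ 6\<close> to the power \<open>\<delta>\<^sup>2\<close>, and
  \<open>\<delta> \<ge> 1\<close>, the factor \<open>300 * M ^ 4\<close> can be moved into the base,
  which becomes \<open>300 * M ^ 10\<close>.\<close>

lemma blackbox_time:
  fixes \<delta> s n :: nat
  defines "M \<equiv> \<delta> * s * n + 1" and "D \<equiv> 3 * \<delta>\<^sup>2"
  assumes pos: "\<delta> \<ge> 1" "s \<ge> 1" "n \<ge> 1"
  shows "setup_time \<delta> s n M D (M ^ (2 * D)) + (search_time n M D (M ^ (2 * D)) + (1 + 1))
    \<le> poly ([:300:] * [:1, 1:] ^ 10) (\<delta> * s * n) ^ (\<delta>\<^sup>2)"
proof -
  define Z where "Z = M ^ (2 * D)"
  have M1: "1 \<le> M" by (simp add: M_def)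
  have Z1: "1 \<le> Z" using M1 by (simp add: Z_def)
  have le: "\<delta> * s \<le> M" "\<delta> * s * n \<le> M" "\<delta> \<le> M" "n \<le> M" "\<delta> * \<delta> \<le> M * M"
  proof -
    show "\<delta> * s * n \<le> M" by (simp add: M_def)
    show ds: "\<delta> * s \<le> M" unfolding M_def using pos(3) by (metis le_add1 mult_le_mono2 nat_mult_1_right order.trans)
    show d: "\<delta> \<le> M" using ds pos(2) by (metis mult_le_mono2 nat_mult_1_right order.trans)
    show "n \<le> M" unfolding M_def using pos by (metis le_add1 mult_le_mono1 nat_mult_1 one_le_mult_iff order.trans)
    show "\<delta> * \<delta> \<le> M * M" using d by (intro mult_le_mono)
  qed
  have MM: "M \<le> M * M" using M1 by simp
  have D: "D \<le> 3 * (M * M)" using le(5) by (simp add: D_def power2_eq_square)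
  have ZM: "1 \<le> Z * (M * M)" using M1 Z1 by simp
  let ?q = "Z * (M * M * M * M)"
  have q: "M * M \<le> ?q"
  proof -
    have "M * M * 1 \<le> M * M * (Z * (M * M))" by (intro mult_le_mono order.refl ZM)
    then show ?thesis by (simp add: mult_ac)
  qed
  have q1: "1 \<le> ?q" using q M1 by (metis mult_le_mono nat_mult_1 order.trans)
  have loop: "D * ((1 + ((3 + Z * (3 * M + 4)) + (3 + Z * M * (3 * M + 4)))) + 1) \<le> 66 * ?q"
  proof -
    have "Z * (3 * M + 4) \<le> Z * (7 * (M * M))" using M1 MM by (intro mult_le_mono2) linarith
    also have "\<dots> = 7 * (Z * (M * M))" by simp
    finally have 1: "Z * (3 * M + 4) \<le> 7 * (Z * (M * M))" .
    have "Z * M * (3 * M + 4) \<le> Z * M * (7 * M)" using M1 by (intro mult_le_mono2) linarith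
    also have "\<dots> = 7 * (Z * (M * M))" by simp
    finally have "(1 + ((3 + Z * (3 * M + 4)) + (3 + Z * M * (3 * M + 4)))) + 1 \<le> 22 * (Z * (M * M))"
      using 1 ZM by linarith
    then have "D * ((1 + ((3 + Z * (3 * M + 4)) + (3 + Z * M * (3 * M + 4)))) + 1) \<le> 3 * (M * M) * (22 * (Z * (M * M)))"
      by (intro mult_le_mono D)
    then show ?thesis by (simp add: mult_ac)
  qed
  have "setup_time \<delta> s n M D Z \<le> 7 * M + 7 * M + 3 * (M * M) + 4 * M + 13 * (M * M) + 66 * ?q + 21"
  proof -
    have "\<delta> * (3 * s + 4) \<le> 7 * M" "\<delta> * s * (3 * n + 4) \<le> 7 * M"
      using le by (simp_all add: algebra_simps)
    moreover have "\<delta> * (3 * \<delta> + 4) \<le> 3 * (M * M) + 4 * M" "\<delta> * \<delta> * (3 * 3 + 4) \<le> 13 * (M * M)"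
      using le by (simp_all add: algebra_simps)
    ultimately show ?thesis unfolding setup_time_def using loop by linarith
  qed
  then have st: "setup_time \<delta> s n M D Z \<le> 121 * ?q" using q q1 MM by linarith
  have pt: "point_time n M D + 6 \<le> 100 * (M * M * M)"
  proof -
    have "(1 + ((3 * M + 3) + ((5 * n + 4) + (3 * M + 3)))) + 1 \<le> 24 * M" using le M1 by linarith
    then have "D * ((1 + ((3 * M + 3) + ((5 * n + 4) + (3 * M + 3)))) + 1) \<le> 3 * (M * M) * (24 * M)"
      by (intro mult_le_mono D)
    also have "\<dots> = 72 * (M * M * M)" by simp
    finally have "point_time n M D \<le> 4 * M + 5 + 72 * (M * M * M)"
      unfolding point_time_def using le by linarith
    moreover have "M \<le> M * M * M" using M1 by simp
    ultimately show ?thesis using M1 by linarith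
  qed
  have "search_time n M D Z \<le> Z * (100 * (M * M * M)) + 1"
    unfolding search_time_def using pt by (intro add_mono mult_le_mono2) auto
  also have "Z * (100 * (M * M * M)) \<le> 100 * ?q"
  proof -
    have "Z * (100 * (M * M * M)) * 1 \<le> Z * (100 * (M * M * M)) * M" by (intro mult_le_mono2 M1)
    then show ?thesis by (simp add: mult_ac)
  qed
  finally have "setup_time \<delta> s n M D Z + (search_time n M D Z + (1 + 1)) \<le> 300 * ?q"
    using st q1 by linarith
  also have "300 * ?q = (300 * M ^ 4) * Z" by (simp add: power4_eq_xxxx)
  also have "\<dots> = (300 * M ^ 4) * (M ^ 6) ^ (\<delta>\<^sup>2)" by (simp add: Z_def D_def flip: power_mult)
  also have "\<dots> \<le> (300 * M ^ 4) ^ (\<delta>\<^sup>2) * (M ^ 6) ^ (\<delta>\<^sup>2)"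
    using pos(1) M1 by (intro mult_le_mono1 self_le_power) auto
  also have "\<dots> = (300 * M ^ 10) ^ (\<delta>\<^sup>2)"
  proof -
    have "300 * M ^ 4 * M ^ 6 = 300 * M ^ 10" by (simp add: mult.assoc flip: power_add)
    then show ?thesis by (simp only: power_mult_distrib[symmetric])
  qed
  also have "300 * M ^ 10 = poly ([:300:] * [:1, 1:] ^ 10) (\<delta> * s * n)"
    by (simp only: M_def poly_mult poly_power poly_pCons poly_0) (simp add: add.commute)
  finally show ?thesis unfolding Z_def .
qed

theorem theorem2:
  shows "\<exists>(P :: prog) (p :: nat poly).
    \<forall>e :: nat \<Rightarrow> 'k::field alg_closure. inj e \<longrightarrow>
      (\<forall>\<delta>\<ge>1. \<forall>s\<ge>1. \<forall>n\<ge>1. \<forall>f :: nat \<Rightarrow> nat \<Rightarrow> 'k mvpoly.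
        is_SPSP_circuit \<delta> 2 s n f \<longrightarrow>
        decides_zero_within e P \<delta> s n (SPSP_poly 2 s f) (poly p (\<delta> * s * n) ^ (\<delta>\<^sup>2)))"
proof (intro exI[of _ blackbox_prog] exI[of _ "[:300:] * [:1, 1:] ^ 10"] allI impI)
  fix e :: "nat \<Rightarrow> 'k alg_closure" and \<delta> s n :: nat and f :: "nat \<Rightarrow> nat \<Rightarrow> 'k mvpoly"
  assume e: "inj e" and pos: "1 \<le> \<delta>" "1 \<le> s" "1 \<le> n" and f: "is_SPSP_circuit \<delta> 2 s n f"
  let ?C = "SPSP_poly 2 s f"
  let ?M = "\<delta> * s * n + 1" and ?D = "3 * \<delta>\<^sup>2"
  define N where "N = fst (initial_mem \<delta> s n :: 'k alg_closure mem)"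
  define F where "F = snd (initial_mem \<delta> s n :: 'k alg_closure mem)"
  have N: "N 0 = \<delta>" "N 1 = s" "N 2 = n" "N 6 = 0" "N 10 = 0"
    by (auto simp: N_def initial_mem_def)
  \<comment> \<open>The circuit uses \<open>n\<close> variables only, so the memory behind a queried
    point does not influence the answer.\<close>
  have B: "eval_ac ?C x = eval_ac ?C y" if "\<And>i. i < n \<Longrightarrow> x i = y i" for x y
    using depends_belowD[OF circuit_pf(1)[OF f], of x y] that by (simp add: evp_mv_pf)
  have hit: "(\<exists>k<?M ^ (2 * ?D). eval_ac ?C (kronecker_pt ?M ?D (e k)) \<noteq> 0) \<longleftrightarrow> ?C \<noteq> 0"
    using hitting_set[OF f pos e] by (auto simp: eval_ac_0)
  have "wp e (eval_ac ?C) blackbox_prog (setup_time \<delta> s n ?M ?D (?M ^ (2 * ?D)) + (search_time n ?M ?D (?M ^ (2 * ?D)) + (1 + 1)))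
    (\<lambda>N' F'. N' 0 = (if \<exists>k<?M ^ (2 * ?D). eval_ac ?C (kronecker_pt ?M ?D (e k)) \<noteq> 0 then 0 else 1)) N F"
    by (rule wp_blackbox_prog[OF N B])
  then obtain t N' F' where t: "exec e (eval_ac ?C) blackbox_prog (N, F) t (N', F')"
      "t \<le> setup_time \<delta> s n ?M ?D (?M ^ (2 * ?D)) + (search_time n ?M ?D (?M ^ (2 * ?D)) + (1 + 1))"
      "N' 0 = (if \<exists>k<?M ^ (2 * ?D). eval_ac ?C (kronecker_pt ?M ?D (e k)) \<noteq> 0 then 0 else 1)"
    unfolding wp_def by blast
  have "exec e (eval_ac ?C) blackbox_prog (initial_mem \<delta> s n) t (N', F')" using t(1) by (simp add: N_def F_def)
  moreover have "t \<le> poly ([:300:] * [:1, 1:] ^ 10) (\<delta> * s * n) ^ (\<delta>\<^sup>2)"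
    using t(2) blackbox_time[OF pos] by (rule order.trans)
  moreover have "N' 0 = (if ?C = 0 then 1 else 0)" using t(3) unfolding hit by simp
  ultimately show "decides_zero_within e blackbox_prog \<delta> s n ?C (poly ([:300:] * [:1, 1:] ^ 10) (\<delta> * s * n) ^ (\<delta>\<^sup>2))"
    unfolding decides_zero_within_def by blast
qed

end
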